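(* Let $n\geq 1$ be an integer, let $p\geq 5$ be a prime, and let $q$ be any prime power. Let $S$ be a Sylow $p$-subgroup of the unitary group $\mathrm{U}_n(\mathbb{F}_q)$. Then $J(S)\leq \mathfrak{X}(S)$.
   Context: For a prime power $q$, $\mathbb{F}_{q^2}$ has the field automorphism $x\mapsto \overline{x}=x^q$ of order $2$; for a matrix $A=(a_{ij})$ write $\overline{A}=(\overline{a_{ij}})$. The unitary group is $\mathrm{U}_n(\mathbb{F}_q)=\{A\in \mathrm{GL}_n(\mathbb{F}_{q^2}) : \overline{A}^{T}A=I_n\}$ (equivalently, up to isomorphism, $\{A : \overline{A}^T Q_n A=Q_n\}$, where $Q_n$ is the $n\times n$ matrix with $1$ on the skew-diagonal and $0$ elsewhere). For a finite $p$-group $S$: the Thompson subgroup $J(S)$ is the subgroup generated by all elementary abelian $p$-subgroups of $S$ whose rank equals the $p$-rank of $S$. Commutators: $[x,y]=x^{-1}y^{-1}xy$, $[X,Y;1]=[X,Y]$, $[X,Y;k]=[[X,Y;k-1],Y]$. $\Omega_1(H)$ is the subgroup generated by elements of order $p$ in $H$. The Oliver subgroup $\mathfrak{X}(S)$ is the unique largest normal subgroup $K$ of $S$ admitting a chain $1=Q_0\leq Q_1\leq\cdots\leq Q_k=K$ of normal subgroups of $S$ such that $[\Omega_1(C_S(Q_{i-1})),Q_i;p-1]=1$ for each $1\leq i\leq k$ (such a chain is called a $Q$-series). *)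

theory Defs
  imports "Jordan_Normal_Form.Matrix" "HOL-Algebra.Algebra" "HOL-Computational_Algebra.Primes"
begin

text \<open>The field F_{q^2} is a finite field type 'a with CARD('a) = q^2; the
 involution is x \<mapsto> x^q.\<close>

definition bar_mat :: "nat \<Rightarrow> 'a::field mat \<Rightarrow> 'a mat" where
  "bar_mat q A = map_mat (\<lambda>x. x ^ q) A"

definition unitary_mats :: "nat \<Rightarrow> nat \<Rightarrow> 'a::field mat set" where
  "unitary_mats q n = {A \<in> carrier_mat n n. transpose_mat (bar_mat q A) * A = 1\<^sub>m n}"

definition unitary_group :: "nat \<Rightarrow> nat \<Rightarrow> 'a::field mat monoid" where
  "unitary_group q n = \<lparr> carrier = unitary_mats q n, monoid.mult = (\<lambda>A B. A * B), one = 1\<^sub>m n \<rparr>"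

definition prime_power :: "nat \<Rightarrow> bool" where
  "prime_power q \<longleftrightarrow> (\<exists>r e. Factorial_Ring.prime (r::nat) \<and> e \<ge> 1 \<and> q = r ^ e)"

definition sylow_subgroup :: "('a, 'b) monoid_scheme \<Rightarrow> nat \<Rightarrow> 'a set \<Rightarrow> bool" where
  "sylow_subgroup G p S \<longleftrightarrow> subgroup S G \<and> card S = p ^ multiplicity p (order G)"

definition elem_abelian_sub :: "('a, 'b) monoid_scheme \<Rightarrow> nat \<Rightarrow> 'a set \<Rightarrow> 'a set \<Rightarrow> bool" where
  "elem_abelian_sub G p S E \<longleftrightarrow> subgroup E G \<and> E \<subseteq> S \<and>
     (\<forall>x\<in>E. \<forall>y\<in>E. x \<otimes>\<^bsub>G\<^esub> y = y \<otimes>\<^bsub>G\<^esub> x) \<and>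
     (\<forall>x\<in>E. x [^]\<^bsub>G\<^esub> p = \<one>\<^bsub>G\<^esub>)"

definition elab_rank :: "nat \<Rightarrow> 'a set \<Rightarrow> nat" where
  "elab_rank p E = multiplicity p (card E)"

definition p_rank :: "('a, 'b) monoid_scheme \<Rightarrow> nat \<Rightarrow> 'a set \<Rightarrow> nat" where
  "p_rank G p S = Max {elab_rank p E | E. elem_abelian_sub G p S E}"

definition thompson_subgroup :: "('a, 'b) monoid_scheme \<Rightarrow> nat \<Rightarrow> 'a set \<Rightarrow> 'a set" where
  "thompson_subgroup G p S = generate G
     (\<Union>{E. elem_abelian_sub G p S E \<and> elab_rank p E = p_rank G p S})"

definition commutator :: "('a, 'b) monoid_scheme \<Rightarrow> 'a \<Rightarrow> 'a \<Rightarrow> 'a" where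
  "commutator G x y = ((m_inv G x \<otimes>\<^bsub>G\<^esub> m_inv G y) \<otimes>\<^bsub>G\<^esub> x) \<otimes>\<^bsub>G\<^esub> y"

definition comm_sub :: "('a, 'b) monoid_scheme \<Rightarrow> 'a set \<Rightarrow> 'a set \<Rightarrow> 'a set" where
  "comm_sub G A B = generate G {c. \<exists>a\<in>A. \<exists>b\<in>B. c = commutator G a b}"

primrec iter_comm :: "('a, 'b) monoid_scheme \<Rightarrow> 'a set \<Rightarrow> 'a set \<Rightarrow> nat \<Rightarrow> 'a set" where
  "iter_comm G A B 0 = A"
| "iter_comm G A B (Suc k) = comm_sub G (iter_comm G A B k) B"

definition Omega1 :: "('a, 'b) monoid_scheme \<Rightarrow> nat \<Rightarrow> 'a set \<Rightarrow> 'a set" where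
  "Omega1 G p H = generate G {x \<in> H. group.ord G x = p}"

definition centralizer_in :: "('a, 'b) monoid_scheme \<Rightarrow> 'a set \<Rightarrow> 'a set \<Rightarrow> 'a set" where
  "centralizer_in G S Q = {x \<in> S. \<forall>y\<in>Q. x \<otimes>\<^bsub>G\<^esub> y = y \<otimes>\<^bsub>G\<^esub> x}"

definition has_Q_series :: "('a, 'b) monoid_scheme \<Rightarrow> nat \<Rightarrow> 'a set \<Rightarrow> 'a set \<Rightarrow> bool" where
  "has_Q_series G p S K \<longleftrightarrow> (\<exists>(Q :: nat \<Rightarrow> 'a set) k.
     Q 0 = {\<one>\<^bsub>G\<^esub>} \<and> Q k = K \<and>
     (\<forall>i\<le>k. Q i \<lhd> (G\<lparr>carrier := S\<rparr>)) \<and>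
     (\<forall>i<k. Q i \<subseteq> Q (Suc i)) \<and>
     (\<forall>i. 1 \<le> i \<and> i \<le> k \<longrightarrow>
        iter_comm G (Omega1 G p (centralizer_in G S (Q (i - 1)))) (Q i) (p - 1) = {\<one>\<^bsub>G\<^esub>}))"

definition oliver_subgroup :: "('a, 'b) monoid_scheme \<Rightarrow> nat \<Rightarrow> 'a set \<Rightarrow> 'a set" where
  "oliver_subgroup G p S = (THE K. K \<lhd> (G\<lparr>carrier := S\<rparr>) \<and> has_Q_series G p S K \<and>
     (\<forall>K'. K' \<lhd> (G\<lparr>carrier := S\<rparr>) \<and> has_Q_series G p S K' \<longrightarrow> K' \<subseteq> K))"

end

theory Submission
  imports Defs "HOL-Library.Function_Algebras" "HOL-Number_Theory.Residues"
    "Jordan_Normal_Form.Determinant"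
begin

text \<open>
  By Thompson's replacement theorem, if \<open>S\<close> normalizes an elementary abelian subgroup \<open>A\<close> and every
  \<open>g \<in> S\<close> with \<open>[A, g, g] = 1\<close> centralizes \<open>A\<close>, then \<open>J(S)\<close> centralizes \<open>A\<close>. It therefore suffices
  to find such an \<open>A\<close> whose centralizer in \<open>S\<close> lies in the Oliver subgroup.

  If \<open>p\<close> does not divide \<open>q\<close>, let \<open>A\<close> consist of the elements of exponent \<open>p\<close> in the centre of
  the Oliver subgroup; its centralizer is the Oliver subgroup. The unitary elements of exponent \<open>p\<close>
  in the double commutant of \<open>A\<close> form a \<open>p\<close>-group normalized by the Sylow group \<open>S\<close>, so they already
  lie in \<open>A\<close>. If \<open>g\<close> acts quadratically on \<open>A\<close> and \<open>z = [v, g] \<noteq> 1\<close>, the projections onto the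
  spaces where \<open>v z\<^sup>i = 1\<close> and \<open>z\<close> has no eigenvalue 1 are permuted cyclically by \<open>g\<close>, and the
  element acting as \<open>z\<close> on just one of them belongs to \<open>A\<close> but violates quadratic action.

  If \<open>p\<close> divides \<open>q\<close>, let \<open>U\<close> be a maximal \<open>S\<close>-invariant totally isotropic subspace and \<open>A\<close> the
  group of isometries that are trivial on \<open>U\<^sup>\<bottom>\<close> and move vectors only by elements of \<open>U\<close>. Testing
  \<open>[A, g, g] = 1\<close> on the transvections \<open>x \<mapsto> x + c h(u, x) u\<close> with \<open>c\<^sup>q = -c\<close> shows that a
  quadratic \<open>g\<close> is trivial on \<open>U\<close>. The centralizer of \<open>A\<close> is the pointwise stabilizer of \<open>U\<close>; it is
  trivial on the quotients of \<open>0 \<le> U \<le> U\<^sup>\<bottom> \<le> W\<close>, so it has class at most 2, and \<open>3 < p\<close>.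
\<close>

hide_const (open) Polynomial.order Divisibility.prime
hide_fact (open) Polynomial.order_def

section \<open>Actions of p-groups\<close>

definition p_group :: "nat \<Rightarrow> ('a, 'b) monoid_scheme \<Rightarrow> bool" where
  "p_group p G \<longleftrightarrow> group G \<and> (\<exists>k. order G = p ^ k)"

lemma p_groupD:
  assumes "p_group p G"
  shows "group G" "\<exists>k. order G = p ^ k"
  using assms by (auto simp: p_group_def)

lemma p_group_imp_finite:
  assumes "p_group p G" "prime p"
  shows "finite (carrier G)"
  using assms by (metis card.infinite order_def p_groupD(2) power_eq_0_iff not_prime_0)

lemma p_group_subgroup:
  assumes G: "p_group p G" and p: "prime p" and H: "subgroup H G"
  shows "p_group p (G\<lparr>carrier := H\<rparr>)"
proof -
  interpret group G using p_groupD(1)[OF G] .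
  have "card H dvd order G" using lagrange[OF H] by (metis dvd_triv_right)
  then show ?thesis
    using H p_groupD(2)[OF G] p divides_primepow_nat
    by (auto simp: p_group_def order_def intro: subgroup_imp_group)
qed

lemma p_group_dvd_index:
  assumes G: "p_group p G" and p: "prime p" and H: "subgroup H G" "H \<noteq> carrier G"
  shows "p dvd card (rcosets\<^bsub>G\<^esub> H)"
proof -
  interpret group G using p_groupD(1)[OF G] .
  note lagrange = lagrange[OF H(1)]
  obtain i where i: "card (rcosets\<^bsub>G\<^esub> H) = p ^ i"
    using lagrange p_groupD(2)[OF G] p divides_primepow_nat by (metis dvd_triv_left)
  have "card (rcosets\<^bsub>G\<^esub> H) \<noteq> 1"
    using lagrange H subgroup.subset[OF H(1)] p_group_imp_finite[OF G p]
    by (auto simp: order_def dest: card_subset_eq)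
  then have "i \<noteq> 0" using i by auto
  then show ?thesis using i by simp
qed

lemma (in group_action) orbit_eq_singleton_iff:
  "orbit G \<phi> x = {x} \<longleftrightarrow> (\<forall>g\<in>carrier G. \<phi> g x = x)"
proof
  show "\<forall>g\<in>carrier G. \<phi> g x = x" if "orbit G \<phi> x = {x}"
    using that unfolding orbit_def by blast
  interpret group G using group_hom group_hom.axioms(1) by blast
  show "orbit G \<phi> x = {x}" if "\<forall>g\<in>carrier G. \<phi> g x = x"
    using that one_closed unfolding orbit_def by force
qed

lemma p_group_dvd_card_orbit:
  assumes act: "group_action P E \<phi>" and P: "p_group p P" and p: "prime p"
    and y: "y \<in> E" "orbit P \<phi> y \<noteq> {y}"
  shows "p dvd card (orbit P \<phi> y)"
proof -
  interpret group_action P E \<phi> by fact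
  have "card (orbit P \<phi> y) dvd order P"
    using orbit_stabilizer_theorem[OF y(1)] by (metis dvd_triv_left)
  then obtain i where i: "card (orbit P \<phi> y) = p ^ i"
    using p p_groupD(2)[OF P] divides_primepow_nat by metis
  have "card (orbit P \<phi> y) \<noteq> 1"
    using y(2) orbit_refl[OF y(1)] by (auto simp: card_1_singleton_iff)
  then show ?thesis using i by (cases i) auto
qed

theorem p_group_action_cong_card_fixed_points:
  assumes act: "group_action P E \<phi>" and P: "p_group p P" and p: "prime p" and E: "finite E"
  shows "[card E = card {x \<in> E. \<forall>g\<in>carrier P. \<phi> g x = x}] (mod p)"
proof -
  interpret group_action P E \<phi> by fact
  define fixed where "fixed x \<longleftrightarrow> (\<forall>g\<in>carrier P. \<phi> g x = x)" for x
  have fixed_iff: "fixed x \<longleftrightarrow> orbit P \<phi> x = {x}" for x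
    by (simp add: fixed_def orbit_eq_singleton_iff)
  have orbit_cong: "[(\<Sum>x\<in>Y. 1) = (\<Sum>x\<in>Y. of_bool (fixed x))] (mod p)"
    if "Y \<in> orbits P E \<phi>" for Y
  proof -
    obtain y where y: "y \<in> E" "Y = orbit P \<phi> y" using \<open>Y \<in> _\<close> unfolding orbits_def by auto
    show ?thesis
    proof (cases "fixed y")
      case True
      then show ?thesis using y fixed_iff[of y] by (simp add: cong_def)
    next
      case False
      then have "p dvd card Y" using p_group_dvd_card_orbit[OF act P p y(1)] y(2) fixed_iff by simp
      moreover have "\<not> fixed x" if x: "x \<in> Y" for x
      proof
        assume "fixed x"
        have "x \<in> E" using x y element_image unfolding orbit_def by auto
        then have "y \<in> orbit P \<phi> x" using orbit_sym y x by blast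
        then show False using \<open>fixed x\<close> fixed_iff[of x] False by simp
      qed
      ultimately show ?thesis by (simp add: cong_0_iff)
    qed
  qed
  have "card E = (\<Sum>Y\<in>orbits P E \<phi>. \<Sum>x\<in>Y. 1)"
    using disjoint_sum[OF E, of "\<lambda>_. 1::nat"] by simp
  also have "[\<dots> = (\<Sum>Y\<in>orbits P E \<phi>. \<Sum>x\<in>Y. of_bool (fixed x))] (mod p)"
    by (rule cong_sum) (rule orbit_cong)
  also have "(\<Sum>Y\<in>orbits P E \<phi>. \<Sum>x\<in>Y. of_bool (fixed x)) = (\<Sum>x\<in>E. of_bool (fixed x) :: nat)"
    by (rule disjoint_sum[OF E])
  also have "\<dots> = card {x \<in> E. \<forall>g\<in>carrier P. \<phi> g x = x}"
    using E by (simp add: fixed_def Int_def)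
  finally show ?thesis .
qed

locale automorphism_action = P: group P + M: group M
  for P :: "('a, 'c) monoid_scheme" (structure)
    and M :: "('b, 'd) monoid_scheme" (structure) +
  fixes act :: "'a \<Rightarrow> 'b \<Rightarrow> 'b"
  assumes act_closed: "\<lbrakk>s \<in> carrier P; x \<in> carrier M\<rbrakk> \<Longrightarrow> act s x \<in> carrier M"
    and act_mult: "\<lbrakk>s \<in> carrier P; x \<in> carrier M; y \<in> carrier M\<rbrakk> \<Longrightarrow>
      act s (x \<otimes>\<^bsub>M\<^esub> y) = act s x \<otimes>\<^bsub>M\<^esub> act s y"
    and act_one: "x \<in> carrier M \<Longrightarrow> act \<one>\<^bsub>P\<^esub> x = x"
    and act_comp: "\<lbrakk>s \<in> carrier P; t \<in> carrier P; x \<in> carrier M\<rbrakk> \<Longrightarrow>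
      act (s \<otimes>\<^bsub>P\<^esub> t) x = act s (act t x)"
begin

context
  fixes H
  assumes H: "subgroup H M" and act_H: "\<And>s h. \<lbrakk>s \<in> carrier P; h \<in> H\<rbrakk> \<Longrightarrow> act s h \<in> H"
begin

lemma act_r_coset:
  assumes s: "s \<in> carrier P" and x: "x \<in> carrier M"
  shows "act s ` (H #>\<^bsub>M\<^esub> x) = H #>\<^bsub>M\<^esub> act s x"
proof
  note H_carrier = subgroup.mem_carrier[OF H]
  show "act s ` (H #>\<^bsub>M\<^esub> x) \<subseteq> H #>\<^bsub>M\<^esub> act s x"
    using s x act_mult act_H H_carrier by (force simp: r_coset_def)
  show "H #>\<^bsub>M\<^esub> act s x \<subseteq> act s ` (H #>\<^bsub>M\<^esub> x)"
  proof
    fix y assume "y \<in> H #>\<^bsub>M\<^esub> act s x"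
    then obtain h where h: "h \<in> H" "y = h \<otimes>\<^bsub>M\<^esub> act s x" by (auto simp: r_coset_def)
    let ?h = "act (inv\<^bsub>P\<^esub> s) h"
    have "?h \<in> H" using act_H h s by simp
    moreover have "act s ?h = h" using act_comp[of s "inv\<^bsub>P\<^esub> s" h] s h H_carrier act_one by auto
    then have "act s (?h \<otimes>\<^bsub>M\<^esub> x) = y" using act_mult[of s ?h x] s x h \<open>?h \<in> H\<close> H_carrier by auto
    ultimately show "y \<in> act s ` (H #>\<^bsub>M\<^esub> x)" by (force simp: r_coset_def)
  qed
qed

lemma rcosets_action: "group_action P (rcosets\<^bsub>M\<^esub> H) (\<lambda>s. \<lambda>C\<in>rcosets\<^bsub>M\<^esub> H. act s ` C)"
proof -
  let ?E = "rcosets\<^bsub>M\<^esub> H"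
  let ?\<phi> = "\<lambda>s. \<lambda>C\<in>?E. act s ` C"
  have closed: "act s ` C \<in> ?E" if "s \<in> carrier P" "C \<in> ?E" for s C
    using that act_r_coset act_closed by (force simp: RCOSETS_def)
  have mem_carrier: "x \<in> carrier M" if "C \<in> ?E" "x \<in> C" for x C
    using that M.rcosets_part_G[OF H] by blast
  have comp: "act (s \<otimes>\<^bsub>P\<^esub> t) ` C = act s ` act t ` C"
    if "s \<in> carrier P" "t \<in> carrier P" "C \<in> ?E" for s t C
    unfolding image_image by (rule image_cong) (use that act_comp mem_carrier in simp_all)
  have one: "act \<one>\<^bsub>P\<^esub> ` C = C" if "C \<in> ?E" for C
    using image_cong[of C C "act \<one>\<^bsub>P\<^esub>" "\<lambda>x. x"] that act_one mem_carrier by simp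
  have Bij: "?\<phi> s \<in> Bij ?E" if "s \<in> carrier P" for s
  proof -
    have "bij_betw (?\<phi> s) ?E ?E"
      by (rule bij_betw_byWitness[where f' = "?\<phi> (inv\<^bsub>P\<^esub> s)"])
        (use that closed comp[symmetric] one in auto)
    then show ?thesis by (simp add: Bij_def)
  qed
  have "?\<phi> \<in> hom P (BijGroup ?E)"
    using Bij closed comp by (intro homI) (auto simp: BijGroup_def compose_def intro!: ext)
  then show ?thesis
    unfolding group_action_def group_hom_def group_hom_axioms_def
    using P.is_group group_BijGroup by blast
qed

text \<open>The fixed points of \<open>P\<close> on \<open>M/H\<close> are counted modulo \<open>p\<close> by the index of \<open>H\<close>, so besides
  the coset \<open>H\<close> there is another one.\<close>

lemma exists_fixed_modulo:
  assumes p: "prime p" and P: "p_group p P" and M: "p_group p M" and proper: "H \<noteq> carrier M"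
  shows "\<exists>x\<in>carrier M - H. \<forall>s\<in>carrier P. act s x \<otimes>\<^bsub>M\<^esub> inv\<^bsub>M\<^esub> x \<in> H"
proof -
  let ?E = "rcosets\<^bsub>M\<^esub> H"
  define F where "F = {C \<in> ?E. \<forall>s\<in>carrier P. act s ` C = C}"
  have "finite ?E"
    using M.rcosets_part_G[OF H] p_group_imp_finite[OF M p] by (metis finite_UnionD)
  moreover have "F = {C \<in> ?E. \<forall>s\<in>carrier P. (\<lambda>C\<in>?E. act s ` C) C = C}" unfolding F_def by auto
  ultimately have "[card ?E = card F] (mod p)"
    using p_group_action_cong_card_fixed_points[OF rcosets_action P p] by simp
  then have dvd: "p dvd card F"
    using p_group_dvd_index[OF M p H proper] by (simp add: cong_dvd_iff)
  have "act s \<one>\<^bsub>M\<^esub> = \<one>\<^bsub>M\<^esub>" if "s \<in> carrier P" for s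
    using that act_mult[of s "\<one>\<^bsub>M\<^esub>" "\<one>\<^bsub>M\<^esub>"] act_closed[of s "\<one>\<^bsub>M\<^esub>"] by (simp add: M.r_cancel_one')
  then have H_in_F: "H \<in> F"
    using act_r_coset[of _ "\<one>\<^bsub>M\<^esub>"] M.coset_mult_one[OF subgroup.subset[OF H]]
      M.rcosetsI[OF subgroup.subset[OF H] M.one_closed] by (simp add: F_def)
  have "F \<noteq> {H}" using dvd p by (auto simp: prime_nat_iff)
  then obtain C where C: "C \<in> F" "C \<noteq> H" using H_in_F by blast
  then obtain x where x: "x \<in> carrier M" "C = H #>\<^bsub>M\<^esub> x" by (auto simp: F_def RCOSETS_def)
  have "x \<notin> H" using C(2) x H M.coset_join2 by blast
  moreover have "act s x \<otimes>\<^bsub>M\<^esub> inv\<^bsub>M\<^esub> x \<in> H" if s: "s \<in> carrier P" for s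
  proof -
    have "H #>\<^bsub>M\<^esub> act s x = H #>\<^bsub>M\<^esub> x" using C(1) x s act_r_coset by (auto simp: F_def)
    then have "act s x \<in> H #>\<^bsub>M\<^esub> x" using M.rcos_self[OF act_closed[OF s x(1)] H] by simp
    then show ?thesis using subgroup.rcos_module_imp[OF H M.is_group x(1)] by blast
  qed
  ultimately show ?thesis using x(1) by blast
qed

end

end

section \<open>Normalizers, centralizers and products of subgroups\<close>

context group
begin

lemma inv_mult_cancel:
  assumes "x \<in> carrier G" "y \<in> carrier G"
  shows "inv x \<otimes> (x \<otimes> y) = y" "x \<otimes> (inv x \<otimes> y) = y"
  using assms by (simp_all add: m_assoc[symmetric])

lemmas word_simps = m_assoc inv_mult_group inv_mult_cancel

lemma conjugate_eq_iff_commute: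
  assumes "x \<in> carrier G" "y \<in> carrier G"
  shows "x \<otimes> y \<otimes> inv x = y \<longleftrightarrow> x \<otimes> y = y \<otimes> x"
  using assms by (metis inv_solve_right m_closed)

lemma inv_commute:
  assumes "x \<in> carrier G" "y \<in> carrier G" "x \<otimes> y = y \<otimes> x"
  shows "inv x \<otimes> y = y \<otimes> inv x"
  using assms by (metis inv_closed inv_solve_left' inv_solve_right' m_assoc m_closed)

lemma commute_mult:
  assumes "x \<in> carrier G" "y \<in> carrier G" "z \<in> carrier G" "x \<otimes> y = y \<otimes> x" "x \<otimes> z = z \<otimes> x"
  shows "x \<otimes> (y \<otimes> z) = y \<otimes> z \<otimes> x"
proof -
  have "x \<otimes> (y \<otimes> z) = x \<otimes> y \<otimes> z" using assms(1-3) by (simp add: m_assoc)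
  also have "\<dots> = y \<otimes> (x \<otimes> z)" unfolding assms(4) using assms(1-3) by (simp add: m_assoc)
  also have "\<dots> = y \<otimes> z \<otimes> x" unfolding assms(5) using assms(1-3) by (simp add: m_assoc)
  finally show ?thesis .
qed

lemma conjugate_pow:
  assumes "x \<in> carrier G" "y \<in> carrier G"
  shows "(x \<otimes> y \<otimes> inv x) [^] (k::nat) = x \<otimes> y [^] k \<otimes> inv x"
  using assms by (induction k) (simp_all add: word_simps)

lemma conjugate_set_eq_image: "x <# H #> inv x = (\<lambda>h. x \<otimes> h \<otimes> inv x) ` H"
  by (auto simp: l_coset_def r_coset_def)

lemma mem_normalizer_iff_conjugate_set:
  assumes "H \<subseteq> carrier G"
  shows "x \<in> normalizer G H \<longleftrightarrow> x \<in> carrier G \<and> x <# H #> inv x = H"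
  using assms by (auto simp: normalizer_def stabilizer_def)

lemma mem_normalizer_iff:
  assumes H: "H \<subseteq> carrier G"
  shows "x \<in> normalizer G H \<longleftrightarrow>
    x \<in> carrier G \<and> (\<forall>h\<in>H. x \<otimes> h \<otimes> inv x \<in> H \<and> inv x \<otimes> h \<otimes> x \<in> H)"
proof -
  have "(\<lambda>h. x \<otimes> h \<otimes> inv x) ` H = H \<longleftrightarrow> (\<forall>h\<in>H. x \<otimes> h \<otimes> inv x \<in> H \<and> inv x \<otimes> h \<otimes> x \<in> H)"
    if x: "x \<in> carrier G"
  proof -
    have "h \<in> (\<lambda>h. x \<otimes> h \<otimes> inv x) ` H \<longleftrightarrow> inv x \<otimes> h \<otimes> x \<in> H" if "h \<in> H" for h
    proof -
      have "x \<otimes> (inv x \<otimes> h \<otimes> x) \<otimes> inv x = h" using x that H by (simp add: word_simps subset_iff)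
      moreover have "inv x \<otimes> (x \<otimes> k \<otimes> inv x) \<otimes> x = k" if "k \<in> H" for k
        using x that H by (simp add: word_simps subset_iff)
      ultimately show ?thesis by force
    qed
    then show ?thesis by blast
  qed
  then show ?thesis unfolding mem_normalizer_iff_conjugate_set[OF H] conjugate_set_eq_image by blast
qed

lemma normalizer_closed:
  assumes "x \<in> normalizer G H" "H \<subseteq> carrier G" "h \<in> H"
  shows "x \<otimes> h \<otimes> inv x \<in> H" "inv x \<otimes> h \<otimes> x \<in> H"
  using assms mem_normalizer_iff by auto

lemma subset_normalizerI:
  assumes S: "subgroup S G" and H: "H \<subseteq> carrier G"
    and closed: "\<And>s h. \<lbrakk>s \<in> S; h \<in> H\<rbrakk> \<Longrightarrow> s \<otimes> h \<otimes> inv s \<in> H"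
  shows "S \<subseteq> normalizer G H"
  unfolding mem_normalizer_iff[OF H] subset_iff
  using closed subgroup.mem_carrier[OF S] subgroup.m_inv_closed[OF S]
  by (metis inv_inv)

lemma subgroup_subset_normalizer:
  assumes "subgroup H G"
  shows "H \<subseteq> normalizer G H"
  using assms
  by (intro subset_normalizerI) (auto simp: subgroup.subset subgroup.m_closed subgroup.m_inv_closed)

lemma normalizer_Int:
  assumes "H \<subseteq> carrier G" "K \<subseteq> carrier G"
  shows "normalizer G H \<inter> normalizer G K \<subseteq> normalizer G (H \<inter> K)"
  using assms by (auto simp: mem_normalizer_iff le_infI1)

lemma normal_in_subgroup_iff:
  assumes S: "subgroup S G"
  shows "K \<lhd> G\<lparr>carrier := S\<rparr> \<longleftrightarrow> subgroup K G \<and> K \<subseteq> S \<and> S \<subseteq> normalizer G K"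
proof -
  interpret GS: group "G\<lparr>carrier := S\<rparr>" using S subgroup_imp_group by blast
  have "subgroup K (G\<lparr>carrier := S\<rparr>) \<longleftrightarrow> subgroup K G \<and> K \<subseteq> S"
    using incl_subgroup[OF S] subgroup_incl[OF _ S] subgroup.subset by fastforce
  moreover have "(\<forall>s\<in>S. \<forall>k\<in>K. s \<otimes> k \<otimes> inv\<^bsub>G\<lparr>carrier := S\<rparr>\<^esub> s \<in> K) \<longleftrightarrow> S \<subseteq> normalizer G K"
    if "subgroup K G"
    using m_inv_consistent[OF S] subgroup.subset[OF that] subset_normalizerI[OF S]
      normalizer_closed(1)
    by (metis subsetD)
  ultimately show ?thesis unfolding GS.normal_inv_iff by auto
qed

lemma mem_set_mult_iff: "x \<in> H <#> K \<longleftrightarrow> (\<exists>h\<in>H. \<exists>k\<in>K. x = h \<otimes> k)"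
  by (auto simp: set_mult_def)

lemma set_mult_memI: "\<lbrakk>h \<in> H; k \<in> K\<rbrakk> \<Longrightarrow> h \<otimes> k \<in> H <#> K"
  by (auto simp: set_mult_def)

lemma commute_set_mult:
  assumes "x \<in> carrier G" "H \<subseteq> carrier G" "K \<subseteq> carrier G"
    and "\<And>h. h \<in> H \<Longrightarrow> x \<otimes> h = h \<otimes> x" "\<And>k. k \<in> K \<Longrightarrow> x \<otimes> k = k \<otimes> x" and "y \<in> H <#> K"
  shows "x \<otimes> y = y \<otimes> x"
  using assms commute_mult unfolding mem_set_mult_iff by blast

lemma subset_set_mult:
  assumes "subgroup H G" "subgroup K G"
  shows "H \<subseteq> H <#> K" "K \<subseteq> H <#> K"
proof -
  have "h = h \<otimes> \<one>" if "h \<in> H" for h using assms(1) that by (simp add: subgroup.mem_carrier)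
  then show "H \<subseteq> H <#> K"
    using subgroup.one_closed[OF assms(2)] unfolding mem_set_mult_iff subset_iff by blast
  have "k = \<one> \<otimes> k" if "k \<in> K" for k using assms(2) that by (simp add: subgroup.mem_carrier)
  then show "K \<subseteq> H <#> K"
    using subgroup.one_closed[OF assms(1)] unfolding mem_set_mult_iff subset_iff by blast
qed

lemma set_mult_subset_subgroup:
  assumes "subgroup S G" "H \<subseteq> S" "K \<subseteq> S"
  shows "H <#> K \<subseteq> S"
  using assms subgroup.m_closed by (fastforce simp: mem_set_mult_iff)

lemma subgroup_set_mult:
  assumes H: "subgroup H G" and K: "subgroup K G" and norm: "K \<subseteq> normalizer G H"
  shows "subgroup (H <#> K) G"
proof -
  have N: "subgroup (normalizer G H) G" using normalizer_imp_subgroup[OF subgroup.subset[OF H]] .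
  have "subgroup (H <#> K) (G\<lparr>carrier := normalizer G H\<rparr>)"
    using mult_norm_sub_in_sub[OF subgroup_in_normalizer[OF H] _ N] subgroup_incl[OF K N norm] .
  then show ?thesis using incl_subgroup[OF N] by blast
qed

lemma normalizer_set_mult:
  assumes "H \<subseteq> carrier G" "K \<subseteq> carrier G"
  shows "normalizer G H \<inter> normalizer G K \<subseteq> normalizer G (H <#> K)"
proof
  fix x assume x: "x \<in> normalizer G H \<inter> normalizer G K"
  then have x_carrier: "x \<in> carrier G" using mem_normalizer_iff[OF assms(1)] by blast
  have "x \<otimes> (h \<otimes> k) \<otimes> inv x \<in> H <#> K" "inv x \<otimes> (h \<otimes> k) \<otimes> x \<in> H <#> K"
    if hk: "h \<in> H" "k \<in> K" for h k
  proof -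
    have in_carrier: "h \<in> carrier G" "k \<in> carrier G" using assms hk by auto
    have "x \<otimes> (h \<otimes> k) \<otimes> inv x = (x \<otimes> h \<otimes> inv x) \<otimes> (x \<otimes> k \<otimes> inv x)"
      "inv x \<otimes> (h \<otimes> k) \<otimes> x = (inv x \<otimes> h \<otimes> x) \<otimes> (inv x \<otimes> k \<otimes> x)"
      using in_carrier x_carrier by (simp_all add: word_simps)
    moreover have "x \<otimes> h \<otimes> inv x \<in> H" "x \<otimes> k \<otimes> inv x \<in> K" "inv x \<otimes> h \<otimes> x \<in> H" "inv x \<otimes> k \<otimes> x \<in> K"
      using x hk normalizer_closed assms by blast+
    ultimately show "x \<otimes> (h \<otimes> k) \<otimes> inv x \<in> H <#> K" "inv x \<otimes> (h \<otimes> k) \<otimes> x \<in> H <#> K"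
      by (auto simp: mem_set_mult_iff)
  qed
  then show "x \<in> normalizer G (H <#> K)"
    using x_carrier mem_normalizer_iff[OF set_mult_closed[OF assms]]
    by (auto simp: mem_set_mult_iff)
qed

lemma bij_betw_set_mult_fibre:
  assumes H: "subgroup H G" and K: "subgroup K G" and hk: "h \<in> H" "k \<in> K"
  shows "bij_betw (\<lambda>y. (h \<otimes> y, inv y \<otimes> k)) (H \<inter> K) {(h', k') \<in> H \<times> K. h' \<otimes> k' = h \<otimes> k}"
    (is "bij_betw ?shift _ ?fibre")
proof (rule bij_betw_imageI)
  note H_carrier = subgroup.mem_carrier[OF H] and K_carrier = subgroup.mem_carrier[OF K]
  show "inj_on ?shift (H \<inter> K)" using hk H_carrier by (auto simp: inj_on_def)
  show "?shift ` (H \<inter> K) = ?fibre"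
  proof (intro equalityI subsetI)
    fix a assume "a \<in> ?shift ` (H \<inter> K)"
    then obtain y where y: "y \<in> H" "y \<in> K" "a = (h \<otimes> y, inv y \<otimes> k)" by blast
    then have "h \<otimes> y \<otimes> (inv y \<otimes> k) = h \<otimes> k" using hk H_carrier K_carrier by (simp add: word_simps)
    then show "a \<in> ?fibre"
      using y hk H K by (simp add: subgroup.m_closed subgroup.m_inv_closed)
  next
    fix a assume "a \<in> ?fibre"
    then obtain h' k' where a: "a = (h', k')" "h' \<in> H" "k' \<in> K" "h' \<otimes> k' = h \<otimes> k" by blast
    have in_carrier: "h \<in> carrier G" "k \<in> carrier G" "h' \<in> carrier G" "k' \<in> carrier G"
      using a hk H_carrier K_carrier by auto
    define y where "y = inv h \<otimes> h'"
    have y: "y = k \<otimes> inv k'"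
      using in_carrier a(4)
      unfolding y_def by (metis inv_closed inv_solve_left inv_solve_right m_assoc m_closed)
    have "y \<in> H" unfolding y_def using a hk H by (simp add: subgroup.m_closed subgroup.m_inv_closed)
    moreover have "y \<in> K"
      unfolding y using a hk K by (simp add: subgroup.m_closed subgroup.m_inv_closed)
    moreover have "h \<otimes> y = h'" unfolding y_def using in_carrier by (simp add: word_simps)
    moreover have "inv y \<otimes> k = k'" unfolding y using in_carrier by (simp add: word_simps)
    ultimately show "a \<in> ?shift ` (H \<inter> K)" using a(1) by blast
  qed
qed

theorem card_set_mult:
  assumes H: "subgroup H G" "finite H" and K: "subgroup K G" "finite K"
  shows "card (H <#> K) * card (H \<inter> K) = card H * card K"
proof -
  let ?f = "\<lambda>(h, k). h \<otimes> k"
  have image: "?f ` (H \<times> K) = H <#> K" by (auto simp: set_mult_def)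
  have fibre: "card {a \<in> H \<times> K. ?f a = x} = card (H \<inter> K)" if "x \<in> H <#> K" for x
  proof -
    have "\<exists>h\<in>H. \<exists>k\<in>K. x = h \<otimes> k" using that by (simp add: mem_set_mult_iff)
    then obtain h k where hk: "h \<in> H" "k \<in> K" "x = h \<otimes> k" by blast
    have "{a \<in> H \<times> K. ?f a = x} = {(h', k') \<in> H \<times> K. h' \<otimes> k' = h \<otimes> k}" using hk(3) by auto
    then show ?thesis
      using bij_betw_same_card[OF bij_betw_set_mult_fibre[OF H(1) K(1) hk(1,2)]] by simp
  qed
  have "card H * card K = (\<Sum>a\<in>H \<times> K. 1)" by (simp add: card_cartesian_product)
  also have "\<dots> = (\<Sum>x\<in>?f ` (H \<times> K). \<Sum>a\<in>{a \<in> H \<times> K. ?f a = x}. 1)"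
    using H K by (intro sum.image_gen) auto
  also have "\<dots> = (\<Sum>x\<in>H <#> K. card (H \<inter> K))" using fibre image by (intro sum.cong) simp_all
  finally show ?thesis by simp
qed

lemma centralizer_in_subset: "centralizer_in G S A \<subseteq> S"
  by (auto simp: centralizer_in_def)

lemma centralizer_in_commute:
  "\<lbrakk>x \<in> centralizer_in G S A; a \<in> A\<rbrakk> \<Longrightarrow> x \<otimes> a = a \<otimes> x"
  by (simp add: centralizer_in_def)

lemma centralizer_in_antimono: "A \<subseteq> B \<Longrightarrow> centralizer_in G S B \<subseteq> centralizer_in G S A"
  by (auto simp: centralizer_in_def)

lemma subgroup_centralizer_in:
  assumes S: "subgroup S G" and A: "A \<subseteq> carrier G"
  shows "subgroup (centralizer_in G S A) G"
proof (rule subgroupI)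
  note S_carrier = subgroup.mem_carrier[OF S]
  show "centralizer_in G S A \<subseteq> carrier G" using S_carrier by (auto simp: centralizer_in_def)
  have "\<one> \<in> centralizer_in G S A"
    using subgroup.one_closed[OF S] A by (auto simp: centralizer_in_def)
  then show "centralizer_in G S A \<noteq> {}" by blast
  fix x assume x: "x \<in> centralizer_in G S A"
  then show "inv x \<in> centralizer_in G S A"
    using inv_commute S_carrier A subgroup.m_inv_closed[OF S]
    by (auto simp: centralizer_in_def subset_iff)
  fix z assume z: "z \<in> centralizer_in G S A"
  have "y \<otimes> (x \<otimes> z) = x \<otimes> z \<otimes> y" if y: "y \<in> A" for y
    using x z y A S_carrier by (intro commute_mult) (auto simp: centralizer_in_def)
  then show "x \<otimes> z \<in> centralizer_in G S A"
    using x z subgroup.m_closed[OF S] by (auto simp: centralizer_in_def)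
qed

lemma normalizer_centralizer_in:
  assumes S: "subgroup S G" and A: "A \<subseteq> carrier G" and norm: "S \<subseteq> normalizer G A"
  shows "S \<subseteq> normalizer G (centralizer_in G S A)"
proof (rule subset_normalizerI[OF S subgroup.subset[OF subgroup_centralizer_in[OF S A]]])
  fix s x assume s: "s \<in> S" and x: "x \<in> centralizer_in G S A"
  have in_carrier: "s \<in> carrier G" "x \<in> carrier G"
    using s x subgroup.mem_carrier[OF S] by (auto simp: centralizer_in_def)
  have "s \<otimes> x \<otimes> inv s \<otimes> y = y \<otimes> (s \<otimes> x \<otimes> inv s)" if y: "y \<in> A" for y
  proof -
    have y_carrier: "y \<in> carrier G" using y A by auto
    have "inv s \<otimes> y \<otimes> s \<in> A" using normalizer_closed(2) norm s A y by blast
    then have "x \<otimes> (inv s \<otimes> y \<otimes> s) = (inv s \<otimes> y \<otimes> s) \<otimes> x" by (rule centralizer_in_commute[OF x])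
    then have "s \<otimes> (x \<otimes> (inv s \<otimes> y \<otimes> s)) \<otimes> inv s = s \<otimes> ((inv s \<otimes> y \<otimes> s) \<otimes> x) \<otimes> inv s" by simp
    then show ?thesis using in_carrier y_carrier by (simp add: word_simps)
  qed
  then show "s \<otimes> x \<otimes> inv s \<in> centralizer_in G S A"
    using s x subgroup.m_closed[OF S] subgroup.m_inv_closed[OF S] by (auto simp: centralizer_in_def)
qed

lemma conjugation_automorphism_action:
  assumes S: "subgroup S G" and M: "subgroup M G" "S \<subseteq> normalizer G M"
  shows "automorphism_action (G\<lparr>carrier := S\<rparr>) (G\<lparr>carrier := M\<rparr>) (\<lambda>s x. s \<otimes> x \<otimes> inv s)"
proof -
  note S_carrier = subgroup.mem_carrier[OF S] and M_carrier = subgroup.mem_carrier[OF M(1)]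
  have "s \<otimes> x \<otimes> inv s \<in> M" if "s \<in> S" "x \<in> M" for s x
    using that M(2) normalizer_closed(1)[OF _ subgroup.subset[OF M(1)]] by blast
  moreover have "s \<otimes> (x \<otimes> y) \<otimes> inv s = (s \<otimes> x \<otimes> inv s) \<otimes> (s \<otimes> y \<otimes> inv s)"
    if "s \<in> S" "x \<in> M" "y \<in> M" for s x y
    using S_carrier[OF that(1)] M_carrier[OF that(2)] M_carrier[OF that(3)]
    by (simp add: word_simps)
  moreover have "s \<otimes> t \<otimes> x \<otimes> inv (s \<otimes> t) = s \<otimes> (t \<otimes> x \<otimes> inv t) \<otimes> inv s"
    if "s \<in> S" "t \<in> S" "x \<in> M" for s t x
    using that S_carrier M_carrier by (simp add: word_simps)
  ultimately show ?thesis
    using subgroup_imp_group[OF S] subgroup_imp_group[OF M(1)] M_carrier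
    by (simp add: automorphism_action_def automorphism_action_axioms_def)
qed

lemma p_group_exists_centralized_modulo:
  assumes p: "prime p" and S: "subgroup S G" "p_group p (G\<lparr>carrier := S\<rparr>)"
    and M: "subgroup M G" "p_group p (G\<lparr>carrier := M\<rparr>)" "S \<subseteq> normalizer G M"
    and H: "subgroup H G" "H \<subset> M" "S \<subseteq> normalizer G H"
  shows "\<exists>x\<in>M - H. \<forall>s\<in>S. s \<otimes> x \<otimes> inv s \<otimes> inv x \<in> H"
proof -
  interpret automorphism_action "G\<lparr>carrier := S\<rparr>" "G\<lparr>carrier := M\<rparr>" "\<lambda>s x. s \<otimes> x \<otimes> inv s"
    using conjugation_automorphism_action[OF S(1) M(1,3)] .
  have subgroup_H_M: "subgroup H (G\<lparr>carrier := M\<rparr>)" using subgroup_incl[OF H(1) M(1)] H(2) by blast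
  moreover have "s \<otimes> h \<otimes> inv s \<in> H" if "s \<in> carrier (G\<lparr>carrier := S\<rparr>)" "h \<in> H" for s h
    using that H(3) normalizer_closed(1)[OF _ subgroup.subset[OF H(1)]] by auto
  moreover have "H \<noteq> carrier (G\<lparr>carrier := M\<rparr>)" using H(2) by auto
  ultimately have "\<exists>x\<in>M - H. \<forall>s\<in>S. s \<otimes> x \<otimes> inv s \<otimes> inv\<^bsub>G\<lparr>carrier := M\<rparr>\<^esub> x \<in> H"
    using exists_fixed_modulo[OF subgroup_H_M _ p S(2) M(2)] by simp
  then show ?thesis using m_inv_consistent[OF M(1)] by (metis DiffD1)
qed

lemma p_group_if_exponent_p:
  assumes p: "prime p" and D: "subgroup D G" "finite D" and exponent: "\<And>x. x \<in> D \<Longrightarrow> x [^] p = \<one>"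
  shows "p_group p (G\<lparr>carrier := D\<rparr>)"
proof -
  interpret D: group "G\<lparr>carrier := D\<rparr>" using D subgroup_imp_group by blast
  have "r = p" if r: "prime r" "r dvd card D" for r
  proof -
    obtain m where "order (G\<lparr>carrier := D\<rparr>) = r ^ 1 * m" using r(2) by (auto simp: order_def)
    then obtain H where H: "subgroup H (G\<lparr>carrier := D\<rparr>)" "card H = r ^ 1"
      using sylow_thm[OF r(1) D.is_group, of 1 m] D(2) by auto
    have H_in_G: "subgroup H G" "H \<subseteq> D"
      using incl_subgroup[OF D(1) H(1)] subgroup.subset[OF H(1)] by simp_all
    have "H \<noteq> {\<one>}" using H(2) r(1) by (auto simp: prime_nat_iff)
    then obtain x where x: "x \<in> H" "x \<noteq> \<one>" using subgroup.one_closed[OF H_in_G(1)] by blast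
    have x_carrier: "x \<in> carrier G" using subgroup.mem_carrier[OF H_in_G(1)] x by blast
    interpret H: group "G\<lparr>carrier := H\<rparr>" using H_in_G subgroup_imp_group by blast
    have "x [^] r = \<one>"
      using H.pow_order_eq_1[of x] x H(2) by (simp add: order_def nat_pow_consistent[symmetric])
    then have "ord x dvd r" "ord x dvd p" using exponent H_in_G x x_carrier pow_eq_id by auto
    then show "r = p" using r(1) p x x_carrier ord_eq_1 by (metis prime_nat_iff)
  qed
  then have "prime_factors (card D) \<subseteq> {p}" by (auto simp: prime_factors_dvd)
  moreover have "card D > 0" using D subgroup.one_closed[OF D(1)] by (auto simp: card_gt_0_iff)
  ultimately have "card D = (\<Prod>r\<in>{p}. r ^ multiplicity r (card D))"
    using prime_factorization_nat[of "card D"] by (auto simp: subset_singleton_iff)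
  then show ?thesis unfolding p_group_def using D.is_group by (auto simp: order_def)
qed

theorem sylow_contains_normalized_p_subgroup:
  assumes fin: "finite (carrier G)" and p: "prime p" and S: "sylow_subgroup G p S"
    and D: "subgroup D G" "p_group p (G\<lparr>carrier := D\<rparr>)" "S \<subseteq> normalizer G D"
  shows "D \<subseteq> S"
proof -
  have S_sylow: "subgroup S G" "card S = p ^ multiplicity p (order G)"
    using S by (auto simp: sylow_subgroup_def)
  have subgroup_DS: "subgroup (D <#> S) G" using subgroup_set_mult[OF D(1) S_sylow(1) D(3)] .
  have finite: "finite D" "finite S" "finite (D <#> S)"
    using finite_subset[OF subgroup.subset fin] D(1) S_sylow(1) subgroup_DS by auto
  obtain k where k: "card D = p ^ k" using p_groupD(2)[OF D(2)] by (auto simp: order_def)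
  have "card (D <#> S) dvd p ^ (k + multiplicity p (order G))"
    using card_set_mult[OF D(1) finite(1) S_sylow(1) finite(2)] k S_sylow(2)
    by (metis dvd_triv_left power_add)
  then obtain i where i: "card (D <#> S) = p ^ i" using p divides_primepow_nat by blast
  have "p ^ i dvd order G" using i lagrange[OF subgroup_DS] by (metis dvd_triv_right)
  then have "i \<le> multiplicity p (order G)"
    using p fin order_gt_0_iff_finite by (intro multiplicity_geI) (auto simp: prime_nat_iff)
  then have "card (D <#> S) \<le> card S"
    using i S_sylow(2) p by (simp add: prime_gt_0_nat power_increasing Suc_leI)
  then have "D <#> S = S" using subset_set_mult(2)[OF D(1) S_sylow(1)] finite card_seteq by metis
  then show ?thesis using subset_set_mult(1)[OF D(1) S_sylow(1)] by simp
qed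

end

section \<open>Commutators and quadratic action\<close>

context group
begin

lemma commutator_closed [simp]:
  assumes "x \<in> carrier G" "y \<in> carrier G"
  shows "commutator G x y \<in> carrier G"
  using assms by (simp add: commutator_def)

lemma commutator_eq_one_iff:
  assumes "x \<in> carrier G" "y \<in> carrier G"
  shows "commutator G x y = \<one> \<longleftrightarrow> x \<otimes> y = y \<otimes> x"
proof -
  have "commutator G x y = inv (y \<otimes> x) \<otimes> (x \<otimes> y)"
    using assms by (simp add: commutator_def word_simps)
  then show ?thesis using assms by (metis inv_closed inv_equality inv_inv l_inv m_closed)
qed

lemma commutator_in_normalized:
  assumes N: "subgroup N G" and x: "x \<in> normalizer G N" and y: "y \<in> N"
  shows "commutator G x y \<in> N" "commutator G y x \<in> N"
proof -
  have in_carrier: "x \<in> carrier G" "y \<in> carrier G"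
    using x y mem_normalizer_iff[OF subgroup.subset[OF N]] subgroup.mem_carrier[OF N] by auto
  have "inv x \<otimes> inv y \<otimes> x \<in> N" "inv x \<otimes> y \<otimes> x \<in> N"
    using normalizer_closed(2)[OF x subgroup.subset[OF N]] y subgroup.m_inv_closed[OF N] by auto
  then have "(inv x \<otimes> inv y \<otimes> x) \<otimes> y \<in> N" "inv y \<otimes> (inv x \<otimes> y \<otimes> x) \<in> N"
    using y subgroup.m_closed[OF N] subgroup.m_inv_closed[OF N] by auto
  then show "commutator G x y \<in> N" "commutator G y x \<in> N"
    using in_carrier by (simp_all add: commutator_def m_assoc)
qed

definition acts_quadratically :: "'a set \<Rightarrow> 'a \<Rightarrow> bool" where
  "acts_quadratically A g \<longleftrightarrow> (\<forall>a\<in>A. commutator G (commutator G a g) g = \<one>)"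

lemma acts_quadratically_iff_commute:
  assumes "A \<subseteq> carrier G" "g \<in> carrier G"
  shows "acts_quadratically A g \<longleftrightarrow> (\<forall>a\<in>A. commutator G a g \<otimes> g = g \<otimes> commutator G a g)"
  using assms commutator_eq_one_iff by (auto simp: acts_quadratically_def subset_iff)

end

section \<open>Thompson's replacement theorem\<close>

context group
begin

lemma elem_abelian_subD:
  assumes "elem_abelian_sub G p S E"
  shows "subgroup E G" "E \<subseteq> S" "E \<subseteq> carrier G"
    "\<lbrakk>x \<in> E; y \<in> E\<rbrakk> \<Longrightarrow> x \<otimes> y = y \<otimes> x" "x \<in> E \<Longrightarrow> x [^] p = \<one>"
  using assms subgroup.subset unfolding elem_abelian_sub_def by auto

lemma elem_abelian_sub_subset:
  assumes "elem_abelian_sub G p S E" "subgroup F G" "F \<subseteq> E"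
  shows "elem_abelian_sub G p S F"
  using assms unfolding elem_abelian_sub_def by blast

lemma elem_abelian_sub_conjugate:
  assumes S: "subgroup S G" and E: "elem_abelian_sub G p S E" and a: "a \<in> S"
  shows "elem_abelian_sub G p S (a <# E #> inv a)"
proof -
  note E_elab = elem_abelian_subD[OF E]
  have a_carrier: "a \<in> carrier G" using a subgroup.mem_carrier[OF S] by blast
  have E_carrier: "e \<in> carrier G" if "e \<in> E" for e using that E_elab(3) by blast
  have commute: "a \<otimes> e \<otimes> inv a \<otimes> (a \<otimes> f \<otimes> inv a) = a \<otimes> f \<otimes> inv a \<otimes> (a \<otimes> e \<otimes> inv a)"
    if "e \<in> E" "f \<in> E" for e f
  proof -
    have "a \<otimes> (e \<otimes> f) \<otimes> inv a = a \<otimes> (f \<otimes> e) \<otimes> inv a" using E_elab(4)[OF that] by simp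
    then show ?thesis using that E_carrier a_carrier by (simp add: word_simps)
  qed
  have exponent: "(a \<otimes> e \<otimes> inv a) [^] p = \<one>" if "e \<in> E" for e
    using conjugate_pow[OF a_carrier E_carrier[OF that]] E_elab(5)[OF that] a_carrier by simp
  have "subgroup (a <# E #> inv a) G"
    using subgroup_conjugation_is_surj1[of "inv a" E] E_elab(1) a_carrier by simp
  moreover have "a <# E #> inv a \<subseteq> S"
    unfolding conjugate_set_eq_image
    using E_elab(2) a subgroup.m_closed[OF S] subgroup.m_inv_closed[OF S] by auto
  ultimately show ?thesis
    using commute exponent by (auto simp: elem_abelian_sub_def conjugate_set_eq_image)
qed

lemma card_conjugate_set:
  assumes "a \<in> carrier G" "E \<subseteq> carrier G"
  shows "card (a <# E #> inv a) = card E"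
  unfolding conjugate_set_eq_image
  by (rule card_image) (use assms in \<open>auto simp: inj_on_def subset_iff\<close>)

lemma elem_abelian_sub_set_mult:
  assumes S: "subgroup S G" and A: "elem_abelian_sub G p S A" and B: "elem_abelian_sub G p S B"
    and comm: "\<And>a b. \<lbrakk>a \<in> A; b \<in> B\<rbrakk> \<Longrightarrow> a \<otimes> b = b \<otimes> a"
  shows "elem_abelian_sub G p S (A <#> B)"
  unfolding elem_abelian_sub_def
proof (intro conjI ballI)
  note A_elab = elem_abelian_subD[OF A] and B_elab = elem_abelian_subD[OF B]
  have A_carrier: "a \<in> carrier G" if "a \<in> A" for a using that A_elab(3) by blast
  have B_carrier: "b \<in> carrier G" if "b \<in> B" for b using that B_elab(3) by blast
  have "b \<otimes> a \<otimes> inv b = a" if "a \<in> A" "b \<in> B" for a b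
    using comm[OF that] conjugate_eq_iff_commute that A_carrier B_carrier by simp
  then have "B \<subseteq> normalizer G A" using subset_normalizerI[OF B_elab(1) A_elab(3)] by simp
  then show "subgroup (A <#> B) G" by (rule subgroup_set_mult[OF A_elab(1) B_elab(1)])
  show "A <#> B \<subseteq> S" using set_mult_subset_subgroup[OF S A_elab(2) B_elab(2)] .
  fix x assume "x \<in> A <#> B"
  then obtain a b where x: "a \<in> A" "b \<in> B" "x = a \<otimes> b" unfolding mem_set_mult_iff by blast
  then show "x [^] p = \<one>"
    using pow_mult_distrib[OF comm[OF x(1,2)]] A_elab(5) B_elab(5) A_carrier B_carrier by simp
  fix y assume y: "y \<in> A <#> B"
  have "c \<otimes> y = y \<otimes> c" if "c \<in> A" for c
    using commute_set_mult[OF A_carrier[OF that] A_elab(3) B_elab(3) _ _ y] A_elab(4) comm that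
    by blast
  moreover have "d \<otimes> y = y \<otimes> d" if "d \<in> B" for d
    using commute_set_mult[OF B_carrier[OF that] A_elab(3) B_elab(3) _ _ y] B_elab(4) comm that
    by metis
  moreover have "y \<in> carrier G"
    using y set_mult_closed[OF A_elab(3) B_elab(3)] by blast
  ultimately show "x \<otimes> y = y \<otimes> x"
    unfolding x(3) using commute_mult[of y a b] x(1,2) A_carrier B_carrier by simp
qed

end

locale p_subgroup = group G for G (structure) +
  fixes p :: nat and S :: "'a set"
  assumes prime_p: "prime p" and subgroup_S: "subgroup S G"
    and p_group_S: "p_group p (G\<lparr>carrier := S\<rparr>)"
begin

abbreviation "elab \<equiv> elem_abelian_sub G p S"

lemmas S_closed = subgroup.mem_carrier[OF subgroup_S] subgroup.m_closed[OF subgroup_S]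
  subgroup.m_inv_closed[OF subgroup_S] subgroup.one_closed[OF subgroup_S]

lemmas normal_in_S_iff = normal_in_subgroup_iff[OF subgroup_S]

lemma finite_S: "finite S"
  using p_group_imp_finite[OF p_group_S prime_p] by simp

lemma p_group_of_subset:
  assumes "subgroup H G" "H \<subseteq> S"
  shows "p_group p (G\<lparr>carrier := H\<rparr>)"
  using p_group_subgroup[OF p_group_S prime_p subgroup_incl[OF assms(1) subgroup_S assms(2)]]
  by simp

lemma elabD:
  assumes "elab E"
  shows "subgroup E G" "E \<subseteq> S" "E \<subseteq> carrier G" "finite E" "p_group p (G\<lparr>carrier := E\<rparr>)"
    "\<lbrakk>x \<in> E; y \<in> E\<rbrakk> \<Longrightarrow> x \<otimes> y = y \<otimes> x" "x \<in> E \<Longrightarrow> x [^] p = \<one>"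
  using elem_abelian_subD[OF assms] finite_subset[OF _ finite_S] p_group_of_subset by auto

lemma card_eq_power_elab_rank:
  assumes "elab E"
  shows "card E = p ^ elab_rank p E"
proof -
  obtain k where "card E = p ^ k" using p_groupD(2)[OF elabD(5)[OF assms]] by (auto simp: order_def)
  then show ?thesis using prime_p by (simp add: elab_rank_def)
qed

definition maximal_elab :: "'a set \<Rightarrow> bool" where
  "maximal_elab E \<longleftrightarrow> elab E \<and> (\<forall>F. elab F \<longrightarrow> card F \<le> card E)"

lemma maximal_elab_if_elab_rank_eq_p_rank:
  assumes E: "elab E" "elab_rank p E = p_rank G p S"
  shows "maximal_elab E"
proof -
  let ?ranks = "{elab_rank p E | E. elab E}"
  have "?ranks \<subseteq> elab_rank p ` Pow S" using elabD(2) by blast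
  then have "finite ?ranks" using finite_S finite_subset by blast
  then have "elab_rank p F \<le> elab_rank p E" if "elab F" for F
    unfolding E(2) p_rank_def using that by (intro Max_ge) auto
  then show ?thesis
    using card_eq_power_elab_rank E(1) prime_p
    by (simp add: maximal_elab_def power_increasing prime_gt_0_nat Suc_leI)
qed

context
  fixes A E a
  assumes A: "elab A" and A_normal: "S \<subseteq> normalizer G A" and E: "elab E"
    and a: "a \<in> A" "a \<notin> normalizer G E"
    and commutators: "\<And>e. e \<in> E \<Longrightarrow> e \<otimes> a \<otimes> inv e \<otimes> inv a \<in> normalizer G E"
begin

abbreviation "E' \<equiv> a <# E #> inv a"

abbreviation "replacement \<equiv> ((E <#> E') \<inter> A) <#> (E \<inter> E')"

lemma a_carrier: "a \<in> carrier G"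
  using a(1) elabD(3)[OF A] by auto

lemma E_carrier: "e \<in> E \<Longrightarrow> e \<in> carrier G"
  using elabD(3)[OF E] by auto

lemma elab_E': "elab E'"
  using elem_abelian_sub_conjugate[OF subgroup_S E] a(1) elabD(2)[OF A] by blast

lemma E'_subset_normalizer: "E' \<subseteq> normalizer G E"
proof
  note N = normalizer_imp_subgroup[OF elabD(3)[OF E]]
  fix x assume "x \<in> E'"
  then obtain e where e: "e \<in> E" "x = a \<otimes> e \<otimes> inv a" by (auto simp: conjugate_set_eq_image)
  have "x = inv (e \<otimes> a \<otimes> inv e \<otimes> inv a) \<otimes> e" using e a_carrier E_carrier by (simp add: word_simps)
  then show "x \<in> normalizer G E"
    using subgroup.m_closed[OF N subgroup.m_inv_closed[OF N commutators[OF e(1)]]]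
      subgroup_subset_normalizer[OF elabD(1)[OF E]] e(1) by auto
qed

lemma subgroup_EE': "subgroup (E <#> E') G"
  using subgroup_set_mult elabD(1) E elab_E' E'_subset_normalizer by blast

lemma EE'_subset_normalizer: "E <#> E' \<subseteq> normalizer G E"
  using set_mult_subset_subgroup[OF normalizer_imp_subgroup[OF elabD(3)[OF E]]]
    subgroup_subset_normalizer[OF elabD(1)[OF E]] E'_subset_normalizer by blast

lemma subset_EE': "E \<subseteq> E <#> E'" "E' \<subseteq> E <#> E'"
  using subset_set_mult elabD(1) E elab_E' by blast+

lemma subgroup_EE'_Int_A: "subgroup ((E <#> E') \<inter> A) G"
  using subgroups_Inter_pair[OF subgroup_EE' elabD(1)[OF A]] .

lemma subgroup_E_Int_E': "subgroup (E \<inter> E') G"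
  using subgroups_Inter_pair elabD(1) E elab_E' by blast

lemma EE'_eq: "E <#> E' = E <#> ((E <#> E') \<inter> A)"
proof
  show "E <#> E' \<subseteq> E <#> ((E <#> E') \<inter> A)"
  proof
    fix h assume h: "h \<in> E <#> E'"
    then obtain x y where xy: "x \<in> E" "y \<in> E'" "h = x \<otimes> y" unfolding mem_set_mult_iff by blast
    then obtain e where e: "e \<in> E" "y = a \<otimes> e \<otimes> inv a" by (auto simp: conjugate_set_eq_image)
    define c where "c = inv e \<otimes> a \<otimes> e \<otimes> inv a"
    have "inv e \<otimes> a \<otimes> e \<in> A"
      using normalizer_closed(2)[OF _ elabD(3)[OF A] a(1)] e(1) elabD(2)[OF E] A_normal by blast
    then have c_in_A: "c \<in> A"
      unfolding c_def
      using a(1) elabD(1)[OF A] by (simp add: subgroup.m_closed subgroup.m_inv_closed)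
    have c_carrier: "c \<in> carrier G" using c_in_A elabD(3)[OF A] by blast
    have "y = e \<otimes> c" unfolding e(2) c_def using e(1) a_carrier E_carrier by (simp add: word_simps)
    then have h_eq: "h = (x \<otimes> e) \<otimes> c"
      using xy e(1) a_carrier E_carrier c_carrier by (simp add: m_assoc)
    have xe_in_E: "x \<otimes> e \<in> E" using xy e(1) subgroup.m_closed[OF elabD(1)[OF E]] by blast
    have "c = inv (x \<otimes> e) \<otimes> h"
      using h_eq xe_in_E a_carrier E_carrier c_carrier by (simp add: inv_mult_cancel)
    then have "c \<in> (E <#> E') \<inter> A"
      using c_in_A h xe_in_E subset_EE'(1) subgroup_EE'
      by (auto intro: subgroup.m_closed subgroup.m_inv_closed)
    then show "h \<in> E <#> ((E <#> E') \<inter> A)"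
      unfolding h_eq by (rule set_mult_memI[OF xe_in_E])
  qed
  show "E <#> ((E <#> E') \<inter> A) \<subseteq> E <#> E'"
    using set_mult_subset_subgroup[OF subgroup_EE' subset_EE'(1)] by blast
qed

lemma E_Int_A_subset_E': "E \<inter> A \<subseteq> E'"
proof
  fix z assume z: "z \<in> E \<inter> A"
  then have "a \<otimes> z \<otimes> inv a = z"
    using conjugate_eq_iff_commute[OF a_carrier E_carrier] elabD(6)[OF A a(1)] by blast
  then show "z \<in> E'" using z unfolding conjugate_set_eq_image by force
qed

lemma card_replacement: "card replacement = card E"
proof -
  let ?H = "E <#> E'"
  have fin: "finite E" "finite E'" "finite (?H \<inter> A)" "finite (E \<inter> E')"
    using elabD(4)[OF E] elabD(4)[OF elab_E'] elabD(4)[OF A] by auto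
  have card_H: "card ?H * card (E \<inter> E') = card E * card E"
    using card_set_mult[OF elabD(1)[OF E] fin(1) elabD(1)[OF elab_E'] fin(2)]
      card_conjugate_set[OF a_carrier elabD(3)[OF E]] by simp
  have card_H_A: "card ?H * card (E \<inter> A) = card E * card (?H \<inter> A)"
  proof -
    have "E \<inter> (?H \<inter> A) = E \<inter> A" using subset_EE'(1) by blast
    then show ?thesis
      using card_set_mult[OF elabD(1)[OF E] fin(1) subgroup_EE'_Int_A fin(3)] EE'_eq by simp
  qed
  have card_repl: "card replacement * card (E \<inter> A) = card (?H \<inter> A) * card (E \<inter> E')"
  proof -
    have "?H \<inter> A \<inter> (E \<inter> E') = E \<inter> A" using subset_EE'(1) E_Int_A_subset_E' by blast
    then show ?thesis
      using card_set_mult[OF subgroup_EE'_Int_A fin(3) subgroup_E_Int_E' fin(4)] by simp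
  qed
  have "card replacement * (card (E \<inter> A) * card E) = (card E * card (?H \<inter> A)) * card (E \<inter> E')"
    using card_repl by simp
  also have "\<dots> = card E * (card (E \<inter> A) * card E)"
    using card_H unfolding card_H_A[symmetric] by simp
  finally have "card replacement * (card (E \<inter> A) * card E) = card E * (card (E \<inter> A) * card E)" .
  moreover have "card E > 0" "card (E \<inter> A) > 0"
    using fin(1) subgroup.one_closed[OF elabD(1)[OF E]] subgroup.one_closed[OF elabD(1)[OF A]]
    by (auto simp: card_gt_0_iff)
  ultimately show ?thesis by simp
qed

lemma elab_replacement: "elab replacement"
proof (rule elem_abelian_sub_set_mult[OF subgroup_S])
  show "elab ((E <#> E') \<inter> A)" using elem_abelian_sub_subset[OF A subgroup_EE'_Int_A] by simp
  show "elab (E \<inter> E')" using elem_abelian_sub_subset[OF E subgroup_E_Int_E'] by simp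
  fix b z assume b: "b \<in> (E <#> E') \<inter> A" and z: "z \<in> E \<inter> E'"
  have "z \<otimes> b = b \<otimes> z"
  proof (rule commute_set_mult[OF _ elabD(3)[OF E] elabD(3)[OF elab_E']])
    show "z \<in> carrier G" using z E_carrier by blast
    show "z \<otimes> e = e \<otimes> z" if "e \<in> E" for e using elabD(6)[OF E _ that] z by blast
    show "z \<otimes> e = e \<otimes> z" if "e \<in> E'" for e using elabD(6)[OF elab_E' _ that] z by blast
    show "b \<in> E <#> E'" using b by blast
  qed
  then show "b \<otimes> z = z \<otimes> b" by simp
qed

lemma replacement_subset_normalizer: "replacement \<subseteq> normalizer G E"
  using set_mult_subset_subgroup[OF subgroup_EE', of "(E <#> E') \<inter> A" "E \<inter> E'"]
    subset_EE'(1) EE'_subset_normalizer by blast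

lemma E_Int_A_psubset_replacement: "E \<inter> A \<subset> replacement \<inter> A"
proof
  let ?B = "(E <#> E') \<inter> A"
  have B: "?B \<subseteq> replacement \<inter> A"
    using subset_set_mult(1)[OF subgroup_EE'_Int_A subgroup_E_Int_E'] by blast
  then show "E \<inter> A \<subseteq> replacement \<inter> A" using subset_EE'(1) by blast
  show "E \<inter> A \<noteq> replacement \<inter> A"
  proof
    assume "E \<inter> A = replacement \<inter> A"
    then have "?B \<subseteq> E" using B by blast
    then have "E <#> E' \<subseteq> E"
      by (subst EE'_eq) (rule set_mult_subset_subgroup[OF elabD(1)[OF E] order_refl])
    then have "E' = E"
      using subset_EE'(2) card_conjugate_set[OF a_carrier elabD(3)[OF E]] elabD(4)[OF E]
      by (intro card_subset_eq) auto
    then show False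
      using a(2) mem_normalizer_iff_conjugate_set[OF elabD(3)[OF E]] a_carrier by blast
  qed
qed

end

theorem thompson_replacement:
  assumes A: "elab A" "S \<subseteq> normalizer G A" and E: "elab E" and not_norm: "\<not> A \<subseteq> normalizer G E"
  obtains F where "elab F" "card F = card E" "E \<inter> A \<subset> F \<inter> A" "F \<subseteq> normalizer G E"
proof -
  let ?N = "A \<inter> normalizer G E"
  note subgroup_normalizer = normalizer_imp_subgroup[OF elabD(3)[OF E]]
  have N: "subgroup ?N G" using subgroups_Inter_pair[OF elabD(1)[OF A(1)] subgroup_normalizer] .
  have "E \<subseteq> normalizer G ?N"
  proof -
    have "E \<subseteq> normalizer G (normalizer G E)"
      using subgroup_subset_normalizer[OF elabD(1)[OF E]]
        subgroup_subset_normalizer[OF subgroup_normalizer] by blast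
    then show ?thesis
      using normalizer_Int[OF elabD(3)[OF A(1)] subgroup.subset[OF subgroup_normalizer]]
        A(2) elabD(2)[OF E] by blast
  qed
  then obtain a where a: "a \<in> A - ?N" "\<And>e. e \<in> E \<Longrightarrow> e \<otimes> a \<otimes> inv e \<otimes> inv a \<in> ?N"
    using p_group_exists_centralized_modulo[OF prime_p elabD(1,5)[OF E] elabD(1,5)[OF A(1)] _ N]
      A(2) elabD(2)[OF E] not_norm by blast
  then have a: "a \<in> A" "a \<notin> normalizer G E" "\<And>e. e \<in> E \<Longrightarrow> e \<otimes> a \<otimes> inv e \<otimes> inv a \<in> normalizer G E"
    by auto
  show thesis
    using that elab_replacement[OF A E a] card_replacement[OF A E a]
      E_Int_A_psubset_replacement[OF A E a] replacement_subset_normalizer[OF A E a] by blast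
qed

lemma subset_maximal_elab_if_centralized:
  assumes A: "elab A" and F: "maximal_elab F" "F \<subseteq> centralizer_in G S A"
  shows "A \<subseteq> F"
proof -
  have elab_F: "elab F" using F(1) by (simp add: maximal_elab_def)
  have "x \<otimes> f = f \<otimes> x" if "x \<in> A" "f \<in> F" for x f
    using centralizer_in_commute[of f S A x] F(2) that by auto
  then have elab_AF: "elab (A <#> F)" by (rule elem_abelian_sub_set_mult[OF subgroup_S A elab_F])
  have "F = A <#> F"
    using subset_set_mult(2)[OF elabD(1)[OF A] elabD(1)[OF elab_F]] F(1) elab_AF
      elabD(4)[OF elab_AF]
    by (intro card_seteq) (auto simp: maximal_elab_def)
  then show ?thesis using subset_set_mult(1)[OF elabD(1)[OF A] elabD(1)[OF elab_F]] by simp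
qed

lemma acts_quadratically_if_normalized:
  assumes E: "elab E" "A \<subseteq> normalizer G E" and g: "g \<in> E"
  shows "acts_quadratically A g"
  unfolding acts_quadratically_def
proof
  fix a assume "a \<in> A"
  then have "commutator G a g \<in> E"
    using commutator_in_normalized(1)[OF elabD(1)[OF E(1)]] E(2) g by blast
  then show "commutator G (commutator G a g) g = \<one>"
    using commutator_eq_one_iff[of "commutator G a g" g] elabD(3,6)[OF E(1)] g by blast
qed

text \<open>Among the maximal \<open>E\<close> that do not centralize \<open>A\<close>, one with \<open>E \<inter> A\<close> maximal is normalized
  by \<open>A\<close>, by the replacement theorem.\<close>

lemma exists_normalized_maximal_elab:
  assumes A: "elab A" "S \<subseteq> normalizer G A"
    and E: "maximal_elab E" "\<not> E \<subseteq> centralizer_in G S A"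
  obtains D where "maximal_elab D" "\<not> D \<subseteq> centralizer_in G S A" "A \<subseteq> normalizer G D"
proof -
  let ?C = "centralizer_in G S A"
  define \<M> where "\<M> = {E. maximal_elab E \<and> \<not> E \<subseteq> ?C}"
  have "(\<lambda>E. E \<inter> A) ` \<M> \<noteq> {}" using E unfolding \<M>_def by blast
  moreover have "(\<lambda>E. E \<inter> A) ` \<M> \<subseteq> Pow A" by auto
  then have "finite ((\<lambda>E. E \<inter> A) ` \<M>)" using elabD(4)[OF A(1)] finite_subset by blast
  ultimately have "\<exists>M\<in>(\<lambda>E. E \<inter> A) ` \<M>. \<forall>N\<in>(\<lambda>E. E \<inter> A) ` \<M>. M \<subseteq> N \<longrightarrow> M = N"
    by (intro finite_has_maximal)
  then obtain D where D: "D \<in> \<M>" "\<forall>F\<in>\<M>. D \<inter> A \<subseteq> F \<inter> A \<longrightarrow> D \<inter> A = F \<inter> A" by auto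
  then have max_D: "maximal_elab D" "\<not> D \<subseteq> ?C" unfolding \<M>_def by auto
  have "A \<subseteq> normalizer G D"
  proof (rule ccontr)
    assume not_norm: "\<not> A \<subseteq> normalizer G D"
    then obtain F where F: "elab F" "card F = card D" "D \<inter> A \<subset> F \<inter> A" "F \<subseteq> normalizer G D"
      using thompson_replacement[OF A] max_D(1) unfolding maximal_elab_def by blast
    then have max_F: "maximal_elab F" using max_D(1) by (simp add: maximal_elab_def)
    have "\<not> F \<subseteq> ?C" using subset_maximal_elab_if_centralized[OF A(1) max_F] F(4) not_norm by blast
    then have "F \<in> \<M>" using max_F unfolding \<M>_def by simp
    then have "D \<inter> A \<subseteq> F \<inter> A \<longrightarrow> D \<inter> A = F \<inter> A" using D(2) by blast
    then show False using F(3) by blast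
  qed
  then show thesis using that max_D by blast
qed

theorem thompson_subgroup_le_centralizer:
  assumes A: "elab A" "S \<subseteq> normalizer G A"
    and quadratic: "\<And>g. \<lbrakk>g \<in> S; acts_quadratically A g\<rbrakk> \<Longrightarrow> g \<in> centralizer_in G S A"
  shows "thompson_subgroup G p S \<subseteq> centralizer_in G S A"
proof -
  let ?C = "centralizer_in G S A"
  have "E \<subseteq> ?C" if E: "maximal_elab E" for E
  proof (rule ccontr)
    assume "\<not> E \<subseteq> ?C"
    then obtain D where D: "maximal_elab D" "\<not> D \<subseteq> ?C" "A \<subseteq> normalizer G D"
      using exists_normalized_maximal_elab[OF A E] by blast
    then have elab_D: "elab D" by (simp add: maximal_elab_def)
    have "D \<subseteq> ?C"
      using quadratic acts_quadratically_if_normalized[OF elab_D D(3)] elabD(2)[OF elab_D] by blast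
    then show False using D(2) by simp
  qed
  then have "\<Union>{E. elab E \<and> elab_rank p E = p_rank G p S} \<subseteq> ?C"
    using maximal_elab_if_elab_rank_eq_p_rank by blast
  then show ?thesis
    unfolding thompson_subgroup_def
    by (rule generate_subgroup_incl) (rule subgroup_centralizer_in[OF subgroup_S elabD(3)[OF A(1)]])
qed

end

section \<open>The Oliver subgroup\<close>

context group
begin

lemma comm_sub_subset:
  assumes "subgroup H G" "\<And>a b. \<lbrakk>a \<in> A; b \<in> B\<rbrakk> \<Longrightarrow> commutator G a b \<in> H"
  shows "comm_sub G A B \<subseteq> H"
  unfolding comm_sub_def using assms by (intro generate_subgroup_incl) auto

lemma comm_sub_trivial:
  assumes "A \<subseteq> carrier G" "B \<subseteq> carrier G" "\<And>a b. \<lbrakk>a \<in> A; b \<in> B\<rbrakk> \<Longrightarrow> a \<otimes> b = b \<otimes> a"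
  shows "comm_sub G A B \<subseteq> {\<one>}"
proof (rule comm_sub_subset[OF triv_subgroup])
  fix a b assume "a \<in> A" "b \<in> B"
  then show "commutator G a b \<in> {\<one>}" using assms commutator_eq_one_iff[of a b] by auto
qed

lemma comm_sub_mono:
  assumes "A \<subseteq> A'" "B \<subseteq> B'"
  shows "comm_sub G A B \<subseteq> comm_sub G A' B'"
  unfolding comm_sub_def using assms by (intro mono_generate) auto

lemma iter_comm_mono:
  assumes "A \<subseteq> A'" "B \<subseteq> B'"
  shows "iter_comm G A B k \<subseteq> iter_comm G A' B' k"
  using assms by (induction k) (simp_all add: comm_sub_mono)

lemma iter_comm_Suc_eq_one_iff:
  "iter_comm G A B (Suc k) = {\<one>} \<longleftrightarrow> iter_comm G A B (Suc k) \<subseteq> {\<one>}"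
  using generate.one[of G] by (auto simp: comm_sub_def)

lemma iter_comm_trivial_mono:
  assumes B: "B \<subseteq> carrier G" and k: "iter_comm G A B k \<subseteq> {\<one>}" "k \<le> l"
  shows "iter_comm G A B l \<subseteq> {\<one>}"
  using k(2)
proof (induction l rule: dec_induct)
  case base
  then show ?case using k(1) .
next
  case (step l)
  have "a \<otimes> b = b \<otimes> a" if "a \<in> iter_comm G A B l" "b \<in> B" for a b
  proof -
    have "a = \<one>" using that(1) step.IH by blast
    then show ?thesis using that(2) B by auto
  qed
  then have "comm_sub G (iter_comm G A B l) B \<subseteq> {\<one>}"
    using B step.IH by (intro comm_sub_trivial) auto
  then show ?case by simp
qed

lemma commutator_mult_centralized:
  assumes "a \<in> carrier G" "k \<in> carrier G" "r \<in> carrier G" "a \<otimes> k = k \<otimes> a"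
  shows "commutator G a (k \<otimes> r) = commutator G a r"
proof -
  have "commutator G a (k \<otimes> r) = inv a \<otimes> inv r \<otimes> (inv k \<otimes> (a \<otimes> k)) \<otimes> r"
    using assms(1-3) by (simp add: commutator_def word_simps)
  also have "inv k \<otimes> (a \<otimes> k) = a" unfolding assms(4) using assms(1-3) by (simp add: inv_mult_cancel)
  finally show ?thesis by (simp add: commutator_def)
qed

lemma iter_comm_set_mult_centralized:
  assumes S: "subgroup S G" and C: "subgroup C G" "S \<subseteq> normalizer G C"
    and W: "W \<subseteq> C" and K: "K \<subseteq> S" and R: "R \<subseteq> S"
    and comm: "\<And>x k. \<lbrakk>x \<in> C; k \<in> K\<rbrakk> \<Longrightarrow> x \<otimes> k = k \<otimes> x"
  shows "iter_comm G W (K <#> R) j \<subseteq> iter_comm G W R j \<inter> C"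
proof (induction j)
  case 0
  then show ?case using W by simp
next
  case (Suc j)
  note S_carrier = subgroup.mem_carrier[OF S]
  have commutator_eq: "commutator G a (k \<otimes> r) = commutator G a r"
    if "a \<in> C" "k \<in> K" "r \<in> R" for a k r
    using that K R S_carrier subgroup.mem_carrier[OF C(1)] comm
    by (intro commutator_mult_centralized) auto
  have "comm_sub G (iter_comm G W (K <#> R) j) (K <#> R) \<subseteq> comm_sub G (iter_comm G W R j) R"
    unfolding comm_sub_def
  proof (intro mono_generate subsetI, clarify)
    fix a b assume ab: "a \<in> iter_comm G W (K <#> R) j" "b \<in> K <#> R"
    then obtain k r where "k \<in> K" "r \<in> R" "b = k \<otimes> r" unfolding mem_set_mult_iff by blast
    moreover have "a \<in> iter_comm G W R j" "a \<in> C" using Suc.IH ab(1) by auto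
    ultimately show "\<exists>a'\<in>iter_comm G W R j. \<exists>r\<in>R. commutator G a b = commutator G a' r"
      using commutator_eq by blast
  qed
  moreover have "comm_sub G (iter_comm G W (K <#> R) j) (K <#> R) \<subseteq> C"
  proof (rule comm_sub_subset[OF C(1)])
    fix a b assume "a \<in> iter_comm G W (K <#> R) j" "b \<in> K <#> R"
    then have "a \<in> C" "b \<in> normalizer G C"
      using Suc.IH set_mult_subset_subgroup[OF S K R] C(2) by auto
    then show "commutator G a b \<in> C" using commutator_in_normalized(2)[OF C(1)] by blast
  qed
  ultimately show ?case by simp
qed

lemma Omega1_subset:
  assumes "subgroup H G"
  shows "Omega1 G p H \<subseteq> H"
  unfolding Omega1_def using assms by (intro generate_subgroup_incl) auto

lemma Omega1_mono: "H \<subseteq> K \<Longrightarrow> Omega1 G p H \<subseteq> Omega1 G p K"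
  unfolding Omega1_def by (intro mono_generate) auto

lemma Omega1_abelian:
  assumes p: "prime p" and H: "subgroup H G" and comm: "\<And>x y. \<lbrakk>x \<in> H; y \<in> H\<rbrakk> \<Longrightarrow> x \<otimes> y = y \<otimes> x"
  shows "Omega1 G p H = {x \<in> H. x [^] p = \<one>}"
proof
  have H_carrier: "x \<in> carrier G" if "x \<in> H" for x using subgroup.mem_carrier[OF H that] .
  have "subgroup {x \<in> H. x [^] p = \<one>} G"
  proof (rule subgroupI)
    have "\<one> \<in> {x \<in> H. x [^] p = \<one>}" using subgroup.one_closed[OF H] by simp
    then show "{x \<in> H. x [^] p = \<one>} \<noteq> {}" by blast
  qed (use H_carrier subgroup.m_inv_closed[OF H] subgroup.m_closed[OF H] comm
      in \<open>auto simp: nat_pow_inv pow_mult_distrib\<close>)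
  then show "Omega1 G p H \<subseteq> {x \<in> H. x [^] p = \<one>}"
    unfolding Omega1_def using pow_ord_eq_1 H_carrier by (intro generate_subgroup_incl) auto
  show "{x \<in> H. x [^] p = \<one>} \<subseteq> Omega1 G p H"
  proof clarify
    fix x assume x: "x \<in> H" "x [^] p = \<one>"
    then have "ord x dvd p" using pow_eq_id H_carrier by blast
    then consider "ord x = 1" | "ord x = p" using p by (auto simp: prime_nat_iff)
    then show "x \<in> Omega1 G p H"
      unfolding Omega1_def
    proof cases
      case 1
      then have "x = \<one>" using ord_eq_1 H_carrier x(1) by blast
      then show "x \<in> generate G {x \<in> H. ord x = p}" by (simp add: generate.one)
    qed (use x(1) in \<open>auto intro: generate.incl\<close>)
  qed
qed

end

context p_subgroup
begin

abbreviation "C_S \<equiv> centralizer_in G S"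

abbreviation "oliver \<equiv> oliver_subgroup G p S"

abbreviation "normal_S K \<equiv> K \<lhd> G\<lparr>carrier := S\<rparr>"

lemma normal_SD:
  assumes "normal_S K"
  shows "subgroup K G" "K \<subseteq> S" "S \<subseteq> normalizer G K" "K \<subseteq> carrier G"
  using assms normal_in_S_iff subgroup.subset[OF subgroup_S] by auto

lemma normal_S_one: "normal_S {\<one>}"
  using triv_subgroup S_closed(4) subset_normalizerI[OF subgroup_S, of "{\<one>}"] S_closed(1)
  by (simp add: normal_in_S_iff)

lemma normal_S_centralizer: "normal_S K \<Longrightarrow> normal_S (C_S K)"
  using normal_SD[of K] subgroup_centralizer_in[OF subgroup_S, of K]
    normalizer_centralizer_in[OF subgroup_S, of K] centralizer_in_subset[of S K]
  unfolding normal_in_S_iff by blast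

lemma normal_S_set_mult:
  assumes "normal_S K" "normal_S R"
  shows "normal_S (K <#> R)"
proof -
  note K = normal_SD[OF assms(1)] and R = normal_SD[OF assms(2)]
  have "subgroup (K <#> R) G" using subgroup_set_mult[OF K(1) R(1)] R(2) K(3) by blast
  moreover have "S \<subseteq> normalizer G (K <#> R)"
    using normalizer_set_mult[OF K(4) R(4)] K(3) R(3) by blast
  ultimately show ?thesis
    using set_mult_subset_subgroup[OF subgroup_S K(2) R(2)] by (simp add: normal_in_S_iff)
qed

definition Q_step :: "'a set \<Rightarrow> 'a set \<Rightarrow> bool" where
  "Q_step K Y \<longleftrightarrow> normal_S Y \<and> K \<subseteq> Y \<and> iter_comm G (Omega1 G p (C_S K)) Y (p - 1) = {\<one>}"

lemma Q_stepI:
  assumes "normal_S Y" "K \<subseteq> Y" "iter_comm G (Omega1 G p (C_S K)) Y k \<subseteq> {\<one>}" "k < p"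
  shows "Q_step K Y"
proof -
  have "p - 1 = Suc (p - 2)" using prime_ge_2_nat[OF prime_p] by simp
  moreover have "iter_comm G (Omega1 G p (C_S K)) Y (p - 1) \<subseteq> {\<one>}"
    using iter_comm_trivial_mono[OF normal_SD(4)[OF assms(1)] assms(3)] assms(4) by simp
  ultimately have "iter_comm G (Omega1 G p (C_S K)) Y (p - 1) = {\<one>}"
    using iter_comm_Suc_eq_one_iff by metis
  then show ?thesis using assms(1,2) by (simp add: Q_step_def)
qed

lemma has_Q_series_one: "has_Q_series G p S {\<one>}"
  unfolding has_Q_series_def using normal_S_one
  by (intro exI[of _ "\<lambda>_. {\<one>}"] exI[of _ "0::nat"]) simp

lemma has_Q_series_iff:
  "has_Q_series G p S K \<longleftrightarrow> (\<exists>Q k. Q 0 = {\<one>} \<and> Q k = K \<and> (\<forall>i<k. Q_step (Q i) (Q (Suc i))))"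
proof
  assume "has_Q_series G p S K"
  then obtain Q k where Q: "Q 0 = {\<one>}" "Q k = K" "\<forall>i\<le>k. normal_S (Q i)" "\<forall>i<k. Q i \<subseteq> Q (Suc i)"
    "\<forall>i. 1 \<le> i \<and> i \<le> k \<longrightarrow> iter_comm G (Omega1 G p (C_S (Q (i - 1)))) (Q i) (p - 1) = {\<one>}"
    unfolding has_Q_series_def by (elim exE conjE)
  have "Q_step (Q i) (Q (Suc i))" if "i < k" for i
    using that Q(3,4) Q(5)[rule_format, of "Suc i"] by (simp add: Q_step_def)
  then show "\<exists>Q k. Q 0 = {\<one>} \<and> Q k = K \<and> (\<forall>i<k. Q_step (Q i) (Q (Suc i)))" using Q(1,2) by blast
next
  assume "\<exists>Q k. Q 0 = {\<one>} \<and> Q k = K \<and> (\<forall>i<k. Q_step (Q i) (Q (Suc i)))"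
  then obtain Q k where Q: "Q 0 = {\<one>}" "Q k = K" "\<And>i. i < k \<Longrightarrow> Q_step (Q i) (Q (Suc i))" by blast
  have "normal_S (Q i)" if "i \<le> k" for i
    using that Q(1,3) normal_S_one by (cases i) (auto simp: Q_step_def)
  moreover have "iter_comm G (Omega1 G p (C_S (Q (i - 1)))) (Q i) (p - 1) = {\<one>}"
    if "1 \<le> i" "i \<le> k" for i
    using Q(3)[of "i - 1"] that by (simp add: Q_step_def)
  ultimately show "has_Q_series G p S K"
    unfolding has_Q_series_def using Q by (intro exI[of _ Q] exI[of _ k]) (simp add: Q_step_def)
qed

lemma has_Q_series_extend:
  assumes "has_Q_series G p S K" "Q_step K Y"
  shows "has_Q_series G p S Y"
proof -
  obtain Q k where Q: "Q 0 = {\<one>}" "Q k = K" "\<And>i. i < k \<Longrightarrow> Q_step (Q i) (Q (Suc i))"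
    using assms(1) unfolding has_Q_series_iff by blast
  then show ?thesis
    unfolding has_Q_series_iff using assms(2)
    by (intro exI[of _ "Q(Suc k := Y)"] exI[of _ "Suc k"]) (auto simp: less_Suc_eq)
qed

lemma has_Q_series_induct [consumes 1, case_names one extend]:
  assumes "has_Q_series G p S K" and one: "P {\<one>}"
    and extend: "\<And>K Y. \<lbrakk>has_Q_series G p S K; P K; Q_step K Y\<rbrakk> \<Longrightarrow> P Y"
  shows "P K"
proof -
  obtain Q k where Q: "Q 0 = {\<one>}" "Q k = K" "\<And>i. i < k \<Longrightarrow> Q_step (Q i) (Q (Suc i))"
    using assms(1) unfolding has_Q_series_iff by blast
  have "has_Q_series G p S (Q i) \<and> P (Q i)" if "i \<le> k" for i
    using that
  proof (induction i)
    case 0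
    then show ?case using Q(1) has_Q_series_one one by simp
  next
    case (Suc i)
    then have "has_Q_series G p S (Q i)" "P (Q i)" "Q_step (Q i) (Q (Suc i))"
      using Q(3)[of i] by simp_all
    then show ?case using has_Q_series_extend extend by blast
  qed
  then show ?thesis using Q(2) by blast
qed

lemma has_Q_series_normal:
  assumes "has_Q_series G p S K"
  shows "normal_S K"
  using assms
proof (induction rule: has_Q_series_induct)
  case one
  then show ?case by (rule normal_S_one)
qed (simp add: Q_step_def)

lemma Q_step_set_mult:
  assumes K: "normal_S K" and R: "normal_S R" "Q_step R Y"
  shows "Q_step (K <#> R) (K <#> Y)"
proof (rule Q_stepI)
  note K_normal = normal_SD[OF K] and R_normal = normal_SD[OF R(1)]
  have Y: "normal_S Y" "R \<subseteq> Y" using R(2) by (auto simp: Q_step_def)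
  show "normal_S (K <#> Y)" using normal_S_set_mult[OF K Y(1)] .
  show "K <#> R \<subseteq> K <#> Y" using mono_set_mult[OF order_refl Y(2)] .
  let ?C = "C_S (K <#> R)"
  note C = normal_SD[OF normal_S_centralizer[OF normal_S_set_mult[OF K R(1)]]]
  have "x \<otimes> k = k \<otimes> x" if "x \<in> ?C" "k \<in> K" for x k
    using that centralizer_in_commute subset_set_mult(1)[OF K_normal(1) R_normal(1)] by blast
  then have "iter_comm G (Omega1 G p ?C) (K <#> Y) (p - 1) \<subseteq> iter_comm G (Omega1 G p ?C) Y (p - 1)"
    using iter_comm_set_mult_centralized[OF subgroup_S C(1,3) Omega1_subset[OF C(1)] K_normal(2)]
      normal_SD(2)[OF Y(1)] by blast
  also have "\<dots> \<subseteq> iter_comm G (Omega1 G p (C_S R)) Y (p - 1)"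
    using centralizer_in_antimono[OF subset_set_mult(2)[OF K_normal(1) R_normal(1)]]
    by (intro iter_comm_mono Omega1_mono) auto
  also have "\<dots> \<subseteq> {\<one>}" using R(2) by (simp add: Q_step_def)
  finally show "iter_comm G (Omega1 G p ?C) (K <#> Y) (p - 1) \<subseteq> {\<one>}" .
  show "p - 1 < p" using prime_gt_0_nat[OF prime_p] by simp
qed

lemma has_Q_series_set_mult:
  assumes K: "has_Q_series G p S K" and R: "has_Q_series G p S R"
  shows "has_Q_series G p S (K <#> R)"
  using R
proof (induction rule: has_Q_series_induct)
  case one
  have "K <#> {\<one>} = K"
    using normal_SD(4)[OF has_Q_series_normal[OF K]] by (force simp: set_mult_def)
  then show ?case using K by simp
next
  case (extend R Y)
  then show ?case
    using has_Q_series_extend Q_step_set_mult has_Q_series_normal K by blast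
qed

theorem oliver_has_Q_series: "has_Q_series G p S oliver"
  and has_Q_series_subset_oliver: "has_Q_series G p S K \<Longrightarrow> K \<subseteq> oliver"
proof -
  define \<K> where "\<K> = {K. has_Q_series G p S K}"
  have normal: "normal_S K" if "K \<in> \<K>" for K using that has_Q_series_normal unfolding \<K>_def by blast
  have "\<K> \<subseteq> Pow S" using normal normal_SD(2) by blast
  then have "finite \<K>" using finite_S finite_subset by blast
  moreover have "\<K> \<noteq> {}" using has_Q_series_one unfolding \<K>_def by blast
  ultimately obtain M where M: "M \<in> \<K>" "\<And>K. \<lbrakk>K \<in> \<K>; M \<subseteq> K\<rbrakk> \<Longrightarrow> M = K"
    using finite_has_maximal[of \<K>] by blast
  have greatest: "K \<subseteq> M" if K: "K \<in> \<K>" for K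
  proof -
    note subset = subset_set_mult[OF normal_SD(1)[OF normal[OF M(1)]] normal_SD(1)[OF normal[OF K]]]
    have "M <#> K \<in> \<K>" using has_Q_series_set_mult M(1) K unfolding \<K>_def by blast
    then have "M = M <#> K" using M(2) subset(1) by blast
    then show ?thesis using subset(2) by simp
  qed
  have "oliver = M"
    unfolding oliver_subgroup_def
    using M(1) greatest normal unfolding \<K>_def by (intro the_equality) blast+
  then show "has_Q_series G p S oliver" "has_Q_series G p S K \<Longrightarrow> K \<subseteq> oliver"
    using M(1) greatest unfolding \<K>_def by auto
qed

lemma normal_S_oliver: "normal_S oliver"
  using has_Q_series_normal[OF oliver_has_Q_series] .

lemma Q_step_oliver_subset: "Q_step oliver Y \<Longrightarrow> Y \<subseteq> oliver"
  using has_Q_series_subset_oliver[OF has_Q_series_extend[OF oliver_has_Q_series]] .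

lemma subset_oliver_if_iter_comm_trivial:
  assumes Y: "normal_S Y" and trivial: "iter_comm G S Y k \<subseteq> {\<one>}" "k < p"
  shows "Y \<subseteq> oliver"
proof (rule has_Q_series_subset_oliver, rule has_Q_series_extend[OF has_Q_series_one])
  show "Q_step {\<one>} Y"
  proof (rule Q_stepI[OF Y])
    show "{\<one>} \<subseteq> Y" using subgroup.one_closed[OF normal_SD(1)[OF Y]] by blast
    have "Omega1 G p (C_S {\<one>}) \<subseteq> S"
      using Omega1_subset[OF subgroup_centralizer_in[OF subgroup_S, of "{\<one>}"]] centralizer_in_subset
      by blast
    then show "iter_comm G (Omega1 G p (C_S {\<one>})) Y k \<subseteq> {\<one>}"
      using iter_comm_mono[of _ S Y Y k] trivial(1) by blast
  qed (rule trivial(2))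
qed

definition centre_modulo :: "'a set \<Rightarrow> 'a set \<Rightarrow> 'a set" where
  "centre_modulo C N = {t \<in> C. \<forall>s\<in>S. s \<otimes> t \<otimes> inv s \<otimes> inv t \<in> N}"

context
  fixes C N
  assumes C: "normal_S C" and N: "normal_S N"
begin

lemma subgroup_centre_modulo: "subgroup (centre_modulo C N) G"
proof (rule subgroupI)
  note C_carrier = subgroup.mem_carrier[OF normal_SD(1)[OF C]]
  show "centre_modulo C N \<subseteq> carrier G" using C_carrier by (auto simp: centre_modulo_def)
  have "\<one> \<in> centre_modulo C N"
    using subgroup.one_closed[OF normal_SD(1)[OF C]] subgroup.one_closed[OF normal_SD(1)[OF N]]
      S_closed(1)
    by (simp add: centre_modulo_def)
  then show "centre_modulo C N \<noteq> {}" by blast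
  fix t assume t: "t \<in> centre_modulo C N"
  then have t_in_C: "t \<in> C" and t_in_S: "t \<in> S"
    using normal_SD(2)[OF C] by (auto simp: centre_modulo_def)
  note t_conj = normalizer_closed[OF subsetD[OF normal_SD(3)[OF N] t_in_S] normal_SD(4)[OF N]]
  have t_commutator: "s \<otimes> t \<otimes> inv s \<otimes> inv t \<in> N" if "s \<in> S" for s
    using t that by (simp add: centre_modulo_def)
  have "s \<otimes> inv t \<otimes> inv s \<otimes> inv (inv t) \<in> N" if s: "s \<in> S" for s
  proof -
    have "inv t \<otimes> inv (s \<otimes> t \<otimes> inv s \<otimes> inv t) \<otimes> t \<in> N"
      using t_conj(2) subgroup.m_inv_closed[OF normal_SD(1)[OF N] t_commutator[OF s]] .
    then show ?thesis using s t_in_S S_closed(1) by (simp add: word_simps)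
  qed
  then show "inv t \<in> centre_modulo C N"
    using subgroup.m_inv_closed[OF normal_SD(1)[OF C] t_in_C] by (simp add: centre_modulo_def)
  fix u assume u: "u \<in> centre_modulo C N"
  have "s \<otimes> (t \<otimes> u) \<otimes> inv s \<otimes> inv (t \<otimes> u) \<in> N" if s: "s \<in> S" for s
  proof -
    have "(s \<otimes> t \<otimes> inv s \<otimes> inv t) \<otimes> (t \<otimes> (s \<otimes> u \<otimes> inv s \<otimes> inv u) \<otimes> inv t) \<in> N"
      using subgroup.m_closed[OF normal_SD(1)[OF N] t_commutator[OF s] t_conj(1)] u s
      by (simp add: centre_modulo_def)
    then show ?thesis
      using s t_in_S u C_carrier S_closed(1) by (simp add: word_simps centre_modulo_def)
  qed
  then show "t \<otimes> u \<in> centre_modulo C N"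
    using subgroup.m_closed[OF normal_SD(1)[OF C] t_in_C] u by (simp add: centre_modulo_def)
qed

lemma commutator_centre_modulo:
  assumes w: "w \<in> S" and t: "t \<in> centre_modulo C N"
  shows "commutator G w t \<in> N"
proof -
  have "inv t \<in> centre_modulo C N" using subgroup.m_inv_closed[OF subgroup_centre_modulo t] .
  then have "inv w \<otimes> inv t \<otimes> inv (inv w) \<otimes> inv (inv t) \<in> N"
    using S_closed(3)[OF w] by (simp add: centre_modulo_def)
  then show ?thesis
    using S_closed(1)[OF w] subgroup.mem_carrier[OF subgroup_centre_modulo t]
    by (simp add: commutator_def)
qed

lemma normal_S_set_mult_centre_modulo: "normal_S (N <#> centre_modulo C N)"
proof -
  let ?T = "centre_modulo C N"
  have T_subset_S: "?T \<subseteq> S" using normal_SD(2)[OF C] by (auto simp: centre_modulo_def)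
  have subgroup_NT: "subgroup (N <#> ?T) G"
    using subgroup_set_mult[OF normal_SD(1)[OF N] subgroup_centre_modulo] T_subset_S
      normal_SD(3)[OF N] by blast
  have "S \<subseteq> normalizer G (N <#> ?T)"
  proof (rule subset_normalizerI[OF subgroup_S subgroup.subset[OF subgroup_NT]])
    fix s y assume s: "s \<in> S" and "y \<in> N <#> ?T"
    then obtain x t where y: "x \<in> N" "t \<in> ?T" "y = x \<otimes> t" unfolding mem_set_mult_iff by blast
    have "s \<otimes> x \<otimes> inv s \<in> N"
      using normalizer_closed(1)[OF _ normal_SD(4)[OF N] y(1)] normal_SD(3)[OF N] s by blast
    moreover have "s \<otimes> t \<otimes> inv s \<otimes> inv t \<in> N" using y(2) s by (simp add: centre_modulo_def)
    ultimately have "(s \<otimes> x \<otimes> inv s) \<otimes> (s \<otimes> t \<otimes> inv s \<otimes> inv t) \<otimes> t \<in> N <#> ?T"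
      using subgroup.m_closed[OF normal_SD(1)[OF N]] y(2) by (intro set_mult_memI)
    moreover have "s \<in> carrier G" "x \<in> carrier G" "t \<in> carrier G"
      using s y normal_SD(4)[OF N] T_subset_S S_closed(1) by auto
    ultimately show "s \<otimes> y \<otimes> inv s \<in> N <#> ?T" using y(3) by (simp add: word_simps)
  qed
  then show ?thesis
    using subgroup_NT set_mult_subset_subgroup[OF subgroup_S normal_SD(2)[OF N] T_subset_S]
    by (simp add: normal_in_S_iff)
qed

lemma centre_modulo_not_subset:
  assumes "\<not> C \<subseteq> N"
  shows "\<not> centre_modulo C N \<subseteq> N"
proof -
  have "subgroup (C \<inter> N) G" using subgroups_Inter_pair[OF normal_SD(1)[OF C] normal_SD(1)[OF N]] .
  moreover have "C \<inter> N \<subset> C" using assms by blast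
  moreover have "S \<subseteq> normalizer G (C \<inter> N)"
    using normalizer_Int[OF normal_SD(4)[OF C] normal_SD(4)[OF N]] normal_SD(3)[OF C]
      normal_SD(3)[OF N] by blast
  ultimately obtain t where "t \<in> C - C \<inter> N" "\<forall>s\<in>S. s \<otimes> t \<otimes> inv s \<otimes> inv t \<in> C \<inter> N"
    using p_group_exists_centralized_modulo[OF prime_p subgroup_S p_group_S normal_SD(1)[OF C]
        p_group_of_subset[OF normal_SD(1,2)[OF C]] normal_SD(3)[OF C]] by blast
  then show ?thesis by (auto simp: centre_modulo_def)
qed

end

text \<open>Otherwise the Oliver subgroup \<open>X\<close> is enlarged by the elements of \<open>C\<^sub>S(X)\<close> that are central
  in \<open>S\<close> modulo \<open>X\<close>; these act on \<open>C\<^sub>S(X)\<close> with commutators in the abelian group \<open>C\<^sub>S(X) \<inter> X\<close>.\<close>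

theorem centralizer_oliver_subset:
  assumes p: "p \<ge> 3"
  shows "C_S oliver \<subseteq> oliver"
proof (rule ccontr)
  let ?C = "C_S oliver" and ?W = "Omega1 G p (C_S oliver)"
  let ?T = "centre_modulo ?C oliver"
  let ?Y = "oliver <#> ?T"
  note oliver = normal_SD[OF normal_S_oliver]
  note normal_C = normal_S_centralizer[OF normal_S_oliver]
  note C = normal_SD[OF normal_C]
  note T = subgroup_centre_modulo[OF normal_C normal_S_oliver]
  have T_subset_C: "?T \<subseteq> ?C" by (auto simp: centre_modulo_def)
  have W_subset_C: "?W \<subseteq> ?C" using Omega1_subset[OF C(1)] .
  have "iter_comm G ?W ?Y 1 \<subseteq> iter_comm G ?W ?T 1 \<inter> ?C"
    using iter_comm_set_mult_centralized[OF subgroup_S C(1,3) W_subset_C oliver(2)]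
      T_subset_C C(2) centralizer_in_commute by blast
  moreover have "iter_comm G ?W ?T 1 \<subseteq> oliver"
  proof -
    have "commutator G w t \<in> oliver" if "w \<in> ?W" "t \<in> ?T" for w t
      using commutator_centre_modulo[OF normal_C normal_S_oliver _ that(2)] that(1) W_subset_C C(2)
      by blast
    then show ?thesis using comm_sub_subset[OF oliver(1)] by simp
  qed
  ultimately have "iter_comm G ?W ?Y 1 \<subseteq> ?C \<inter> oliver" by blast
  moreover have "m \<otimes> y = y \<otimes> m" if m: "m \<in> ?C \<inter> oliver" and y: "y \<in> ?Y" for m y
  proof (rule commute_set_mult[OF _ oliver(4) subgroup.subset[OF T] _ _ y])
    show "m \<in> carrier G" using m oliver(4) by blast
    show "m \<otimes> x = x \<otimes> m" if "x \<in> oliver" for x using m that centralizer_in_commute by blast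
    show "m \<otimes> t = t \<otimes> m" if "t \<in> ?T" for t
      using m that T_subset_C centralizer_in_commute[of t S oliver m] by auto
  qed
  moreover have Y: "normal_S ?Y"
    using normal_S_set_mult_centre_modulo[OF normal_C normal_S_oliver] .
  ultimately have "comm_sub G (iter_comm G ?W ?Y 1) ?Y \<subseteq> {\<one>}"
    using C(4) normal_SD(4)[OF Y] by (intro comm_sub_trivial) blast+
  then have "iter_comm G ?W ?Y 2 \<subseteq> {\<one>}" by (simp add: numeral_2_eq_2)
  then have "Q_step oliver ?Y" using Q_stepI[OF Y subset_set_mult(1)[OF oliver(1) T]] p by simp
  then have "?T \<subseteq> oliver" using Q_step_oliver_subset subset_set_mult(2)[OF oliver(1) T] by blast
  moreover assume "\<not> ?C \<subseteq> oliver"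
  ultimately show False using centre_modulo_not_subset[OF normal_C normal_S_oliver] by blast
qed

context
  assumes p: "p \<ge> 3"
begin

lemma Omega1_centralizer_oliver: "Omega1 G p (C_S oliver) = {x \<in> C_S oliver. x [^] p = \<one>}"
proof (rule Omega1_abelian[OF prime_p normal_SD(1)[OF normal_S_centralizer[OF normal_S_oliver]]])
  fix x y assume "x \<in> C_S oliver" "y \<in> C_S oliver"
  then show "x \<otimes> y = y \<otimes> x"
    using centralizer_in_commute[of x S oliver y] centralizer_oliver_subset[OF p] by blast
qed

lemma elab_Omega1_centralizer_oliver: "elab (Omega1 G p (C_S oliver))"
  and normal_S_Omega1_centralizer_oliver: "normal_S (Omega1 G p (C_S oliver))"
proof -
  let ?C = "C_S oliver" and ?V = "Omega1 G p (C_S oliver)"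
  note C = normal_SD[OF normal_S_centralizer[OF normal_S_oliver]]
  have V: "subgroup ?V G" unfolding Omega1_def using C(4) by (intro generate_is_subgroup) auto
  have V_subset_C: "?V \<subseteq> ?C" using Omega1_subset[OF C(1)] .
  show "elab ?V"
    unfolding elem_abelian_sub_def
  proof (intro conjI ballI V)
    show "?V \<subseteq> S" using V_subset_C C(2) by blast
    fix v assume v: "v \<in> ?V"
    then show "v [^] p = \<one>" unfolding Omega1_centralizer_oliver by blast
    show "v \<otimes> u = u \<otimes> v" if "u \<in> ?V" for u
    proof (rule centralizer_in_commute)
      show "v \<in> ?C" using v V_subset_C by blast
      show "u \<in> oliver" using that V_subset_C centralizer_oliver_subset[OF p] by blast
    qed
  qed
  have "S \<subseteq> normalizer G ?V"
  proof (rule subset_normalizerI[OF subgroup_S subgroup.subset[OF V]])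
    fix s v assume s: "s \<in> S" and "v \<in> ?V"
    then have v: "v \<in> ?C" "v [^] p = \<one>" unfolding Omega1_centralizer_oliver by auto
    have "s \<in> carrier G" "v \<in> carrier G" using s S_closed(1) v(1) C(4) by auto
    moreover from this have "(s \<otimes> v \<otimes> inv s) [^] p = \<one>" using conjugate_pow v(2) by simp
    moreover have "s \<otimes> v \<otimes> inv s \<in> ?C"
      using normalizer_closed(1)[OF subsetD[OF C(3) s] C(4) v(1)] .
    ultimately show "s \<otimes> v \<otimes> inv s \<in> ?V" unfolding Omega1_centralizer_oliver by blast
  qed
  then show "normal_S ?V" using V V_subset_C C(2) by (auto simp: normal_in_S_iff)
qed

theorem centralizer_Omega1_subset_oliver: "C_S (Omega1 G p (C_S oliver)) \<subseteq> oliver"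
proof (rule Q_step_oliver_subset, rule Q_stepI)
  let ?V = "Omega1 G p (C_S oliver)"
  note V = normal_SD[OF normal_S_Omega1_centralizer_oliver]
  show D: "normal_S (C_S ?V)" using normal_S_centralizer[OF normal_S_Omega1_centralizer_oliver] .
  show "oliver \<subseteq> C_S ?V"
  proof
    fix x assume x: "x \<in> oliver"
    have "x \<otimes> v = v \<otimes> x" if "v \<in> ?V" for v
      using that x centralizer_in_commute[of v S oliver x]
      unfolding Omega1_centralizer_oliver by auto
    then show "x \<in> C_S ?V"
      using x normal_SD(2)[OF normal_S_oliver] by (auto simp: centralizer_in_def)
  qed
  have "v \<otimes> d = d \<otimes> v" if "v \<in> ?V" "d \<in> C_S ?V" for v d
    using centralizer_in_commute[OF that(2,1)] by simp
  then have "comm_sub G ?V (C_S ?V) \<subseteq> {\<one>}" using comm_sub_trivial V(4) normal_SD(4)[OF D] by blast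
  then show "iter_comm G ?V (C_S ?V) 1 \<subseteq> {\<one>}" by simp
  show "1 < p" using p by simp
qed

end

end

section \<open>Matrices as endomorphisms of sequence spaces\<close>

text \<open>Square matrices of variable size do not form a type; linear endomorphisms of sequences do. A
  matrix acts as the identity on the coordinates from \<open>n\<close> on, which makes the passage to
  endomorphisms unital.\<close>

definition scale_fun :: "'a::field \<Rightarrow> ('i \<Rightarrow> 'a) \<Rightarrow> 'i \<Rightarrow> 'a" (infixr "*s" 75) where
  "c *s x = (\<lambda>i. c * x i)"

lemma scale_fun_apply [simp]: "(c *s x) i = c * x i"
  by (simp add: scale_fun_def)

interpretation fun_space: vector_space "scale_fun :: 'a::field \<Rightarrow> ('i \<Rightarrow> 'a) \<Rightarrow> 'i \<Rightarrow> 'a"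
  by unfold_locales (auto simp: scale_fun_def fun_eq_iff algebra_simps)

interpretation fun_space_pair: vector_space_pair scale_fun scale_fun
  by unfold_locales

lemma linear_scale_funI:
  assumes "\<And>x y. f (x + y) = f x + f y" "\<And>c x. f (c *s x) = c *s f x"
  shows "Vector_Spaces.linear (*s) (*s) f"
  by unfold_locales (use assms in auto)

typedef (overloaded) 'a endo =
  "{f :: (nat \<Rightarrow> 'a::field) \<Rightarrow> nat \<Rightarrow> 'a. Vector_Spaces.linear (*s) (*s) f}"
  morphisms app Abs_endo
  by (auto intro!: exI[of _ "\<lambda>x. x"] linear_scale_funI)

setup_lifting type_definition_endo

interpretation app: Vector_Spaces.linear scale_fun scale_fun "app f" for f
  using app[of f] by simp

lemma endo_eqI: "(\<And>x. app f x = app g x) \<Longrightarrow> f = g"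
  by (simp add: app_inject[symmetric] ext)

instantiation endo :: (field) ring_1
begin

lift_definition zero_endo :: "'a endo" is "\<lambda>x. 0"
  by (auto intro!: linear_scale_funI)

lift_definition one_endo :: "'a endo" is "\<lambda>x. x"
  by (auto intro!: linear_scale_funI)

lift_definition plus_endo :: "'a endo \<Rightarrow> 'a endo \<Rightarrow> 'a endo" is "\<lambda>f g x. f x + g x"
  by (rule fun_space_pair.linear_compose_add)

lift_definition minus_endo :: "'a endo \<Rightarrow> 'a endo \<Rightarrow> 'a endo" is "\<lambda>f g x. f x - g x"
  by (rule fun_space_pair.linear_compose_sub)

lift_definition uminus_endo :: "'a endo \<Rightarrow> 'a endo" is "\<lambda>f x. - f x"
  by (rule fun_space_pair.linear_compose_neg)

lift_definition times_endo :: "'a endo \<Rightarrow> 'a endo \<Rightarrow> 'a endo" is "\<lambda>f g x. f (g x)"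
  using Vector_Spaces.linear_compose unfolding comp_def by blast

lemma app_endo [simp]:
  "app 0 x = 0" "app 1 x = x" "app (f + g) x = app f x + app g x"
    "app (f - g) x = app f x - app g x"
  "app (- f) x = - app f x" "app (f * g) x = app f (app g x)"
  by (transfer; simp)+

instance
proof
  fix f g k :: "'a endo"
  show "f + g + k = f + (g + k)" "f + g = g + f" "0 + f = f" "- f + f = 0" "f - g = f + - g"
    "f * g * k = f * (g * k)" "1 * f = f" "f * 1 = f"
    "(f + g) * k = f * k + g * k" "f * (g + k) = f * g + f * k"
    by (rule endo_eqI; simp add: app.add algebra_simps)+
  have "app (0::'a endo) (\<lambda>_. 1) 0 \<noteq> app 1 (\<lambda>_. 1) 0" by simp
  then show "(0::'a endo) \<noteq> 1" by metis
qed

end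

lift_definition scalar_endo :: "'a::field \<Rightarrow> 'a endo" is "\<lambda>c x. c *s x"
  by (auto intro!: linear_scale_funI simp: fun_eq_iff algebra_simps)

lemma app_scalar_endo [simp]: "app (scalar_endo c) x = c *s x"
  by transfer simp

lemma scalar_endo_commute: "scalar_endo c * f = f * scalar_endo c"
  by (rule endo_eqI) (simp add: app.scale)

lemma of_nat_endo: "of_nat k = scalar_endo (of_nat k)"
proof (rule endo_eqI)
  fix x :: "nat \<Rightarrow> 'a"
  show "app (of_nat k) x = app (scalar_endo (of_nat k)) x"
    by (induction k) (simp_all add: fun_eq_iff algebra_simps)
qed

lift_definition trunc :: "nat \<Rightarrow> 'a::field endo" is "\<lambda>n x i. if i < n then x i else 0"
  by (auto intro!: linear_scale_funI simp: fun_eq_iff)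

lemma app_trunc: "app (trunc n) x i = (if i < n then x i else 0)"
  by transfer simp

definition coord_space :: "nat \<Rightarrow> (nat \<Rightarrow> 'a::field) set" where
  "coord_space n = {x. app (trunc n) x = x}"

lemma mem_coord_space_iff: "x \<in> coord_space n \<longleftrightarrow> (\<forall>i\<ge>n. x i = 0)"
  by (auto simp: coord_space_def app_trunc fun_eq_iff not_less)

lemma subspace_coord_space: "fun_space.subspace (coord_space n)"
  by (rule fun_space.subspaceI) (auto simp: coord_space_def app.add app.scale)

lemma trunc_in_coord_space: "app (trunc n) x \<in> coord_space n"
  by (simp add: mem_coord_space_iff app_trunc)

lemma card_coord_space:
  "card (coord_space n :: (nat \<Rightarrow> 'a::{field,finite}) set) = card (UNIV :: 'a set) ^ n"
proof -
  let ?F = "PiE {..<n} (\<lambda>_. UNIV :: 'a set)"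
  have "bij_betw (\<lambda>x. restrict x {..<n}) (coord_space n) ?F"
  proof (rule bij_betw_byWitness[where f' = "\<lambda>f i. if i < n then f i else 0"])
    show "\<forall>x\<in>coord_space n. (\<lambda>i. if i < n then restrict x {..<n} i else 0) = x"
      by (auto simp: mem_coord_space_iff fun_eq_iff)
    show "\<forall>f\<in>?F. restrict (\<lambda>i. if i < n then f i else 0) {..<n} = f"
    proof (intro ballI ext)
      fix f :: "nat \<Rightarrow> 'a" and i assume "f \<in> ?F"
      then show "restrict (\<lambda>i. if i < n then f i else 0) {..<n} i = f i"
        using PiE_arb[of f "{..<n}" _ i] by simp
    qed
    show "(\<lambda>x. restrict x {..<n}) ` coord_space n \<subseteq> ?F"
      by (rule image_subsetI) (simp add: restrict_PiE_iff)
    show "(\<lambda>f i. if i < n then f i else 0) ` ?F \<subseteq> coord_space n"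
      by (rule image_subsetI) (simp add: mem_coord_space_iff)
  qed
  then have "card (coord_space n :: (nat \<Rightarrow> 'a) set) = card ?F" by (rule bij_betw_same_card)
  then show ?thesis by (simp add: card_PiE)
qed

lemma finite_coord_space: "finite (coord_space n :: (nat \<Rightarrow> 'a::{field,finite}) set)"
  using card_coord_space[of n, where 'a = 'a] by (intro card_ge_0_finite) (simp add: card_gt_0_iff)

definition basis_fun :: "nat \<Rightarrow> nat \<Rightarrow> 'a::field" where
  "basis_fun j = (\<lambda>i. if i = j then 1 else 0)"

lemma sum_mult_basis_fun:
  "i < n \<Longrightarrow> (\<Sum>j<n. f j * basis_fun i j) = f i" "i < n \<Longrightarrow> (\<Sum>j<n. f j * basis_fun j i) = f i"
  by (simp_all add: basis_fun_def if_distrib[of "(*) _"] cong: if_cong)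

lemma sum_fun_apply: "(\<Sum>i\<in>I. f i) x = (\<Sum>i\<in>I. f i x)"
  by (induction I rule: infinite_finite_induct) simp_all

lemma trunc_eq_sum_basis_fun: "app (trunc n) x = (\<Sum>j<n. x j *s basis_fun j)"
proof
  fix i
  show "app (trunc n) x i = (\<Sum>j<n. x j *s basis_fun j) i"
  proof (cases "i < n")
    case True
    then show ?thesis by (simp add: app_trunc sum_fun_apply sum_mult_basis_fun)
  next
    case False
    then have "(\<Sum>j<n. x j * basis_fun j i) = 0" by (intro sum.neutral) (auto simp: basis_fun_def)
    then show ?thesis using False by (simp add: app_trunc sum_fun_apply)
  qed
qed

lemma linear_mat_action:
  fixes A :: "'a::field mat"
  shows "Vector_Spaces.linear (*s) (*s) (\<lambda>x i. if i < n then \<Sum>j<n. A $$ (i, j) * x j else x i)"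
proof (rule linear_scale_funI)
  show "(\<lambda>i. if i < n then \<Sum>j<n. A $$ (i, j) * (x + y) j else (x + y) i) =
    (\<lambda>i. if i < n then \<Sum>j<n. A $$ (i, j) * x j else x i) +
    (\<lambda>i. if i < n then \<Sum>j<n. A $$ (i, j) * y j else y i)" for x y
    by (rule ext) (simp add: distrib_left sum.distrib)
  show "(\<lambda>i. if i < n then \<Sum>j<n. A $$ (i, j) * (c *s x) j else (c *s x) i) =
    c *s (\<lambda>i. if i < n then \<Sum>j<n. A $$ (i, j) * x j else x i)" for c x
    by (rule ext) (simp add: sum_distrib_left mult.left_commute)
qed

lift_definition mat_endo :: "nat \<Rightarrow> 'a::field mat \<Rightarrow> 'a endo"
  is "\<lambda>n A x i. if i < n then \<Sum>j<n. A $$ (i, j) * x j else x i"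
  by (rule linear_mat_action)

lemma app_mat_endo: "app (mat_endo n A) x i = (if i < n then \<Sum>j<n. A $$ (i, j) * x j else x i)"
  by (simp add: mat_endo.rep_eq)

lemma mat_endo_mult:
  assumes "A \<in> carrier_mat n n" "B \<in> carrier_mat n n"
  shows "mat_endo n (A * B) = mat_endo n A * mat_endo n B"
proof (rule endo_eqI, rule ext)
  fix x :: "nat \<Rightarrow> 'a" and i
  show "app (mat_endo n (A * B)) x i = app (mat_endo n A * mat_endo n B) x i"
  proof (cases "i < n")
    case True
    have "(\<Sum>j<n. (A * B) $$ (i, j) * x j) = (\<Sum>j<n. \<Sum>k<n. A $$ (i, k) * B $$ (k, j) * x j)"
      using assms True by (simp add: scalar_prod_def atLeast0LessThan sum_distrib_right)
    also have "\<dots> = (\<Sum>k<n. \<Sum>j<n. A $$ (i, k) * B $$ (k, j) * x j)" by (rule sum.swap)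
    finally show ?thesis using True by (simp add: app_mat_endo sum_distrib_left mult.assoc)
  qed (simp add: app_mat_endo)
qed

lemma mat_endo_one: "mat_endo n (1\<^sub>m n) = 1"
proof (rule endo_eqI, rule ext)
  fix x :: "nat \<Rightarrow> 'a" and i
  have "(\<Sum>j<n. 1\<^sub>m n $$ (i, j) * x j) = x i" if "i < n"
    using that sum_mult_basis_fun(1)[OF that, of x]
    by (simp add: basis_fun_def mult.commute eq_commute)
  then show "app (mat_endo n (1\<^sub>m n)) x i = app 1 x i" by (simp add: app_mat_endo)
qed

lemma mat_eqI_coord_space:
  assumes "A \<in> carrier_mat n n" "B \<in> carrier_mat n n"
    and "\<And>x. x \<in> coord_space n \<Longrightarrow> app (mat_endo n A) x = app (mat_endo n B) x"
  shows "A = B"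
proof (rule eq_matI)
  fix i j assume ij: "i < dim_row B" "j < dim_col B"
  then have "app (mat_endo n M) (basis_fun j) i = M $$ (i, j)" for M :: "'a mat"
    using assms(2) by (simp add: app_mat_endo sum_mult_basis_fun)
  moreover have "basis_fun j \<in> coord_space n"
    using ij assms(2) by (auto simp: mem_coord_space_iff basis_fun_def)
  ultimately show "A $$ (i, j) = B $$ (i, j)" using assms(3) by metis
qed (use assms in auto)

definition mat_like :: "nat \<Rightarrow> 'a::field endo \<Rightarrow> bool" where
  "mat_like n f \<longleftrightarrow> f * trunc n = trunc n * f \<and> f * (1 - trunc n) = 1 - trunc n"

lemma mat_like_mat_endo: "mat_like n (mat_endo n A)"
  unfolding mat_like_def
  by (intro conjI endo_eqI ext) (auto simp: app_mat_endo app_trunc)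

lemma mat_like_coord_space:
  assumes f: "mat_like n f" and x: "x \<in> coord_space n"
  shows "app f x \<in> coord_space n"
proof -
  have "app (trunc n) (app f x) = app (trunc n * f) x" by simp
  also have "trunc n * f = f * trunc n" using f by (simp add: mat_like_def)
  also have "app (f * trunc n) x = app f x" using x by (simp add: coord_space_def)
  finally show ?thesis by (simp add: coord_space_def)
qed

lemma mat_likeE:
  assumes "mat_like n f"
  obtains A where "A \<in> carrier_mat n n" "f = mat_endo n A"
proof
  define A where "A = mat n n (\<lambda>(i, j). app f (basis_fun j) i)"
  show "A \<in> carrier_mat n n" unfolding A_def by simp
  show "f = mat_endo n A"
  proof (rule endo_eqI, rule ext)
    fix x i
    have "app f x = app f (app (trunc n) x) + app (f * (1 - trunc n)) x" by (simp add: app.diff)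
    also have "app (f * (1 - trunc n)) x = x - app (trunc n) x"
      using assms by (simp add: mat_like_def)
    finally have f_x: "app f x = app f (app (trunc n) x) + (x - app (trunc n) x)" .
    show "app f x i = app (mat_endo n A) x i"
    proof (cases "i < n")
      case True
      then have "app f x i = app f (app (trunc n) x) i" unfolding f_x by (simp add: app_trunc)
      also have "\<dots> = (\<Sum>j<n. x j * app f (basis_fun j) i)"
        unfolding trunc_eq_sum_basis_fun by (simp add: app.sum app.scale sum_fun_apply)
      finally show ?thesis using True by (simp add: app_mat_endo A_def mult.commute)
    next
      case False
      have "app f (app (trunc n) x) i = 0"
        using mat_like_coord_space[OF assms trunc_in_coord_space] False
        by (simp add: mem_coord_space_iff)
      then show ?thesis using False unfolding f_x by (simp add: app_mat_endo app_trunc)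
    qed
  qed
qed

section \<open>The unitary group as an isometry group\<close>

text \<open>The library states this for the class \<open>finite_field\<close>, which the sort \<open>{field, finite}\<close> does
  not imply.\<close>

lemma power_card_UNIV: "(x :: 'a::{field,finite}) ^ card (UNIV :: 'a set) = x"
proof (cases "x = 0")
  case False
  let ?U = "UNIV - {0::'a}"
  have "bij_betw ((*) x) ?U ?U"
    by (rule bij_betw_byWitness[where f' = "\<lambda>y. y / x"]) (use False in auto)
  then have "(\<Prod>y\<in>?U. x * y) = \<Prod>?U" by (rule prod.reindex_bij_betw)
  then have "x ^ card ?U * \<Prod>?U = \<Prod>?U" by (simp add: prod.distrib)
  moreover have "\<Prod>?U \<noteq> 0" by simp
  ultimately have "x ^ card ?U = 1" by simp
  moreover have "card (UNIV :: 'a set) = Suc (card ?U)"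
    by (simp add: card_Diff_singleton card_gt_0_iff)
  then have "x ^ card (UNIV :: 'a set) = x * x ^ card ?U" by (metis power_Suc)
  ultimately show ?thesis by (simp only: mult_1_right)
qed (simp add: card_gt_0_iff)

definition herm :: "nat \<Rightarrow> nat \<Rightarrow> (nat \<Rightarrow> 'a::field) \<Rightarrow> (nat \<Rightarrow> 'a) \<Rightarrow> 'a" where
  "herm q n x y = (\<Sum>i<n. x i ^ q * y i)"

locale unitary_space =
  fixes q n :: nat and G :: "'a::{field,finite} mat monoid" (structure)
  assumes prime_power_q: "prime_power q" and card_field: "card (UNIV :: 'a set) = q ^ 2"
    and G_def: "G = unitary_group q n"
begin

abbreviation "h \<equiv> herm q n :: (nat \<Rightarrow> 'a) \<Rightarrow> (nat \<Rightarrow> 'a) \<Rightarrow> 'a"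

abbreviation "W \<equiv> coord_space n :: (nat \<Rightarrow> 'a) set"

lemma prime_CHAR: "prime CHAR('a)"
  using prime_CHAR_semidom[where 'a = 'a] finite_imp_CHAR_pos[where 'a = 'a] by simp

lemma q_eq_power_CHAR: "\<exists>e\<ge>1. q = CHAR('a) ^ e"
proof -
  obtain r e where r: "prime (r::nat)" "e \<ge> 1" "q = r ^ e"
    using prime_power_q unfolding prime_power_def by blast
  have "CHAR('a) dvd r ^ (e * 2)"
    using CHAR_dvd_CARD[where 'a = 'a] card_field r(3) by (simp add: power_mult)
  then have "CHAR('a) dvd r" using prime_dvd_power prime_CHAR by blast
  then show ?thesis using primes_dvd_imp_eq prime_CHAR r by blast
qed

lemma q_ge_2: "q \<ge> 2"
proof -
  obtain e where "e \<ge> 1" "q = CHAR('a) ^ e" using q_eq_power_CHAR by blast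
  then show ?thesis
    using prime_ge_2_nat[OF prime_CHAR] self_le_power[of "CHAR('a)" e] by simp
qed

lemma power_q_add: "(x + y :: 'a) ^ q = x ^ q + y ^ q"
  using q_eq_power_CHAR prime_CHAR freshmans_dream' by blast

lemma power_q_sum: "(\<Sum>i\<in>I. f i :: 'a) ^ q = (\<Sum>i\<in>I. f i ^ q)"
  using q_eq_power_CHAR prime_CHAR freshmans_dream_sum' by blast

lemma power_q_diff: "(x - y :: 'a) ^ q = x ^ q - y ^ q"
  using power_q_add[of "x - y" y] by simp

lemma power_q_of_nat: "(of_nat k :: 'a) ^ q = of_nat k"
  using q_ge_2 by (induction k) (simp_all add: power_q_add)

lemma power_q_q: "((x::'a) ^ q) ^ q = x"
  using power_card_UNIV[of x] by (simp add: card_field power2_eq_square power_mult)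

lemma herm_add: "h (x + x') y = h x y + h x' y" "h x (y + y') = h x y + h x y'"
  by (simp_all add: herm_def power_q_add algebra_simps sum.distrib)

lemma herm_diff: "h (x - x') y = h x y - h x' y" "h x (y - y') = h x y - h x y'"
  by (simp_all add: herm_def power_q_diff algebra_simps sum_subtractf)

lemma herm_scale: "h (c *s x) y = c ^ q * h x y" "h x (c *s y) = c * h x y"
  by (simp_all add: herm_def power_mult_distrib sum_distrib_left algebra_simps)

lemma herm_zero [simp]: "h 0 y = 0" "h x 0 = 0"
  using q_ge_2 by (simp_all add: herm_def zero_power)

lemma herm_conjugate: "h y x = h x y ^ q"
  by (simp add: herm_def power_q_sum power_mult_distrib power_q_q mult.commute)

lemma herm_eq_0_commute: "h x y = 0 \<longleftrightarrow> h y x = 0"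
  unfolding herm_conjugate[of x y] using q_ge_2 by simp

lemma herm_nondegenerate:
  assumes "x \<in> W" "\<And>y. h y x = 0"
  shows "x = 0"
proof
  fix i
  show "x i = 0 i"
  proof (cases "i < n")
    case True
    have "h (basis_fun i) x = (\<Sum>j<n. x j * basis_fun i j)"
      unfolding herm_def using q_ge_2 by (intro sum.cong) (auto simp: basis_fun_def)
    then show ?thesis using sum_mult_basis_fun(1)[OF True, of x] assms(2) by simp
  qed (use assms(1) in \<open>simp add: mem_coord_space_iff\<close>)
qed

definition adjoint :: "'a endo \<Rightarrow> 'a endo \<Rightarrow> bool" where
  "adjoint f g \<longleftrightarrow> (\<forall>x y. h (app f x) y = h x (app g y))"

lemma adjoint_one: "adjoint 1 1"
  by (simp add: adjoint_def)

lemma adjoint_add: "\<lbrakk>adjoint f g; adjoint f' g'\<rbrakk> \<Longrightarrow> adjoint (f + f') (g + g')"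
  by (simp add: adjoint_def herm_add)

lemma adjoint_diff: "\<lbrakk>adjoint f g; adjoint f' g'\<rbrakk> \<Longrightarrow> adjoint (f - f') (g - g')"
  by (simp add: adjoint_def herm_diff)

lemma adjoint_mult: "\<lbrakk>adjoint f g; adjoint f' g'\<rbrakk> \<Longrightarrow> adjoint (f * f') (g' * g)"
  by (simp add: adjoint_def)

lemma adjoint_power: "adjoint f g \<Longrightarrow> adjoint (f ^ k) (g ^ k)"
proof (induction k)
  case (Suc k)
  then show ?case using adjoint_mult[of f g "f ^ k" "g ^ k"] by (simp add: power_commutes)
qed (simp add: adjoint_one)

lemma adjoint_sum:
  assumes "\<And>i. i \<in> I \<Longrightarrow> adjoint (f i) (g i)"
  shows "adjoint (\<Sum>i\<in>I. f i) (\<Sum>i\<in>I. g i)"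
  using assms
proof (induction I rule: infinite_finite_induct)
  case (insert i I)
  then show ?case by (simp add: adjoint_add)
qed (simp_all add: adjoint_def)

lemma adjoint_scalar_endo: "adjoint (scalar_endo c) (scalar_endo (c ^ q))"
  by (simp add: adjoint_def herm_scale)

abbreviation rep :: "'a mat \<Rightarrow> 'a endo" where "rep \<equiv> mat_endo n"

lemma adjoint_rep_transpose:
  assumes "A \<in> carrier_mat n n"
  shows "adjoint (rep A) (rep (transpose_mat (bar_mat q A)))"
  unfolding adjoint_def
proof (intro allI)
  fix x y
  have "h (app (rep A) x) y = (\<Sum>i<n. \<Sum>j<n. A $$ (i, j) ^ q * x j ^ q * y i)"
    by (simp add: herm_def app_mat_endo power_q_sum power_mult_distrib sum_distrib_right)
  also have "\<dots> = (\<Sum>j<n. \<Sum>i<n. A $$ (i, j) ^ q * x j ^ q * y i)" by (rule sum.swap)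
  also have "\<dots> = h x (app (rep (transpose_mat (bar_mat q A))) y)"
    using assms
    by (simp add: herm_def app_mat_endo bar_mat_def sum_distrib_left mult_ac)
  finally show "h (app (rep A) x) y = h x (app (rep (transpose_mat (bar_mat q A))) y)" .
qed

lemma unitary_mats_iff:
  assumes A: "A \<in> carrier_mat n n"
  shows "A \<in> unitary_mats q n \<longleftrightarrow> (\<forall>x y. h (app (rep A) x) (app (rep A) y) = h x y)"
proof -
  define B where "B = transpose_mat (bar_mat q A)"
  have B: "B \<in> carrier_mat n n" using A by (simp add: B_def bar_mat_def)
  have h_BA: "h (app (rep A) x) (app (rep A) y) = h x (app (rep (B * A)) y)" for x y
    using adjoint_rep_transpose[OF A] mat_endo_mult[OF B A] by (simp add: adjoint_def B_def)
  have "A \<in> unitary_mats q n \<longleftrightarrow> B * A = 1\<^sub>m n" using A by (simp add: unitary_mats_def B_def)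
  also have "\<dots> \<longleftrightarrow> (\<forall>x y. h x (app (rep (B * A)) y) = h x y)"
  proof
    assume isometric: "\<forall>x y. h x (app (rep (B * A)) y) = h x y"
    show "B * A = 1\<^sub>m n"
    proof (rule mat_eqI_coord_space)
      fix y assume y: "y \<in> W"
      have "app (rep (B * A)) y \<in> W" using mat_like_coord_space[OF mat_like_mat_endo y] .
      then have "app (rep (B * A)) y - y \<in> W"
        using y subspace_coord_space fun_space.subspace_diff by blast
      then have "app (rep (B * A)) y - y = 0"
        using isometric by (intro herm_nondegenerate) (simp_all add: herm_diff)
      then show "app (rep (B * A)) y = app (rep (1\<^sub>m n)) y" by (simp add: mat_endo_one)
    qed (use A B in auto)
  qed (simp add: mat_endo_one)
  finally show ?thesis by (simp add: h_BA)
qed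

lemma carrier_iff_isometry:
  "A \<in> carrier G \<longleftrightarrow> A \<in> carrier_mat n n \<and> (\<forall>x y. h (app (rep A) x) (app (rep A) y) = h x y)"
  using unitary_mats_iff by (auto simp: G_def unitary_group_def unitary_mats_def)

lemma carrier_matI: "A \<in> carrier G \<Longrightarrow> A \<in> carrier_mat n n"
  using carrier_iff_isometry by blast

lemma mult_eq: "A \<otimes> B = A * B" and one_eq: "\<one> = 1\<^sub>m n"
  by (simp_all add: G_def unitary_group_def)

lemma rep_mult: "\<lbrakk>A \<in> carrier G; B \<in> carrier G\<rbrakk> \<Longrightarrow> rep (A \<otimes> B) = rep A * rep B"
  by (simp add: mat_endo_mult carrier_matI mult_eq)

lemma rep_one: "rep \<one> = 1"
  by (simp add: mat_endo_one one_eq)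

lemma isometry: "A \<in> carrier G \<Longrightarrow> h (app (rep A) x) (app (rep A) y) = h x y"
  using carrier_iff_isometry by blast

sublocale group G
proof (rule groupI)
  fix A B C assume A: "A \<in> carrier G" and B: "B \<in> carrier G" and C: "C \<in> carrier G"
  have "A \<otimes> B \<in> carrier_mat n n"
    unfolding mult_eq using mult_carrier_mat[OF carrier_matI[OF A] carrier_matI[OF B]] .
  moreover have "h (app (rep (A \<otimes> B)) x) (app (rep (A \<otimes> B)) y) = h x y" for x y
    using rep_mult[OF A B] isometry[OF A] isometry[OF B] by simp
  ultimately show "A \<otimes> B \<in> carrier G" unfolding carrier_iff_isometry by blast
  show "A \<otimes> B \<otimes> C = A \<otimes> (B \<otimes> C)"
    unfolding mult_eq
    using assoc_mult_mat[OF carrier_matI[OF A] carrier_matI[OF B] carrier_matI[OF C]] .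
next
  show "\<one> \<in> carrier G" by (simp add: carrier_iff_isometry rep_one one_eq mat_endo_one)
next
  fix A assume A: "A \<in> carrier G"
  note A_mat = carrier_matI[OF A]
  show "\<one> \<otimes> A = A" using A_mat by (simp add: mult_eq one_eq)
  define B where "B = transpose_mat (bar_mat q A)"
  have B_mat: "B \<in> carrier_mat n n" using A_mat by (simp add: B_def bar_mat_def)
  have BA: "B * A = 1\<^sub>m n"
    using A by (simp add: B_def G_def unitary_group_def unitary_mats_def)
  then have "A * B = 1\<^sub>m n" using mat_mult_left_right_inverse A_mat B_mat by blast
  then have "rep A * rep B = 1" using mat_endo_mult[OF A_mat B_mat] by (simp add: mat_endo_one)
  then have "app (rep A) (app (rep B) x) = x" for x using app_endo(2,6) by metis
  then have "h (app (rep B) x) (app (rep B) y) = h x y" for x y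
    using isometry[OF A, of "app (rep B) x" "app (rep B) y"] by simp
  then have "B \<in> carrier G" using B_mat by (simp add: carrier_iff_isometry)
  then show "\<exists>B\<in>carrier G. B \<otimes> A = \<one>" using BA by (auto simp: mult_eq one_eq)
qed

lemma finite_carrier: "finite (carrier G)"
proof (rule finite_subset)
  let ?F = "PiE ({..<n} \<times> {..<n}) (\<lambda>_. UNIV :: 'a set)"
  show "carrier G \<subseteq> mat n n ` ?F"
  proof
    fix A assume "A \<in> carrier G"
    then have "A = mat n n (restrict (\<lambda>ij. A $$ ij) ({..<n} \<times> {..<n}))"
      using carrier_matI by (intro eq_matI) auto
    then show "A \<in> mat n n ` ?F" by (metis image_eqI restrict_PiE_iff UNIV_I)
  qed
  show "finite (mat n n ` ?F)" by (intro finite_imageI finite_PiE) auto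
qed

lemma mat_like_isometryE:
  assumes "mat_like n f" "\<And>x y. h (app f x) (app f y) = h x y"
  obtains A where "A \<in> carrier G" "rep A = f"
proof -
  obtain A where A: "A \<in> carrier_mat n n" "f = rep A" using mat_likeE[OF assms(1)] .
  then have "A \<in> carrier G" unfolding carrier_iff_isometry using assms(2) by blast
  then show thesis using that A(2) by blast
qed

lemma carrier_eqI:
  assumes "A \<in> carrier G" "B \<in> carrier G" "\<And>x. x \<in> W \<Longrightarrow> app (rep A) x = app (rep B) x"
  shows "A = B"
  using mat_eqI_coord_space[OF carrier_matI[OF assms(1)] carrier_matI[OF assms(2)] assms(3)] .

lemma rep_inject: "\<lbrakk>A \<in> carrier G; B \<in> carrier G\<rbrakk> \<Longrightarrow> rep A = rep B \<longleftrightarrow> A = B"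
  using carrier_eqI[of A B] by metis

lemma rep_inv: "A \<in> carrier G \<Longrightarrow> rep (inv A) * rep A = 1" "A \<in> carrier G \<Longrightarrow> rep A * rep (inv A) = 1"
  using rep_mult[of "inv A" A] rep_mult[of A "inv A"] rep_one by auto

lemma rep_pow: "A \<in> carrier G \<Longrightarrow> rep (A [^] (k::nat)) = rep A ^ k"
  by (induction k) (simp_all add: rep_one rep_mult power_commutes)

lemma rep_commute_iff:
  "\<lbrakk>A \<in> carrier G; B \<in> carrier G\<rbrakk> \<Longrightarrow> rep A * rep B = rep B * rep A \<longleftrightarrow> A \<otimes> B = B \<otimes> A"
  using rep_inject[of "A \<otimes> B" "B \<otimes> A"] by (simp add: rep_mult)

lemma adjoint_rep:
  assumes A: "A \<in> carrier G"
  shows "adjoint (rep A) (rep (inv A))"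
  unfolding adjoint_def
proof (intro allI)
  fix x y
  have "h (app (rep A) x) y = h (app (rep A) x) (app (rep A * rep (inv A)) y)"
    using rep_inv(2)[OF A] by simp
  then show "h (app (rep A) x) y = h x (app (rep (inv A)) y)" using isometry[OF A] by simp
qed

end

section \<open>Commutants and projections onto fixed spaces\<close>

definition commutant :: "'r::ring_1 set \<Rightarrow> 'r set" where
  "commutant M = {y. \<forall>x\<in>M. y * x = x * y}"

lemma commutantD: "\<lbrakk>y \<in> commutant M; x \<in> M\<rbrakk> \<Longrightarrow> y * x = x * y"
  by (simp add: commutant_def)

lemma commutant_one: "1 \<in> commutant M"
  by (simp add: commutant_def)

lemma commutant_add: "\<lbrakk>y \<in> commutant M; y' \<in> commutant M\<rbrakk> \<Longrightarrow> y + y' \<in> commutant M"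
  by (simp add: commutant_def distrib_left distrib_right)

lemma commutant_diff: "\<lbrakk>y \<in> commutant M; y' \<in> commutant M\<rbrakk> \<Longrightarrow> y - y' \<in> commutant M"
  by (simp add: commutant_def left_diff_distrib right_diff_distrib)

lemma commutant_mult:
  assumes "y \<in> commutant M" "y' \<in> commutant M"
  shows "y * y' \<in> commutant M"
  unfolding commutant_def
proof (intro CollectI ballI)
  fix x assume "x \<in> M"
  then have "y * y' * x = (y * x) * y'" using commutantD[OF assms(2)] by (simp add: mult.assoc)
  then show "y * y' * x = x * (y * y')"
    using commutantD[OF assms(1) \<open>x \<in> M\<close>] by (simp add: mult.assoc)
qed

lemma commutant_power: "y \<in> commutant M \<Longrightarrow> y ^ k \<in> commutant M"
  by (induction k) (simp_all add: commutant_one commutant_mult)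

lemma commutant_sum: "(\<And>i. i \<in> I \<Longrightarrow> y i \<in> commutant M) \<Longrightarrow> (\<Sum>i\<in>I. y i) \<in> commutant M"
  by (simp add: commutant_def sum_distrib_left sum_distrib_right)

lemma commutant_inverse:
  assumes "a \<in> commutant M" "a * b = 1" "b * a = 1"
  shows "b \<in> commutant M"
  unfolding commutant_def
proof (intro CollectI ballI)
  fix x assume "x \<in> M"
  have "b * x = b * (x * a) * b" using assms(2) by (simp add: mult.assoc)
  also have "x * a = a * x" using commutantD[OF assms(1) \<open>x \<in> M\<close>] by simp
  also have "b * (a * x) * b = x * b" using assms(3) by (simp flip: mult.assoc)
  finally show "b * x = x * b" .
qed

lemma commutant_antimono: "M \<subseteq> Y \<Longrightarrow> commutant Y \<subseteq> commutant M"
  by (auto simp: commutant_def)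

lemma subset_double_commutant: "M \<subseteq> commutant (commutant M)"
  by (auto simp: commutant_def)

lemma double_commutant_commute:
  assumes M: "M \<subseteq> commutant M" and y: "y \<in> commutant (commutant M)" "y' \<in> commutant (commutant M)"
  shows "y * y' = y' * y"
  using commutantD[OF y(1)] y(2) commutant_antimono[OF M] by blast

lemma commutant_conjugate:
  assumes u: "u' * u = 1" and M: "\<And>x. x \<in> M \<Longrightarrow> u * x * u' \<in> M" and y: "y \<in> commutant M"
  shows "u' * y * u \<in> commutant M"
  unfolding commutant_def
proof (intro CollectI ballI)
  fix x assume "x \<in> M"
  have "u' * y * u * x = u' * (y * (u * x * u')) * u" using u by (simp add: mult.assoc)
  also have "y * (u * x * u') = u * x * u' * y" using commutantD[OF y M[OF \<open>x \<in> M\<close>]] .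
  also have "u' * (u * x * u' * y) * u = x * (u' * y * u)"
    using u by (simp add: mult.assoc) (simp flip: mult.assoc)
  finally show "u' * y * u * x = x * (u' * y * u)" .
qed

locale central_prime_inverse =
  fixes p :: nat and c :: "'r::ring_1"
  assumes prime_p: "prime p" and c_commute: "c * x = x * c" and c_mult_p: "c * of_nat p = 1"
begin

definition fix_proj :: "'r \<Rightarrow> 'r" where
  "fix_proj x = c * (\<Sum>j<p. x ^ j)"

lemma c_in_commutant: "c \<in> commutant M"
  by (simp add: commutant_def c_commute)

lemma mult_sum_powers:
  fixes x :: 'r
  assumes "x ^ p = 1"
  shows "x * (\<Sum>j<p. x ^ j) = (\<Sum>j<p. x ^ j)"
proof -
  have "1 + x * (\<Sum>j<p. x ^ j) = (\<Sum>j<Suc p. x ^ j)"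
    unfolding sum.lessThan_Suc_shift by (simp add: sum_distrib_left)
  also have "\<dots> = (\<Sum>j<p. x ^ j) + 1" using assms by simp
  finally show ?thesis by (simp add: add.commute)
qed

lemma mult_fix_proj:
  assumes "x ^ p = 1"
  shows "x * fix_proj x = fix_proj x"
proof -
  have "x * fix_proj x = c * (x * (\<Sum>j<p. x ^ j))"
    unfolding fix_proj_def by (simp add: c_commute mult.assoc)
  then show ?thesis unfolding mult_sum_powers[OF assms] by (simp add: fix_proj_def)
qed

lemma fix_proj_mult_fixed:
  assumes "x * y = y"
  shows "fix_proj x * y = y"
proof -
  have "x ^ j * y = y" for j by (induction j) (simp_all add: assms mult.assoc)
  then have "(\<Sum>j<p. x ^ j) * y = of_nat p * y" by (simp add: sum_distrib_right)
  then show ?thesis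
    by (simp add: fix_proj_def mult.assoc c_mult_p flip: mult.assoc[of c "of_nat p"])
qed

lemma fix_proj_idem: "x ^ p = 1 \<Longrightarrow> fix_proj x * fix_proj x = fix_proj x"
  by (simp add: fix_proj_mult_fixed mult_fix_proj)

lemma fix_proj_in_commutant: "x \<in> commutant M \<Longrightarrow> fix_proj x \<in> commutant M"
  unfolding fix_proj_def by (intro commutant_mult c_in_commutant commutant_sum commutant_power)

lemma fix_proj_inverse:
  assumes x: "x ^ p = 1" and y: "x * y = 1" "y * x = 1"
  shows "fix_proj y = fix_proj x"
proof -
  have "y ^ p = 1" using left_right_inverse_power[OF y(2), of p] x by simp
  have commute: "fix_proj x * fix_proj y = fix_proj y * fix_proj x"
  proof -
    have "y \<in> commutant {x}" using y by (simp add: commutant_def)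
    then have "fix_proj y \<in> commutant {x}" by (rule fix_proj_in_commutant)
    then have "x \<in> commutant {fix_proj y}" by (simp add: commutant_def)
    then have "fix_proj x \<in> commutant {fix_proj y}" by (rule fix_proj_in_commutant)
    then show ?thesis by (simp add: commutant_def)
  qed
  have "x * fix_proj y = x * (y * fix_proj y)" using mult_fix_proj[OF \<open>y ^ p = 1\<close>] by simp
  then have "fix_proj x * fix_proj y = fix_proj y"
    using y(1) by (intro fix_proj_mult_fixed) (simp flip: mult.assoc)
  moreover have "y * fix_proj x = y * (x * fix_proj x)" using mult_fix_proj[OF x] by simp
  then have "fix_proj y * fix_proj x = fix_proj x"
    using y(2) by (intro fix_proj_mult_fixed) (simp flip: mult.assoc)
  ultimately show ?thesis using commute by simp
qed

end

section \<open>Quadratic action in coprime characteristic\<close>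

locale commuting_roots = central_prime_inverse p c for p and c :: "'r::ring_1" +
  fixes v z :: 'r
  assumes v_z_commute: "v * z = z * v" and v_power_p: "v ^ p = 1" and z_power_p: "z ^ p = 1"
begin

definition "moving_proj = 1 - fix_proj z"

definition "eigen_proj i = moving_proj * fix_proj (v * z ^ i)"

definition "partial x = 1 + eigen_proj 0 * (x - 1)"

context
  fixes M
  assumes v: "v \<in> commutant M" and z: "z \<in> commutant M"
begin

lemma moving_proj_in_commutant: "moving_proj \<in> commutant M"
  unfolding moving_proj_def by (intro commutant_diff commutant_one fix_proj_in_commutant z)

lemma eigen_proj_in_commutant: "eigen_proj i \<in> commutant M"
  unfolding eigen_proj_def
  by (intro commutant_mult commutant_power moving_proj_in_commutant fix_proj_in_commutant v z)

lemma partial_in_commutant: "x \<in> commutant M \<Longrightarrow> partial x \<in> commutant M"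
  unfolding partial_def
  by (intro commutant_add commutant_mult commutant_diff commutant_one eigen_proj_in_commutant)

end

abbreviation "\<A> \<equiv> commutant (commutant {v, z})"

lemma v_in_\<A>: "v \<in> \<A>" and z_in_\<A>: "z \<in> \<A>"
  using subset_double_commutant[of "{v, z}"] by auto

lemma \<A>_commute: "\<lbrakk>x \<in> \<A>; y \<in> \<A>\<rbrakk> \<Longrightarrow> x * y = y * x"
  by (rule double_commutant_commute[of "{v, z}"]) (auto simp: commutant_def v_z_commute)

lemmas in_\<A> = moving_proj_in_commutant[OF v_in_\<A> z_in_\<A>] eigen_proj_in_commutant[OF v_in_\<A> z_in_\<A>]
  fix_proj_in_commutant commutant_mult[OF v_in_\<A> commutant_power[OF z_in_\<A>]]

lemma moving_proj_idem: "moving_proj * moving_proj = moving_proj"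
  using fix_proj_idem[OF z_power_p] by (simp add: moving_proj_def algebra_simps)

lemma moving_proj_mult_fixed: "z * y = y \<Longrightarrow> moving_proj * y = 0"
  using fix_proj_mult_fixed[of z y] by (simp add: moving_proj_def algebra_simps)

lemma z_power_power_p: "(z ^ i) ^ p = 1"
  using z_power_p by (metis mult.commute power_mult power_one)

lemma fixed_if_power_fixed:
  assumes "0 < i" "i < p" "z ^ i * y = y"
  shows "z * y = y"
proof -
  have "coprime i p"
    using assms(1,2) prime_p by (metis coprime_commute nat_dvd_not_less prime_imp_coprime)
  then obtain m where "[i * m = 1] (mod p)" using cong_solve_coprime_nat by auto
  then have m: "(i * m) mod p = 1" using prime_gt_1_nat[OF prime_p] by (simp add: cong_def)
  have "z ^ (i * m) = z ^ (p * (i * m div p) + i * m mod p)" by simp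
  also have "\<dots> = z" unfolding power_add power_mult m z_power_p by simp
  finally have "(z ^ i) ^ m = z" by (simp add: power_mult)
  moreover have "(z ^ i) ^ k * y = y" for k by (induction k) (simp_all add: assms(3) mult.assoc)
  ultimately show ?thesis by metis
qed

lemma v_z_power_power: "(v * z ^ i) ^ j = v ^ j * z ^ (i * j)"
proof (induction j)
  case (Suc j)
  have "z ^ i \<in> \<A>" "v ^ j \<in> \<A>" by (intro commutant_power v_in_\<A> z_in_\<A>)+
  have "(v * z ^ i) ^ Suc j = v * (z ^ i * v ^ j) * z ^ (i * j)" using Suc by (simp add: mult.assoc)
  also have "z ^ i * v ^ j = v ^ j * z ^ i" using \<A>_commute \<open>z ^ i \<in> \<A>\<close> \<open>v ^ j \<in> \<A>\<close> by blast
  finally show ?case by (simp add: mult.assoc power_add)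
qed simp

lemma v_z_power_root: "(v * z ^ i) ^ p = 1"
  unfolding v_z_power_power power_mult by (simp add: v_power_p z_power_power_p)

lemma eigen_proj_idem: "eigen_proj i * eigen_proj i = eigen_proj i"
proof -
  let ?P = "fix_proj (v * z ^ i)"
  have "?P * moving_proj = moving_proj * ?P" by (intro \<A>_commute in_\<A>)
  then have "eigen_proj i * eigen_proj i = (moving_proj * moving_proj) * (?P * ?P)"
    unfolding eigen_proj_def by (metis mult.assoc)
  then show ?thesis by (simp add: moving_proj_idem fix_proj_idem[OF v_z_power_root] eigen_proj_def)
qed

lemma eigen_proj_orthogonal:
  assumes "0 < i" "i < p"
  shows "eigen_proj 0 * eigen_proj i = 0"
proof -
  let ?P = "fix_proj v" and ?R = "fix_proj (v * z ^ i)"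
  have "?P \<in> \<A>" "?R \<in> \<A>" "v \<in> \<A>" "moving_proj \<in> \<A>" by (intro in_\<A> v_in_\<A>)+
  note commute = \<A>_commute[OF \<open>?P \<in> \<A>\<close> \<open>?R \<in> \<A>\<close>] \<A>_commute[OF \<open>?P \<in> \<A>\<close> \<open>moving_proj \<in> \<A>\<close>]
  have v_fixes: "v * (?P * ?R) = ?P * ?R"
    using mult_fix_proj[OF v_power_p] by (simp flip: mult.assoc)
  have "(v * z ^ i) * (?P * ?R) = ?P * ?R"
    unfolding commute(1) using mult_fix_proj[OF v_z_power_root, of i] by (simp flip: mult.assoc)
  moreover have "v * z ^ i = z ^ i * v" by (intro \<A>_commute v_in_\<A> commutant_power z_in_\<A>)
  ultimately have "z ^ i * (?P * ?R) = ?P * ?R" using v_fixes by (simp add: mult.assoc)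
  then have "moving_proj * (?P * ?R) = 0"
    using moving_proj_mult_fixed fixed_if_power_fixed[OF assms] by blast
  moreover have "eigen_proj 0 * eigen_proj i = moving_proj * (moving_proj * (?P * ?R))"
    unfolding eigen_proj_def using commute(2) by (simp add: mult.assoc) (metis mult.assoc)
  ultimately show ?thesis by simp
qed

lemma sum_eigen_proj: "(\<Sum>i<p. eigen_proj i) = moving_proj"
proof -
  define N where "N j = (\<Sum>i<p. (z ^ j) ^ i)" for j
  have "(\<Sum>i<p. \<Sum>j<p. (v * z ^ i) ^ j) = (\<Sum>i<p. \<Sum>j<p. v ^ j * (z ^ j) ^ i)"
    by (simp add: v_z_power_power mult.commute flip: power_mult)
  also have "\<dots> = (\<Sum>j<p. v ^ j * N j)" unfolding N_def sum_distrib_left by (rule sum.swap)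
  finally have sum_eq: "(\<Sum>i<p. fix_proj (v * z ^ i)) = c * (\<Sum>j<p. v ^ j * N j)"
    by (simp add: fix_proj_def flip: sum_distrib_left)
  have "moving_proj * (v ^ j * N j) = 0" if "j \<in> {..<p} - {0}" for j
  proof -
    have "z ^ j * N j = N j" unfolding N_def by (rule mult_sum_powers[OF z_power_power_p])
    then have "moving_proj * N j = 0"
      using that moving_proj_mult_fixed fixed_if_power_fixed by force
    moreover have "moving_proj * v ^ j = v ^ j * moving_proj"
      by (intro \<A>_commute in_\<A> commutant_power v_in_\<A>)
    ultimately show ?thesis by (metis mult.assoc mult_zero_right)
  qed
  then have "moving_proj * (\<Sum>j<p. v ^ j * N j) = (\<Sum>j\<in>{0}. moving_proj * (v ^ j * N j))"
    unfolding sum_distrib_left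
    using prime_gt_0_nat[OF prime_p] by (intro sum.mono_neutral_right) auto
  also have "\<dots> = moving_proj * of_nat p" by (simp add: N_def)
  finally have "moving_proj * (\<Sum>i<p. fix_proj (v * z ^ i)) = c * (moving_proj * of_nat p)"
    unfolding sum_eq by (metis c_commute mult.assoc)
  also have "\<dots> = moving_proj" by (metis c_commute c_mult_p mult.assoc mult_1_right)
  finally show ?thesis by (simp add: eigen_proj_def sum_distrib_left)
qed

lemma partial_one: "partial 1 = 1"
  by (simp add: partial_def)

lemma partial_mult:
  assumes "x * eigen_proj 0 = eigen_proj 0 * x"
  shows "partial x * partial y = partial (x * y)"
proof -
  let ?e = "eigen_proj 0"
  have "?e * (x - 1) * (?e * (y - 1)) = ?e * ((x - 1) * ?e) * (y - 1)" by (simp only: mult.assoc)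
  also have "(x - 1) * ?e = ?e * (x - 1)" using assms by (simp add: algebra_simps)
  also have "?e * (?e * (x - 1)) * (y - 1) = (?e * ?e) * ((x - 1) * (y - 1))"
    by (simp only: mult.assoc)
  finally have "?e * (x - 1) * (?e * (y - 1)) = ?e * ((x - 1) * (y - 1))"
    unfolding eigen_proj_idem .
  then show ?thesis unfolding partial_def by (simp add: algebra_simps)
qed

lemma z_eigen_proj_commute: "z * eigen_proj i = eigen_proj i * z"
  by (intro \<A>_commute in_\<A> z_in_\<A>)

lemma partial_power: "partial z ^ k = partial (z ^ k)"
  by (induction k) (simp_all add: partial_one partial_mult z_eigen_proj_commute)

lemma partial_power_p: "partial z ^ p = 1"
  by (simp add: partial_power z_power_p partial_one)

context
  fixes g g'
  assumes g: "g * g' = 1" "g' * g = 1" and conj_v: "g' * v * g = v * z" and conj_z: "g' * z * g = z"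
begin

lemma conj_mult: "g' * (x * y) * g = (g' * x * g) * (g' * y * g)"
  using g(1) by (metis mult.assoc mult_1)

lemma conj_power: "g' * x ^ k * g = (g' * x * g) ^ k"
  by (induction k) (simp_all add: g(2) conj_mult)

lemma conj_fix_proj: "g' * fix_proj x * g = fix_proj (g' * x * g)"
proof -
  have "g' * c * g = c" using g(2) by (metis c_commute mult.assoc mult_1_right)
  then have "g' * fix_proj x * g = c * (g' * (\<Sum>j<p. x ^ j) * g)"
    unfolding fix_proj_def conj_mult by simp
  also have "g' * (\<Sum>j<p. x ^ j) * g = (\<Sum>j<p. (g' * x * g) ^ j)"
    by (simp add: sum_distrib_left sum_distrib_right conj_power)
  finally show ?thesis by (simp add: fix_proj_def)
qed

lemma conj_eigen_proj: "g' * eigen_proj i * g = eigen_proj (Suc i)"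
proof -
  have "g' * moving_proj * g = moving_proj"
    by (simp add: moving_proj_def right_diff_distrib left_diff_distrib g(2) conj_fix_proj conj_z)
  moreover have "g' * (v * z ^ i) * g = v * z ^ Suc i"
    unfolding conj_mult conj_v conj_power conj_z by (simp add: mult.assoc)
  ultimately show ?thesis unfolding eigen_proj_def conj_mult conj_fix_proj by simp
qed

lemma conj_one_plus_eigen_proj:
  "g' * (1 + eigen_proj i * (z - 1)) * g = 1 + eigen_proj (Suc i) * (z - 1)"
proof -
  have "g' * (z - 1) * g = z - 1" by (simp add: right_diff_distrib left_diff_distrib g(2) conj_z)
  then have "g' * (eigen_proj i * (z - 1)) * g = eigen_proj (Suc i) * (z - 1)"
    unfolding conj_mult conj_eigen_proj by simp
  then show ?thesis by (simp add: distrib_left distrib_right g(2))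
qed

text \<open>Conjugation by \<open>g\<close> moves the projection \<open>eigen_proj 0\<close> through \<open>eigen_proj 1\<close> to
  \<open>eigen_proj 2\<close>, both of which are orthogonal to it; so \<open>[w, g, g] = 1\<close> for \<open>w = partial z\<close> would
  make \<open>z\<close> trivial on its image.\<close>

theorem quadratic_imp_trivial:
  assumes p: "p \<ge> 3" and w': "w' * partial z = 1" "partial z * w' = 1"
    and quadratic: "g' * (w' * (g' * partial z * g)) * g = w' * (g' * partial z * g)"
  shows "z = 1"
proof -
  let ?w = "partial z" and ?e = "eigen_proj 0"
  define y where "y = w' * (g' * ?w * g)"
  have conj_w: "g' * ?w * g = 1 + eigen_proj 1 * (z - 1)"
    using conj_one_plus_eigen_proj[of 0] by (simp add: partial_def)
  then have conj_conj_w: "g' * (g' * ?w * g) * g = 1 + eigen_proj 2 * (z - 1)"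
    using conj_one_plus_eigen_proj[of 1] by (simp add: numeral_2_eq_2)
  have w_y: "?w * y = g' * ?w * g" unfolding y_def using w'(2) by (simp flip: mult.assoc)
  have e_conj_w: "?e * (g' * ?w * g) = ?e"
    unfolding conj_w
    using p eigen_proj_orthogonal[of 1] by (simp add: distrib_left flip: mult.assoc)
  have e_conj_conj_w: "?e * (g' * (g' * ?w * g) * g) = ?e"
    unfolding conj_conj_w
    using p eigen_proj_orthogonal[of 2] by (simp add: distrib_left flip: mult.assoc)
  have "g' * (g' * ?w * g) * g = (g' * ?w * g) * y"
    using conj_mult[of ?w y] w_y quadratic unfolding y_def by simp
  then have "?e * y = ?e" using e_conj_w e_conj_conj_w by (metis mult.assoc)
  moreover have "?e * ?w = z * ?e"
    unfolding partial_def z_eigen_proj_commute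
    by (simp add: distrib_left right_diff_distrib eigen_proj_idem flip: mult.assoc)
  ultimately have "z * ?e = ?e" using e_conj_w w_y by (metis mult.assoc)
  then have "moving_proj * ?e = 0" by (rule moving_proj_mult_fixed)
  then have "?e = 0" unfolding eigen_proj_def using moving_proj_idem by (simp flip: mult.assoc)
  then have "eigen_proj i = 0" for i
    by (induction i) (simp_all flip: conj_eigen_proj)
  then have "fix_proj z = 1" using sum_eigen_proj by (simp add: moving_proj_def)
  then show "z = 1" using mult_fix_proj[OF z_power_p] by simp
qed

end

end

locale unitary_sylow = unitary_space +
  fixes p :: nat and S
  assumes prime_p: "prime p" and sylow: "sylow_subgroup G p S"

sublocale unitary_sylow \<subseteq> p_subgroup G p S
proof (intro p_subgroup.intro p_subgroup_axioms.intro)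
  show "group G" by (rule is_group)
  have S: "subgroup S G" "card S = p ^ multiplicity p (order G)"
    using sylow by (auto simp: sylow_subgroup_def)
  then show "prime p" "subgroup S G" "p_group p (G\<lparr>carrier := S\<rparr>)"
    using prime_p subgroup_imp_group by (auto simp: p_group_def order_def)
qed

context unitary_sylow
begin

lemma normalized_exponent_p_subset_S:
  assumes D: "subgroup D G" "S \<subseteq> normalizer G D" and exponent: "\<And>x. x \<in> D \<Longrightarrow> x [^] p = \<one>"
  shows "D \<subseteq> S"
proof -
  have "finite D" using finite_subset[OF subgroup.subset[OF D(1)] finite_carrier] .
  then have "p_group p (G\<lparr>carrier := D\<rparr>)"
    using p_group_if_exponent_p[OF prime_p D(1)] exponent by blast
  then show ?thesis
    using sylow_contains_normalized_p_subgroup[OF finite_carrier prime_p sylow D(1) _ D(2)] by blast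
qed

end

locale coprime_unitary_sylow = unitary_sylow +
  assumes p_ge_3: "p \<ge> 3" and p_nonzero: "of_nat p \<noteq> (0 :: 'a)"

sublocale coprime_unitary_sylow \<subseteq> central_prime_inverse p "scalar_endo (1 / of_nat p) :: 'a endo"
proof
  show "prime p" by (rule prime_p)
  show "scalar_endo (1 / of_nat p) * f = f * scalar_endo (1 / of_nat p)" for f :: "'a endo"
    by (rule scalar_endo_commute)
  show "scalar_endo (1 / of_nat p) * of_nat p = (1 :: 'a endo)"
    unfolding of_nat_endo by (rule endo_eqI) (use p_nonzero in \<open>simp add: fun_eq_iff\<close>)
qed

context coprime_unitary_sylow
begin

lemma adjoint_fix_proj_rep:
  assumes A: "A \<in> carrier G" "A [^] p = \<one>"
  shows "adjoint (fix_proj (rep A)) (fix_proj (rep A))"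
proof -
  have "(1 / of_nat p :: 'a) ^ q = 1 / of_nat p" by (simp add: power_divide power_q_of_nat)
  then have "adjoint (scalar_endo (1 / of_nat p)) (scalar_endo (1 / of_nat p))"
    using adjoint_scalar_endo[of "1 / of_nat p"] by simp
  moreover have "adjoint (\<Sum>j<p. rep A ^ j) (\<Sum>j<p. rep (inv A) ^ j)"
    by (intro adjoint_sum adjoint_power adjoint_rep A)
  ultimately have "adjoint (fix_proj (rep A)) (fix_proj (rep (inv A)))"
    unfolding fix_proj_def c_commute[of "\<Sum>j<p. rep (inv A) ^ j"] by (rule adjoint_mult)
  moreover have "rep A ^ p = 1" using rep_pow[OF A(1), of p] A(2) rep_one by simp
  ultimately show ?thesis using fix_proj_inverse[OF _ rep_inv(2,1)[OF A(1)]] by simp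
qed

lemma commuting_roots_rep:
  assumes "v \<in> carrier G" "v [^] p = \<one>" "z \<in> carrier G" "z [^] p = \<one>" "v \<otimes> z = z \<otimes> v"
  shows "commuting_roots p (scalar_endo (1 / of_nat p)) (rep v) (rep z)"
proof
  show "rep v * rep z = rep z * rep v" using rep_commute_iff assms(1,3,5) by blast
  show "rep v ^ p = 1" "rep z ^ p = 1"
    using rep_pow[OF assms(1), of p] rep_pow[OF assms(3), of p] assms(2,4) rep_one by simp_all
qed

context
  fixes v z
  assumes v: "v \<in> carrier G" "v [^] p = \<one>" and z: "z \<in> carrier G" "z [^] p = \<one>"
    and v_z: "v \<otimes> z = z \<otimes> v"
begin

interpretation commuting_roots p "scalar_endo (1 / of_nat p)" "rep v" "rep z"
  by (rule commuting_roots_rep[OF v z v_z])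

lemma adjoint_eigen_proj: "adjoint (eigen_proj 0) (eigen_proj 0)"
proof -
  have "adjoint moving_proj moving_proj"
    unfolding moving_proj_def by (intro adjoint_diff adjoint_one adjoint_fix_proj_rep z)
  then have "adjoint (eigen_proj 0) (fix_proj (rep v) * moving_proj)"
    unfolding eigen_proj_def using adjoint_mult[OF _ adjoint_fix_proj_rep[OF v]] by simp
  moreover have "fix_proj (rep v) * moving_proj = eigen_proj 0"
    unfolding eigen_proj_def using \<A>_commute[OF in_\<A>(3,1)] v_in_\<A> by simp
  ultimately show ?thesis by simp
qed

lemma partial_rep_inv:
  "partial (rep (inv z)) * partial (rep z) = 1" "partial (rep z) * partial (rep (inv z)) = 1"
    "adjoint (partial (rep z)) (partial (rep (inv z)))"
proof -
  have "rep z \<in> commutant {eigen_proj 0}"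
    using z_eigen_proj_commute[of 0] by (simp add: commutant_def)
  then have "rep (inv z) \<in> commutant {eigen_proj 0}"
    using commutant_inverse rep_inv[OF z(1)] by blast
  then have commute: "rep (inv z) * eigen_proj 0 = eigen_proj 0 * rep (inv z)"
    by (simp add: commutant_def)
  show "partial (rep (inv z)) * partial (rep z) = 1" "partial (rep z) * partial (rep (inv z)) = 1"
    using partial_mult[OF commute] partial_mult[OF z_eigen_proj_commute[of 0]] rep_inv[OF z(1)]
      partial_one
    by simp_all
  have "adjoint (eigen_proj 0 * (rep z - 1)) ((rep (inv z) - 1) * eigen_proj 0)"
    by (intro adjoint_mult adjoint_eigen_proj adjoint_diff adjoint_rep z adjoint_one)
  then show "adjoint (partial (rep z)) (partial (rep (inv z)))"
    unfolding partial_def using commute adjoint_add[OF adjoint_one]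
    by (simp add: left_diff_distrib right_diff_distrib)
qed

lemma mat_like_partial: "mat_like n (partial (rep z))"
  unfolding mat_like_def
proof
  have "trunc n \<in> commutant {rep v, rep z}"
    using mat_like_mat_endo[of n v] mat_like_mat_endo[of n z]
    by (simp add: mat_like_def commutant_def)
  moreover have "partial (rep z) \<in> \<A>" by (rule partial_in_commutant[OF v_in_\<A> z_in_\<A> z_in_\<A>])
  ultimately show "partial (rep z) * trunc n = trunc n * partial (rep z)"
    by (simp add: commutant_def)
  have "(rep z - 1) * (1 - trunc n) = 0"
    using mat_like_mat_endo[of n z] by (simp add: mat_like_def left_diff_distrib)
  then show "partial (rep z) * (1 - trunc n) = 1 - trunc n"
    by (simp add: partial_def distrib_right mult.assoc)
qed

lemma partial_rep_unitaryE:
  obtains A where "A \<in> carrier G" "rep A = partial (rep z)" "A [^] p = \<one>"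
proof -
  have "h (app (partial (rep z)) x) (app (partial (rep z)) y) = h x y" for x y
  proof -
    have "h (app (partial (rep z)) x) (app (partial (rep z)) y)
        = h x (app (partial (rep (inv z)) * partial (rep z)) y)"
      using partial_rep_inv(3) by (simp add: adjoint_def)
    then show ?thesis unfolding partial_rep_inv(1) by simp
  qed
  then obtain A where A: "A \<in> carrier G" "rep A = partial (rep z)"
    using mat_like_isometryE[OF mat_like_partial] by blast
  moreover have "A [^] p = \<one>"
    using rep_inject[of "A [^] p" \<one>] rep_pow[OF A(1), of p] A partial_power_p rep_one by simp
  ultimately show thesis using that by blast
qed

lemma quadratic_partial_imp_eq_one:
  assumes g: "g \<in> carrier G" "z = commutator G v g" "z \<otimes> g = g \<otimes> z"
    and A: "A \<in> carrier G" "rep A = partial (rep z)" "commutator G A g \<otimes> g = g \<otimes> commutator G A g"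
  shows "z = \<one>"
proof -
  have rep_conj: "rep (inv g) * rep x * rep g = rep (inv g \<otimes> x \<otimes> g)" if "x \<in> carrier G" for x
    using that g(1) by (simp add: rep_mult)
  have "inv g \<otimes> v \<otimes> g = v \<otimes> z"
    unfolding g(2) commutator_def using v(1) g(1) by (simp add: word_simps)
  then have conj_v: "rep (inv g) * rep v * rep g = rep v * rep z"
    using v(1) z(1) by (simp add: rep_conj rep_mult)
  have "inv g \<otimes> z \<otimes> g = z" using g(1,3) z(1) by (simp add: word_simps)
  then have conj_z: "rep (inv g) * rep z * rep g = rep z" using z(1) by (simp add: rep_conj)
  have rep_A_inv: "rep (inv A) * partial (rep z) = 1" "partial (rep z) * rep (inv A) = 1"
    using rep_inv[OF A(1)] A(2) by simp_all
  have commutator_A: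
    "rep (commutator G A g) = rep (inv A) * (rep (inv g) * partial (rep z) * rep g)"
    unfolding A(2)[symmetric] commutator_def using A(1) g(1) by (simp add: rep_mult mult.assoc)
  have "inv g \<otimes> commutator G A g \<otimes> g = commutator G A g"
    using A(1,3) g(1) by (simp add: m_assoc inv_mult_cancel)
  then have "rep (inv g) * rep (commutator G A g) * rep g = rep (commutator G A g)"
    using A(1) g(1) by (simp add: rep_conj)
  then have "rep z = 1"
    using quadratic_imp_trivial[OF rep_inv(2,1)[OF g(1)] conj_v conj_z p_ge_3 rep_A_inv]
    unfolding commutator_A by blast
  then show ?thesis using rep_inject[OF z(1) one_closed] rep_one by simp
qed

end

definition double_commutant_roots :: "'a mat set \<Rightarrow> 'a mat set" where
  "double_commutant_roots V =
    {d \<in> carrier G. d [^] p = \<one> \<and> rep d \<in> commutant (commutant (rep ` V))}"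

context
  fixes V
  assumes V: "V \<subseteq> carrier G" "\<And>x y. \<lbrakk>x \<in> V; y \<in> V\<rbrakk> \<Longrightarrow> x \<otimes> y = y \<otimes> x"
begin

lemma double_commutant_roots_commute:
  assumes "x \<in> double_commutant_roots V" "y \<in> double_commutant_roots V"
  shows "x \<otimes> y = y \<otimes> x"
proof -
  have "rep ` V \<subseteq> commutant (rep ` V)"
    using V by (auto simp: commutant_def rep_commute_iff subset_iff)
  then have "rep x * rep y = rep y * rep x"
    using assms
    by (intro double_commutant_commute[of "rep ` V"]) (auto simp: double_commutant_roots_def)
  then show ?thesis using assms rep_commute_iff by (simp add: double_commutant_roots_def)
qed

lemma subgroup_double_commutant_roots: "subgroup (double_commutant_roots V) G"
proof (rule subgroupI)
  show "double_commutant_roots V \<subseteq> carrier G" by (auto simp: double_commutant_roots_def)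
  have "\<one> \<in> double_commutant_roots V"
    by (simp add: double_commutant_roots_def rep_one commutant_one)
  then show "double_commutant_roots V \<noteq> {}" by blast
  fix x assume x: "x \<in> double_commutant_roots V"
  then have "rep (inv x) \<in> commutant (commutant (rep ` V))"
    using commutant_inverse rep_inv unfolding double_commutant_roots_def by blast
  then show "inv x \<in> double_commutant_roots V"
    using x by (simp add: double_commutant_roots_def nat_pow_inv)
  fix y assume y: "y \<in> double_commutant_roots V"
  then show "x \<otimes> y \<in> double_commutant_roots V"
    using x pow_mult_distrib[OF double_commutant_roots_commute[OF x y]]
    by (simp add: double_commutant_roots_def rep_mult commutant_mult)
qed

lemma double_commutant_roots_subset_S:
  assumes normal: "S \<subseteq> normalizer G V"
  shows "double_commutant_roots V \<subseteq> S"
proof (rule normalized_exponent_p_subset_S[OF subgroup_double_commutant_roots])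
  show "x [^] p = \<one>" if "x \<in> double_commutant_roots V" for x
    using that by (simp add: double_commutant_roots_def)
  show "S \<subseteq> normalizer G (double_commutant_roots V)"
  proof (rule subset_normalizerI[OF subgroup_S subgroup.subset[OF subgroup_double_commutant_roots]])
    fix s d assume s: "s \<in> S" and d: "d \<in> double_commutant_roots V"
    have in_carrier: "s \<in> carrier G" "d \<in> carrier G"
      using s d S_closed(1) by (auto simp: double_commutant_roots_def)
    note rep_s = rep_inv[OF in_carrier(1)]
    have "rep s * x * rep (inv s) \<in> rep ` V" if x: "x \<in> rep ` V" for x
    proof -
      obtain u where u: "u \<in> V" "x = rep u" using x by blast
      then have "s \<otimes> u \<otimes> inv s \<in> V"
        using normalizer_closed(1)[OF subsetD[OF normal s] V(1)] by blast
      moreover have "rep s * x * rep (inv s) = rep (s \<otimes> u \<otimes> inv s)"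
        using u V(1) in_carrier(1) by (auto simp: rep_mult)
      ultimately show ?thesis by blast
    qed
    then have "rep (inv s) * y * rep s \<in> commutant (rep ` V)" if "y \<in> commutant (rep ` V)" for y
      using commutant_conjugate[OF rep_s(1) _ that] by blast
    then have "rep s * rep d * rep (inv s) \<in> commutant (commutant (rep ` V))"
      using d by (intro commutant_conjugate[OF rep_s(2)]) (auto simp: double_commutant_roots_def)
    then show "s \<otimes> d \<otimes> inv s \<in> double_commutant_roots V"
      using d in_carrier conjugate_pow[OF in_carrier]
      by (simp add: double_commutant_roots_def rep_mult)
  qed
qed

end

abbreviation "V \<equiv> Omega1 G p (C_S oliver)"

lemmas elab_V = elab_Omega1_centralizer_oliver[OF p_ge_3]
  and V_normal = normal_SD[OF normal_S_Omega1_centralizer_oliver[OF p_ge_3]]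

lemma double_commutant_roots_subset: "double_commutant_roots V \<subseteq> V"
proof
  fix d assume d: "d \<in> double_commutant_roots V"
  have d_in_S: "d \<in> S"
    using double_commutant_roots_subset_S[OF V_normal(4) elabD(6)[OF elab_V] V_normal(3)] d by blast
  have "d \<otimes> x = x \<otimes> d" if x: "x \<in> oliver" for x
  proof -
    have x_carrier: "x \<in> carrier G" using x normal_SD(4)[OF normal_S_oliver] by blast
    have "rep x \<in> commutant (rep ` V)"
      unfolding commutant_def
    proof (intro CollectI ballI, elim imageE)
      fix y u assume u: "y = rep u" "u \<in> V"
      then have "u \<otimes> x = x \<otimes> u"
        using centralizer_in_commute[of u S oliver x] x
        unfolding Omega1_centralizer_oliver[OF p_ge_3] by blast
      then show "rep x * y = y * rep x"
        using rep_commute_iff[OF x_carrier, of u] u V_normal(4) by auto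
    qed
    then have "rep d * rep x = rep x * rep d"
      using d commutantD by (auto simp: double_commutant_roots_def)
    then show ?thesis
      using rep_commute_iff[OF _ x_carrier] d by (simp add: double_commutant_roots_def)
  qed
  then show "d \<in> V"
    using d d_in_S unfolding Omega1_centralizer_oliver[OF p_ge_3]
    by (simp add: centralizer_in_def double_commutant_roots_def)
qed

lemma acts_quadratically_imp_centralizes:
  assumes g: "g \<in> S" "acts_quadratically V g"
  shows "g \<in> C_S V"
proof -
  have g_carrier: "g \<in> carrier G" using g(1) S_closed(1) by blast
  have commute: "commutator G v g \<otimes> g = g \<otimes> commutator G v g" if "v \<in> V" for v
    using g(2) that acts_quadratically_iff_commute[OF V_normal(4) g_carrier] by blast
  have "g \<otimes> v = v \<otimes> g" if v: "v \<in> V" for v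
  proof -
    define z where "z = commutator G v g"
    have z_in_V: "z \<in> V"
      unfolding z_def
      using commutator_in_normalized(2)[OF V_normal(1) _ v] V_normal(3) g(1) by blast
    have v_carrier: "v \<in> carrier G" and z_carrier: "z \<in> carrier G"
      using v z_in_V V_normal(4) by auto
    note roots = v_carrier elabD(7)[OF elab_V v] z_carrier elabD(7)[OF elab_V z_in_V]
      elabD(6)[OF elab_V v z_in_V]
    interpret commuting_roots p "scalar_endo (1 / of_nat p)" "rep v" "rep z"
      by (rule commuting_roots_rep[OF roots])
    obtain A where A: "A \<in> carrier G" "rep A = partial (rep z)" "A [^] p = \<one>"
      using partial_rep_unitaryE[OF roots] .
    have "rep v \<in> commutant (commutant (rep ` V))" "rep z \<in> commutant (commutant (rep ` V))"
      using subset_double_commutant[of "rep ` V"] v z_in_V by auto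
    then have "A \<in> double_commutant_roots V"
      using A partial_in_commutant by (simp add: double_commutant_roots_def)
    then have "commutator G A g \<otimes> g = g \<otimes> commutator G A g"
      using commute double_commutant_roots_subset by blast
    then have "z = \<one>"
      using quadratic_partial_imp_eq_one[OF roots g_carrier z_def _ A(1,2)] commute[OF v] z_def
      by blast
    then show ?thesis using commutator_eq_one_iff[OF v_carrier g_carrier] by (simp add: z_def)
  qed
  then show ?thesis using g(1) by (simp add: centralizer_in_def)
qed

theorem thompson_subset_oliver_coprime: "thompson_subgroup G p S \<subseteq> oliver"
  using thompson_subgroup_le_centralizer[OF elab_V V_normal(3) acts_quadratically_imp_centralizes]
    centralizer_Omega1_subset_oliver[OF p_ge_3] by blast

end

section \<open>Defining characteristic\<close>

definition additive_group :: "'v::ab_group_add set \<Rightarrow> 'v monoid" where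
  "additive_group M = \<lparr>carrier = M, monoid.mult = (+), one = 0\<rparr>"

lemma additive_group_simps [simp]:
  "carrier (additive_group M) = M" "x \<otimes>\<^bsub>additive_group M\<^esub> y = x + y" "\<one>\<^bsub>additive_group M\<^esub> = 0"
  by (simp_all add: additive_group_def)

lemma group_additive_group:
  assumes "fun_space.subspace M"
  shows "group (additive_group M)"
proof (rule groupI)
  fix x assume "x \<in> carrier (additive_group M)"
  then show "\<exists>y\<in>carrier (additive_group M). y \<otimes>\<^bsub>additive_group M\<^esub> x = \<one>\<^bsub>additive_group M\<^esub>"
    using fun_space.subspace_neg[OF assms] by (intro bexI[of _ "- x"]) auto
qed (use fun_space.subspace_0[OF assms] fun_space.subspace_add[OF assms] in \<open>auto simp: add.assoc\<close>)

lemma inv_additive_group: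
  assumes "fun_space.subspace M" "x \<in> M"
  shows "inv\<^bsub>additive_group M\<^esub> x = - x"
  using assms fun_space.subspace_neg[OF assms]
  by (intro group.inv_equality[OF group_additive_group]) auto

lemma subgroup_additive_group:
  assumes N: "fun_space.subspace N" and M: "fun_space.subspace M" and "N \<subseteq> M"
  shows "subgroup N (additive_group M)"
proof -
  interpret group "additive_group M" using group_additive_group[OF M] .
  show ?thesis
  proof (rule subgroupI)
    show "N \<noteq> {}" using fun_space.subspace_0[OF N] by blast
    fix x assume x: "x \<in> N"
    then show "inv\<^bsub>additive_group M\<^esub> x \<in> N"
      using inv_additive_group[OF M] fun_space.subspace_neg[OF N] \<open>N \<subseteq> M\<close> by auto
    show "x \<otimes>\<^bsub>additive_group M\<^esub> y \<in> N" if "y \<in> N" for y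
      using fun_space.subspace_add[OF N x that] by simp
  qed (use \<open>N \<subseteq> M\<close> in simp)
qed

context unitary_space
begin

abbreviation "act g \<equiv> app (rep g)"

lemma act_mult: "\<lbrakk>g \<in> carrier G; k \<in> carrier G\<rbrakk> \<Longrightarrow> act (g \<otimes> k) x = act g (act k x)"
  by (simp add: rep_mult)

lemma act_inv:
  assumes "g \<in> carrier G"
  shows "act g (act (inv g) x) = x" "act (inv g) (act g x) = x"
  using assms by (simp_all flip: act_mult, simp_all add: rep_one)

lemma act_inv_fixed: "\<lbrakk>g \<in> carrier G; act g x = x\<rbrakk> \<Longrightarrow> act (inv g) x = x"
  using act_inv(2)[of g x] by simp

lemma herm_act: "g \<in> carrier G \<Longrightarrow> h x (act g y) = h (act (inv g) x) y"
  using isometry[of g "act (inv g) x" y] act_inv(1)[of g x] by simp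

lemma act_coord_space: "x \<in> W \<Longrightarrow> act g x \<in> W"
  by (rule mat_like_coord_space[OF mat_like_mat_endo])

lemmas W_closed = fun_space.subspace_0[OF subspace_coord_space]
  fun_space.subspace_add[OF subspace_coord_space]
  fun_space.subspace_diff[OF subspace_coord_space] fun_space.subspace_scale[OF subspace_coord_space]

definition perp :: "(nat \<Rightarrow> 'a) set \<Rightarrow> (nat \<Rightarrow> 'a) set" where
  "perp M = {x \<in> W. \<forall>u\<in>M. h u x = 0}"

lemma subspace_perp: "fun_space.subspace (perp M)"
  by (intro fun_space.subspaceI) (auto simp: perp_def herm_add herm_scale W_closed)

lemma perp_antimono: "M \<subseteq> N \<Longrightarrow> perp N \<subseteq> perp M"
  by (auto simp: perp_def)

lemma act_perp:
  assumes g: "g \<in> carrier G" and M: "\<And>u. u \<in> M \<Longrightarrow> act (inv g) u \<in> M" and x: "x \<in> perp M"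
  shows "act g x \<in> perp M"
  using x M herm_act[OF g] act_coord_space by (auto simp: perp_def)

lemma displacement_in_perp:
  assumes g: "g \<in> carrier G" and fixes_M: "\<And>u. u \<in> M \<Longrightarrow> act g u = u" and x: "x \<in> W"
  shows "act g x - x \<in> perp M"
proof -
  have "h u (act g x - x) = 0" if "u \<in> M" for u
    using herm_act[OF g] act_inv_fixed[OF g fixes_M[OF that]] by (simp add: herm_diff)
  then show ?thesis
    using x by (simp add: perp_def W_closed act_coord_space)
qed

definition transvection :: "'a \<Rightarrow> (nat \<Rightarrow> 'a) \<Rightarrow> 'a endo" where
  "transvection c u = Abs_endo (\<lambda>x. x + (c * h u x) *s u)"

lemma app_transvection [simp]: "app (transvection c u) x = x + (c * h u x) *s u"
proof -
  have "Vector_Spaces.linear (*s) (*s) (\<lambda>x. x + (c * h u x) *s u)"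
    by (rule linear_scale_funI) (auto simp: herm_add herm_scale fun_eq_iff algebra_simps)
  then show ?thesis by (simp add: transvection_def Abs_endo_inverse)
qed

lemma transvection_conjugate:
  assumes "g \<in> carrier G"
  shows "rep (inv g) * transvection c u * rep g = transvection c (act (inv g) u)"
  using act_inv[OF assms] herm_act[OF assms] by (intro endo_eqI) (simp add: app.add app.scale)

lemma transvection_inverse:
  assumes "h u u = 0"
  shows "transvection (- c) u * transvection c u = 1"
  using assms by (intro endo_eqI ext) (simp add: herm_add herm_scale)

lemma transvectionE:
  assumes u: "u \<in> W" "h u u = 0" and c: "c ^ q = - c"
  obtains a where "a \<in> carrier G" "rep a = transvection c u"
proof (rule mat_like_isometryE)
  have u_trunc: "app (trunc n) u = u" using u(1) by (simp add: coord_space_def)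
  have herm_trunc: "h u (app (trunc n) x) = h u x" for x by (simp add: herm_def app_trunc)
  show "mat_like n (transvection c u)"
    unfolding mat_like_def
    by (intro conjI endo_eqI)
      (simp_all add: app.add app.diff app.scale u_trunc herm_trunc herm_diff)
  fix x y
  have "h u x ^ q = h x u" using herm_conjugate[of x u] by simp
  then have "h (x + (c * h u x) *s u) (y + (c * h u y) *s u)
      = h x y + c * h u y * h x u + c ^ q * h x u * h u y"
    by (simp add: herm_add herm_scale u(2) power_mult_distrib)
  then show "h (app (transvection c u) x) (app (transvection c u) y) = h x y"
    by (simp add: c)
qed (rule that)

lemma exists_skew: "\<exists>c::'a. c \<noteq> 0 \<and> c ^ q = - c"
proof -
  have "\<exists>y::'a. y ^ q \<noteq> y"
  proof (rule ccontr)
    assume fixes_all: "\<nexists>y::'a. y ^ q \<noteq> y"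
    let ?P = "monom 1 q - monom 1 1 :: 'a poly"
    have "coeff ?P q = 1" using q_ge_2 by simp
    then have "?P \<noteq> 0" by (metis coeff_0 zero_neq_one)
    then have "card {y. poly ?P y = 0} \<le> degree ?P" by (rule card_poly_roots_bound)
    moreover have "{y. poly ?P y = 0} = UNIV" using fixes_all by (auto simp: poly_monom)
    moreover have "degree ?P \<le> q"
      using q_ge_2 by (intro degree_diff_le) (auto intro: order.trans[OF degree_monom_le])
    ultimately have "q ^ 2 \<le> q" using card_field by simp
    then show False using q_ge_2 by (simp add: power2_eq_square)
  qed
  then obtain y :: 'a where y: "y ^ q \<noteq> y" by blast
  have "(y ^ q - y) ^ q = - (y ^ q - y)" by (simp add: power_q_diff power_q_q)
  then show ?thesis using y by (intro exI[of _ "y ^ q - y"]) simp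
qed

end

locale defining_unitary_sylow = unitary_sylow +
  assumes p_gt_3: "p > 3" and p_zero: "of_nat p = (0 :: 'a)"
begin

lemma CHAR_eq_p: "CHAR('a) = p"
  using p_zero of_nat_eq_0_iff_char_dvd[where 'a = 'a, of p] primes_dvd_imp_eq prime_CHAR prime_p
  by blast

lemma two_neq_zero: "(2 :: 'a) \<noteq> 0"
proof
  assume "(2 :: 'a) = 0"
  then have "p dvd 2" using of_nat_eq_0_iff_char_dvd[where 'a = 'a, of 2] CHAR_eq_p by simp
  then show False using p_gt_3 by (auto dest: dvd_imp_le)
qed

lemma p_group_additive_group:
  assumes "fun_space.subspace M" "M \<subseteq> W"
  shows "p_group p (additive_group M)"
proof -
  obtain e where "q = p ^ e" using q_eq_power_CHAR CHAR_eq_p by blast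
  then have "card W = p ^ (e * 2 * n)"
    using card_coord_space[of n, where 'a = 'a] card_field by (simp add: power_mult)
  then have "p_group p (additive_group W)"
    using group_additive_group[OF subspace_coord_space] by (auto simp: p_group_def order_def)
  then have "p_group p ((additive_group W)\<lparr>carrier := M\<rparr>)"
    using p_group_subgroup prime_p
      subgroup_additive_group[OF assms(1) subspace_coord_space assms(2)] by blast
  then show ?thesis by (simp add: additive_group_def)
qed

lemma exists_fixed_vector_modulo:
  assumes T: "subgroup T G" "T \<subseteq> S"
    and M: "fun_space.subspace M" "M \<subseteq> W" "\<And>g x. \<lbrakk>g \<in> T; x \<in> M\<rbrakk> \<Longrightarrow> act g x \<in> M"
    and N: "fun_space.subspace N" "N \<subset> M" "\<And>g x. \<lbrakk>g \<in> T; x \<in> N\<rbrakk> \<Longrightarrow> act g x \<in> N"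
  shows "\<exists>x\<in>M - N. \<forall>g\<in>T. act g x - x \<in> N"
proof -
  note T_carrier = subgroup.mem_carrier[OF T(1)]
  interpret automorphism_action "G\<lparr>carrier := T\<rparr>" "additive_group M" act
  proof (intro automorphism_action.intro automorphism_action_axioms.intro)
    show "group (G\<lparr>carrier := T\<rparr>)" "group (additive_group M)"
      using subgroup_imp_group[OF T(1)] group_additive_group[OF M(1)] by auto
  qed (use M(3) T_carrier in \<open>simp_all add: app.add act_mult rep_one\<close>)
  have "subgroup N (additive_group M)" using subgroup_additive_group[OF N(1) M(1)] N(2) by blast
  then have "\<exists>x\<in>carrier (additive_group M) - N.
      \<forall>g\<in>carrier (G\<lparr>carrier := T\<rparr>). act g x \<otimes>\<^bsub>additive_group M\<^esub> inv\<^bsub>additive_group M\<^esub> x \<in> N"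
    using exists_fixed_modulo[of N, OF _ _ prime_p p_group_of_subset[OF T]]
      p_group_additive_group[OF M(1,2)]
      N(2,3) by auto
  then show ?thesis using inv_additive_group[OF M(1)] by auto
qed

definition isotropic_invariant :: "(nat \<Rightarrow> 'a) set \<Rightarrow> bool" where
  "isotropic_invariant U \<longleftrightarrow> fun_space.subspace U \<and> U \<subseteq> W \<and>
     (\<forall>u\<in>U. \<forall>v\<in>U. h u v = 0) \<and> (\<forall>g\<in>S. \<forall>u\<in>U. act g u \<in> U)"

lemma isotropic_invariantD:
  assumes "isotropic_invariant U"
  shows "fun_space.subspace U" "U \<subseteq> W" "\<lbrakk>u \<in> U; v \<in> U\<rbrakk> \<Longrightarrow> h u v = 0"
    "\<lbrakk>g \<in> S; u \<in> U\<rbrakk> \<Longrightarrow> act g u \<in> U" "U \<subseteq> perp U"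
  using assms unfolding isotropic_invariant_def perp_def by auto

lemma isotropic_invariant_insert:
  assumes U: "isotropic_invariant U" and x: "x \<in> perp U" "h x x = 0" "\<And>g. g \<in> S \<Longrightarrow> act g x - x \<in> U"
  shows "isotropic_invariant (fun_space.span (insert x U))"
proof -
  note U_props = isotropic_invariantD[OF U]
  have x_in_W: "x \<in> W" and herm_x: "h u x = 0" "h x u = 0" if "u \<in> U" for u
    using x(1) that herm_eq_0_commute unfolding perp_def by auto
  have mem_iff: "a \<in> fun_space.span (insert x U) \<longleftrightarrow> (\<exists>u\<in>U. \<exists>c. a = u + c *s x)" for a
  proof -
    have "fun_space.span U = U" using U_props(1) fun_space.span_eq_iff by blast
    then have "a \<in> fun_space.span (insert x U) \<longleftrightarrow> (\<exists>c. a - c *s x \<in> U)"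
      by (simp only: fun_space.span_insert mem_Collect_eq)
    then show ?thesis by (metis add_diff_cancel_right' diff_add_cancel)
  qed
  show ?thesis
    unfolding isotropic_invariant_def
  proof (intro conjI ballI)
    show "fun_space.subspace (fun_space.span (insert x U))" by simp
    show "fun_space.span (insert x U) \<subseteq> W"
      using x_in_W U_props(2) subspace_coord_space x(1)
      by (intro fun_space.span_minimal) (auto simp: perp_def)
    fix a assume "a \<in> fun_space.span (insert x U)"
    then obtain u c where a: "u \<in> U" "a = u + c *s x" unfolding mem_iff by blast
    show "h a b = 0" if b: "b \<in> fun_space.span (insert x U)" for b
    proof -
      obtain v d where "v \<in> U" "b = v + d *s x" using b unfolding mem_iff by blast
      then show ?thesis using a by (simp add: herm_add herm_scale herm_x x(2) U_props(3))
    qed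
    show "act g a \<in> fun_space.span (insert x U)" if g: "g \<in> S" for g
    proof -
      have "act g a = (act g u + c *s (act g x - x)) + c *s x"
        unfolding a(2) by (simp add: app.add app.scale fun_space.scale_right_diff_distrib)
      moreover have "act g u + c *s (act g x - x) \<in> U"
        using U_props(1,4) g a(1) x(3)[OF g]
        by (simp add: fun_space.subspace_add fun_space.subspace_scale)
      ultimately show ?thesis unfolding mem_iff by blast
    qed
  qed
qed

lemma exists_maximal_isotropic_invariant:
  obtains U where "isotropic_invariant U" "\<And>U'. \<lbrakk>isotropic_invariant U'; U \<subseteq> U'\<rbrakk> \<Longrightarrow> U = U'"
proof -
  have "Collect isotropic_invariant \<subseteq> Pow W" by (auto simp: isotropic_invariant_def)
  then have "finite (Collect isotropic_invariant)"
    using finite_coord_space[of n, where 'a = 'a] finite_subset by blast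
  moreover have "isotropic_invariant {0}"
    by (simp add: isotropic_invariant_def W_closed(1))
  ultimately show thesis using that finite_has_maximal[of "Collect isotropic_invariant"] by blast
qed

definition fixed_modulo :: "(nat \<Rightarrow> 'a) set \<Rightarrow> (nat \<Rightarrow> 'a) set" where
  "fixed_modulo U = {v \<in> perp U. \<forall>g\<in>S. act g v - v \<in> U}"

lemma act_fixed_modulo:
  assumes U: "isotropic_invariant U" and g: "g \<in> S" and v: "v \<in> fixed_modulo U"
  shows "act g v \<in> fixed_modulo U"
proof -
  note U_props = isotropic_invariantD[OF U]
  have "v \<in> perp U" "act g v - v \<in> U" using v g by (auto simp: fixed_modulo_def)
  then have "v + (act g v - v) \<in> perp U"
    using fun_space.subspace_add[OF subspace_perp] U_props(5) by blast
  moreover have "act k (act g v) - act g v \<in> U" if k: "k \<in> S" for k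
  proof -
    have "act k (act g v) - act g v = act k (act g v - v) - (act g v - v) + (act k v - v)"
      by (simp add: app.diff)
    moreover have "act k v - v \<in> U" using v k by (simp add: fixed_modulo_def)
    ultimately show ?thesis
      using U_props(1) U_props(4)[OF k] \<open>act g v - v \<in> U\<close>
      by (simp only: fun_space.subspace_add fun_space.subspace_diff)
  qed
  ultimately show ?thesis by (simp add: fixed_modulo_def)
qed

text \<open>A fixed vector of \<open>S\<close> modulo \<open>U\<close> that is orthogonal to all such vectors is isotropic and
  hence enlarges \<open>U\<close>; so by maximality only \<open>U\<close> is orthogonal to the fixed vectors.\<close>

lemma perp_fixed_modulo_subset:
  assumes U: "isotropic_invariant U" and maximal: "\<And>U'. \<lbrakk>isotropic_invariant U'; U \<subseteq> U'\<rbrakk> \<Longrightarrow> U = U'"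
  shows "perp (fixed_modulo U) \<subseteq> U"
proof (rule ccontr)
  let ?R = "perp (fixed_modulo U)"
  note U_props = isotropic_invariantD[OF U]
  assume "\<not> ?R \<subseteq> U"
  have act_R: "act g x \<in> ?R" if "g \<in> S" "x \<in> ?R" for g x
    using act_perp[OF S_closed(1)[OF that(1)] _ that(2)] act_fixed_modulo[OF U]
      S_closed(3)[OF that(1)] by blast
  have "\<exists>x\<in>?R - ?R \<inter> U. \<forall>g\<in>S. act g x - x \<in> ?R \<inter> U"
  proof (rule exists_fixed_vector_modulo[OF subgroup_S order_refl subspace_perp])
    show "fun_space.subspace (?R \<inter> U)" using fun_space.subspace_inter[OF subspace_perp U_props(1)] .
    show "?R \<subseteq> W" by (auto simp: perp_def)
    show "?R \<inter> U \<subset> ?R" using \<open>\<not> ?R \<subseteq> U\<close> by blast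
  qed (use act_R U_props(4) in auto)
  then obtain x where x: "x \<in> ?R" "x \<notin> U" "\<And>g. g \<in> S \<Longrightarrow> act g x - x \<in> U" by blast
  have "U \<subseteq> fixed_modulo U"
    using U_props(4,5) fun_space.subspace_diff[OF U_props(1)] by (auto simp: fixed_modulo_def)
  then have x_perp: "x \<in> perp U" using x(1) perp_antimono by blast
  then have "x \<in> fixed_modulo U" using x(3) by (simp add: fixed_modulo_def)
  then have "h x x = 0" using x(1) by (simp add: perp_def)
  then have "isotropic_invariant (fun_space.span (insert x U))"
    using isotropic_invariant_insert[OF U x_perp _ x(3)] by blast
  then have "U = fun_space.span (insert x U)"
    using maximal fun_space.span_superset[of "insert x U"] by blast
  then show False using x(2) fun_space.span_base[of x "insert x U"] by simp
qed

lemma exists_trivial_on_perp_quotient: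
  obtains U where "isotropic_invariant U" "\<And>g x. \<lbrakk>g \<in> S; x \<in> perp U\<rbrakk> \<Longrightarrow> act g x - x \<in> U"
proof -
  obtain U where U: "isotropic_invariant U"
    and maximal: "\<And>U'. \<lbrakk>isotropic_invariant U'; U \<subseteq> U'\<rbrakk> \<Longrightarrow> U = U'"
    using exists_maximal_isotropic_invariant by blast
  have "act g x - x \<in> U" if g: "g \<in> S" and x: "x \<in> perp U" for g x
  proof -
    have "h t (act g x - x) = 0" if t: "t \<in> fixed_modulo U" for t
    proof -
      have "act (inv g) t - t \<in> U" using t S_closed(3)[OF g] by (simp add: fixed_modulo_def)
      then have "h (act (inv g) t - t) x = 0" using x by (simp add: perp_def)
      then show ?thesis using herm_act[OF S_closed(1)[OF g]] by (simp add: herm_diff)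
    qed
    moreover have "act g x - x \<in> W"
      using x by (simp add: perp_def W_closed act_coord_space)
    ultimately have "act g x - x \<in> perp (fixed_modulo U)" by (simp add: perp_def)
    then show ?thesis using perp_fixed_modulo_subset[OF U maximal] by blast
  qed
  then show thesis using that U by blast
qed

text \<open>The centre of the unipotent radical of the stabilizer of \<open>U\<close> in the unitary group.\<close>

definition radical_centre :: "(nat \<Rightarrow> 'a) set \<Rightarrow> 'a mat set" where
  "radical_centre U = {g \<in> carrier G. (\<forall>x\<in>W. act g x - x \<in> U) \<and> (\<forall>x\<in>perp U. act g x = x)}"

lemma radical_centreD:
  assumes "g \<in> radical_centre U"
  shows "g \<in> carrier G" "x \<in> W \<Longrightarrow> act g x - x \<in> U" "x \<in> perp U \<Longrightarrow> act g x = x"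
  using assms by (auto simp: radical_centre_def)

context
  fixes U
  assumes U: "isotropic_invariant U"
begin

lemmas U_props = isotropic_invariantD[OF U]

lemma displacement_mult:
  assumes g: "g \<in> radical_centre U" and k: "k \<in> radical_centre U" and x: "x \<in> W"
  shows "act (g \<otimes> k) x - x = (act g x - x) + (act k x - x)"
proof -
  have "act g (act k x - x) = act k x - x"
    using radical_centreD(3)[OF g] radical_centreD(2)[OF k x] U_props(5) by blast
  then show ?thesis using act_mult[OF radical_centreD(1)[OF g] radical_centreD(1)[OF k], of x]
    by (simp add: app.diff algebra_simps)
qed

lemma subgroup_radical_centre: "subgroup (radical_centre U) G"
proof (rule subgroupI)
  show "radical_centre U \<subseteq> carrier G" by (auto simp: radical_centre_def)
  have "\<one> \<in> radical_centre U"
    using fun_space.subspace_0[OF U_props(1)] by (simp add: radical_centre_def rep_one)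
  then show "radical_centre U \<noteq> {}" by blast
  fix g assume g: "g \<in> radical_centre U"
  note g_carrier = radical_centreD(1)[OF g]
  have "act (inv g) x - x \<in> U" if x: "x \<in> W" for x
  proof -
    have "act g (act (inv g) x) - act (inv g) x \<in> U"
      using radical_centreD(2)[OF g act_coord_space[OF x]] .
    then show ?thesis
      using fun_space.subspace_neg[OF U_props(1)] act_inv(1)[OF g_carrier] by fastforce
  qed
  then show "inv g \<in> radical_centre U"
    using g_carrier act_inv_fixed[OF g_carrier] radical_centreD(3)[OF g]
    by (simp add: radical_centre_def)
  fix k assume k: "k \<in> radical_centre U"
  have "act (g \<otimes> k) x - x \<in> U" if "x \<in> W" for x
    unfolding displacement_mult[OF g k that]
    using radical_centreD(2)[OF g that] radical_centreD(2)[OF k that]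
      fun_space.subspace_add[OF U_props(1)] by blast
  moreover have "act (g \<otimes> k) x = x" if "x \<in> perp U" for x
    using act_mult[OF g_carrier radical_centreD(1)[OF k]] radical_centreD(3)[OF g that]
      radical_centreD(3)[OF k that] by simp
  ultimately show "g \<otimes> k \<in> radical_centre U"
    using g_carrier radical_centreD(1)[OF k] by (simp add: radical_centre_def)
qed

lemma radical_centre_commute:
  assumes g: "g \<in> radical_centre U" and k: "k \<in> radical_centre U"
  shows "g \<otimes> k = k \<otimes> g"
proof (rule carrier_eqI)
  note in_carrier = radical_centreD(1)[OF g] radical_centreD(1)[OF k]
  show "g \<otimes> k \<in> carrier G" "k \<otimes> g \<in> carrier G" using in_carrier by simp_all
  fix x assume x: "x \<in> W"
  have "act (g \<otimes> k) x - x = act (k \<otimes> g) x - x"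
    unfolding displacement_mult[OF g k x] displacement_mult[OF k g x] by (rule add.commute)
  then show "act (g \<otimes> k) x = act (k \<otimes> g) x" by simp
qed

lemma displacement_pow:
  assumes g: "g \<in> radical_centre U" and x: "x \<in> W"
  shows "act (g [^] (k::nat)) x - x = of_nat k *s (act g x - x)"
proof (induction k)
  case 0
  then show ?case by (simp add: rep_one)
next
  case (Suc k)
  have "g [^] k \<in> radical_centre U"
    using subgroup_int_pow_closed[OF subgroup_radical_centre g, of "int k"]
    by (simp add: int_pow_int)
  from displacement_mult[OF this g x]
  have "act (g [^] Suc k) x - x = of_nat k *s (act g x - x) + (act g x - x)"
    by (simp only: nat_pow_Suc Suc)
  then show ?case
    by (simp only: of_nat_Suc fun_space.scale_left_distrib fun_space.scale_one add.commute)
qed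

lemma radical_centre_pow_p:
  assumes g: "g \<in> radical_centre U"
  shows "g [^] p = \<one>"
proof (rule carrier_eqI)
  show "g [^] p \<in> carrier G" "\<one> \<in> carrier G" using radical_centreD(1)[OF g] by simp_all
  show "act (g [^] p) x = act \<one> x" if "x \<in> W" for x
    using displacement_pow[OF g that, of p] p_zero by (simp add: rep_one)
qed

lemma S_normalizes_radical_centre: "S \<subseteq> normalizer G (radical_centre U)"
proof (rule subset_normalizerI[OF subgroup_S subgroup.subset[OF subgroup_radical_centre]])
  fix s g assume s: "s \<in> S" and g: "g \<in> radical_centre U"
  note s_carrier = S_closed(1)[OF s] and g_carrier = radical_centreD(1)[OF g]
  have act_conj: "act (s \<otimes> g \<otimes> inv s) x = act s (act g (act (inv s) x))" for x
    using s_carrier g_carrier by (simp add: act_mult)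
  have "act (s \<otimes> g \<otimes> inv s) x - x \<in> U" if x: "x \<in> W" for x
  proof -
    let ?y = "act (inv s) x"
    have "act s (act g ?y - ?y) \<in> U"
      using U_props(4)[OF s radical_centreD(2)[OF g act_coord_space[OF x]]] .
    then show ?thesis unfolding act_conj by (simp add: app.diff act_inv(1)[OF s_carrier])
  qed
  moreover have "act (s \<otimes> g \<otimes> inv s) x = x" if x: "x \<in> perp U" for x
  proof -
    have "act (inv s) x \<in> perp U"
      using act_perp[of "inv s" U x] x s_carrier U_props(4)[OF s] by simp
    then show ?thesis
      unfolding act_conj using radical_centreD(3)[OF g] act_inv(1)[OF s_carrier] by simp
  qed
  ultimately show "s \<otimes> g \<otimes> inv s \<in> radical_centre U"
    using s_carrier g_carrier by (simp add: radical_centre_def)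
qed

lemma elab_radical_centre: "elab (radical_centre U)"
  unfolding elem_abelian_sub_def
  using subgroup_radical_centre radical_centre_commute radical_centre_pow_p
    normalized_exponent_p_subset_S[OF subgroup_radical_centre S_normalizes_radical_centre] by blast

lemma radical_centre_commute_if_fixes_U:
  assumes g: "g \<in> carrier G" "\<And>u. u \<in> U \<Longrightarrow> act g u = u" and a: "a \<in> radical_centre U"
  shows "g \<otimes> a = a \<otimes> g"
proof (rule carrier_eqI)
  note a_carrier = radical_centreD(1)[OF a]
  show "g \<otimes> a \<in> carrier G" "a \<otimes> g \<in> carrier G" using g(1) a_carrier by simp_all
  fix x assume x: "x \<in> W"
  have "act g (act a x - x) = act a x - x" using g(2) radical_centreD(2)[OF a x] by blast
  then have "act g (act a x) = act g x + (act a x - x)"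
    by (simp add: app.diff diff_eq_eq add.commute)
  moreover have "act a (act g x - x) = act g x - x"
    using radical_centreD(3)[OF a] displacement_in_perp[OF g x] by blast
  then have "act a (act g x) = act a x + (act g x - x)"
    by (simp add: app.diff diff_eq_eq add.commute)
  ultimately show "act (g \<otimes> a) x = act (a \<otimes> g) x"
    using g(1) a_carrier by (simp add: act_mult)
qed

lemma exists_nilpotent_displacement:
  assumes g: "g \<in> S" and u: "u \<in> U" "act g u \<noteq> u"
  shows "\<exists>y\<in>U. act g y \<noteq> y \<and> act g (act g y - y) = act g y - y"
proof -
  note g_carrier = S_closed(1)[OF g]
  let ?N = "{x \<in> U. act g x = x}"
  have T: "subgroup (C_S {g}) G" using subgroup_centralizer_in[OF subgroup_S] g_carrier by simp
  have "\<exists>x\<in>U - ?N. \<forall>s\<in>C_S {g}. act s x - x \<in> ?N"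
  proof (rule exists_fixed_vector_modulo[OF T centralizer_in_subset U_props(1,2)])
    show "fun_space.subspace ?N"
      using U_props(1) by (intro fun_space.subspaceI)
        (auto simp: app.add app.scale fun_space.subspace_0 fun_space.subspace_add
          fun_space.subspace_scale)
    show "?N \<subset> U" using u by blast
    fix s x assume s: "s \<in> C_S {g}"
    then have s_in_S: "s \<in> S" "s \<otimes> g = g \<otimes> s" by (auto simp: centralizer_in_def)
    then show "act s x \<in> U" if "x \<in> U" using U_props(4) that by blast
    have "act g (act s x) = act s (act g x)"
      using act_mult[OF g_carrier S_closed(1)[OF s_in_S(1)]]
        act_mult[OF S_closed(1)[OF s_in_S(1)] g_carrier] s_in_S(2) by metis
    then show "act s x \<in> ?N" if "x \<in> ?N" using U_props(4)[OF s_in_S(1)] that by simp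
  qed
  moreover have "g \<in> C_S {g}" using g by (simp add: centralizer_in_def)
  ultimately show ?thesis by blast
qed

lemma transvection_in_radical_centre:
  assumes "a \<in> carrier G" "rep a = transvection c y" "y \<in> U"
  shows "a \<in> radical_centre U"
  using assms fun_space.subspace_scale[OF U_props(1)] by (simp add: radical_centre_def perp_def)

text \<open>For the transvection \<open>a\<close> along \<open>y\<close> and \<open>d = y\<^sup>g - y\<close>, the second difference of the quadratic
  expression \<open>h(y, x) y\<close> in \<open>y\<close> is \<open>2 h(d, x) d\<close>.\<close>

lemma displacement_eq_0_if_quadratic_on_transvection:
  assumes g: "g \<in> carrier G" and y: "y \<in> U"
    and d: "act (inv g) y = y + d" "d \<in> U" "act (inv g) d = d"
    and c: "c \<noteq> 0" and a: "a \<in> carrier G" "rep a = transvection c y"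
    and commute: "commutator G a g \<otimes> g = g \<otimes> commutator G a g"
  shows "d = 0"
proof -
  define b where "b = commutator G a g"
  have b_carrier: "b \<in> carrier G" using a(1) g by (simp add: b_def)
  have "transvection (- c) y * rep a = 1"
    using transvection_inverse[OF U_props(3)[OF y y]] a(2) by simp
  then have "rep (inv a) = transvection (- c) y"
    using rep_inv(2)[OF a(1)] by (metis mult.assoc mult_1 mult_1_right)
  moreover have "rep b = rep (inv a) * (rep (inv g) * rep a * rep g)"
    unfolding b_def commutator_def using a(1) g by (simp add: rep_mult mult.assoc)
  ultimately have rep_b: "rep b = transvection (- c) y * transvection c (y + d)"
    using transvection_conjugate[OF g, of c y] a(2) d(1) by simp
  have h_y: "h y y = 0" "h y d = 0" "h d y = 0" "h d d = 0" using U_props(3) y d(2) by blast+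
  have act_b: "act b x = x + (c * h (y + d) x) *s (y + d) - (c * h y x) *s y" for x
    unfolding rep_b by (simp add: herm_add herm_scale h_y fun_eq_iff)
  have d_d: "act (inv g) (y + d) = y + d + d" using d by (simp add: app.add)
  have "inv g \<otimes> b \<otimes> g = b" using commute b_carrier g by (simp add: b_def m_assoc inv_mult_cancel)
  then have fixed: "act (inv g) (act b (act g x)) = act b x" for x
    using b_carrier g by (metis act_mult inv_closed m_closed)
  have "(2 * c * h d x) *s d = 0" for x
  proof -
    have "act b x = act (inv g) (act b (act g x))" by (rule fixed[symmetric])
    also have "\<dots> = x + (c * h (y + d + d) x) *s (y + d + d) - (c * h (y + d) x) *s (y + d)"
      unfolding act_b herm_act[OF g] d_d d(1)
      by (simp add: app.add app.diff app.scale d(1,3) act_inv(2)[OF g])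
    finally have "x + (c * h (y + d) x) *s (y + d) - (c * h y x) *s y
        = x + (c * h (y + d + d) x) *s (y + d + d) - (c * h (y + d) x) *s (y + d)"
      unfolding act_b .
    then show ?thesis unfolding herm_add by (simp add: fun_eq_iff algebra_simps)
  qed
  then have "h d x = 0 \<or> d = 0" for x using c two_neq_zero by (simp add: fun_eq_iff)
  then have "d = 0 \<or> (\<forall>x. h x d = 0)" using herm_eq_0_commute by blast
  then show "d = 0" using herm_nondegenerate d(2) U_props(2) by blast
qed

lemma fixes_U_if_acts_quadratically:
  assumes g: "g \<in> S" "acts_quadratically (radical_centre U) g" and u: "u \<in> U"
  shows "act g u = u"
proof (rule ccontr)
  note g_carrier = S_closed(1)[OF g(1)]
  have inv_g_in_S: "inv g \<in> S" using S_closed(3)[OF g(1)] .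
  assume "act g u \<noteq> u"
  then have "act (inv g) u \<noteq> u" using act_inv_fixed[of "inv g" u] g_carrier by auto
  then obtain y where y: "y \<in> U" "act (inv g) y \<noteq> y"
    "act (inv g) (act (inv g) y - y) = act (inv g) y - y"
    using exists_nilpotent_displacement[OF inv_g_in_S u] by blast
  define d where "d = act (inv g) y - y"
  have d_in_U: "d \<in> U"
    unfolding d_def
    using fun_space.subspace_diff[OF U_props(1) U_props(4)[OF inv_g_in_S y(1)] y(1)] .
  obtain c :: 'a where c: "c \<noteq> 0" "c ^ q = - c" using exists_skew by blast
  obtain a where a: "a \<in> carrier G" "rep a = transvection c y"
    using transvectionE[OF _ U_props(3)[OF y(1) y(1)] c(2)] U_props(2) y(1) by blast
  have "commutator G a g \<otimes> g = g \<otimes> commutator G a g"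
    using g(2) transvection_in_radical_centre[OF a y(1)]
      acts_quadratically_iff_commute[OF subgroup.subset[OF subgroup_radical_centre] g_carrier]
      by blast
  then have "d = 0"
    using displacement_eq_0_if_quadratic_on_transvection[OF g_carrier y(1) _ d_in_U _ c(1) a] y(3)
    by (simp add: d_def)
  then show False using y(2) by (simp add: d_def)
qed

lemma centralizer_radical_centre_iff:
  "g \<in> C_S (radical_centre U) \<longleftrightarrow> g \<in> S \<and> (\<forall>u\<in>U. act g u = u)"
proof
  assume g: "g \<in> C_S (radical_centre U)"
  then have g_in_S: "g \<in> S" using centralizer_in_subset by blast
  have "commutator G (commutator G a g) g = \<one>" if "a \<in> radical_centre U" for a
    using centralizer_in_commute[OF g that] commutator_eq_one_iff[of a g]
      commutator_eq_one_iff[of \<one> g] radical_centreD(1)[OF that] S_closed(1)[OF g_in_S] by simp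
  then have "acts_quadratically (radical_centre U) g" by (simp add: acts_quadratically_def)
  then show "g \<in> S \<and> (\<forall>u\<in>U. act g u = u)" using g_in_S fixes_U_if_acts_quadratically by blast
next
  assume "g \<in> S \<and> (\<forall>u\<in>U. act g u = u)"
  then show "g \<in> C_S (radical_centre U)"
    using radical_centre_commute_if_fixes_U S_closed(1) by (simp add: centralizer_in_def)
qed

context
  assumes trivial_quotient: "\<And>g x. \<lbrakk>g \<in> S; x \<in> perp U\<rbrakk> \<Longrightarrow> act g x - x \<in> U"
begin

lemma commutator_in_radical_centre:
  assumes g: "g \<in> S" "\<And>u. u \<in> U \<Longrightarrow> act g u = u" and k: "k \<in> S" "\<And>u. u \<in> U \<Longrightarrow> act k u = u"
  shows "commutator G g k \<in> radical_centre U"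
proof -
  note g_carrier = S_closed(1)[OF g(1)] and k_carrier = S_closed(1)[OF k(1)]
  let ?m = "inv (k \<otimes> g)"
  have "commutator G g k = ?m \<otimes> (g \<otimes> k)"
    using g_carrier k_carrier by (simp add: commutator_def word_simps)
  then have act_commutator:
    "act (commutator G g k) x - x = act ?m (act g (act k x) - act k (act g x))" for x
    using g_carrier k_carrier act_inv(2)[of "k \<otimes> g" x] by (simp add: act_mult app.diff)
  have fixes_U: "act ?m u = u" if "u \<in> U" for u
    using act_inv_fixed[of "k \<otimes> g" u] g_carrier k_carrier g(2)[OF that] k(2)[OF that]
    by (simp add: act_mult)
  have difference: "act g (act k x) - act k (act g x)
      = (act g (act k x - x) - (act k x - x)) - (act k (act g x - x) - (act g x - x))" for x
    by (simp add: app.diff algebra_simps)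
  have "act (commutator G g k) x - x \<in> U" if x: "x \<in> W" for x
  proof -
    have "act g (act k x) - act k (act g x) \<in> U"
      unfolding difference
      using trivial_quotient[OF g(1) displacement_in_perp[OF k_carrier k(2) x]]
        trivial_quotient[OF k(1) displacement_in_perp[OF g_carrier g(2) x]]
        fun_space.subspace_diff[OF U_props(1)] by blast
    then show ?thesis unfolding act_commutator using fixes_U by simp
  qed
  moreover have "act (commutator G g k) x = x" if x: "x \<in> perp U" for x
  proof -
    have "act g (act k x) - act k (act g x) = 0"
      unfolding difference
      using g(2)[OF trivial_quotient[OF k(1) x]] k(2)[OF trivial_quotient[OF g(1) x]] by simp
    then have "act (commutator G g k) x - x = 0" unfolding act_commutator by simp
    then show ?thesis by simp
  qed
  ultimately show ?thesis using g_carrier k_carrier by (simp add: radical_centre_def)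
qed

lemma centralizer_radical_centre_subset_oliver: "C_S (radical_centre U) \<subseteq> oliver"
proof (rule subset_oliver_if_iter_comm_trivial)
  let ?A = "radical_centre U"
  let ?Q = "C_S ?A"
  have "normal_S ?A"
    using subgroup_radical_centre elabD(2)[OF elab_radical_centre] S_normalizes_radical_centre
    by (simp add: normal_in_S_iff)
  then show normal: "normal_S ?Q" by (rule normal_S_centralizer)
  note Q = normal_SD[OF normal]
  have "comm_sub G S ?Q \<subseteq> ?Q"
    using comm_sub_subset[OF Q(1)] commutator_in_normalized(1)[OF Q(1)] Q(3) by blast
  moreover have "comm_sub G ?Q ?Q \<subseteq> ?A"
    using comm_sub_subset[OF subgroup_radical_centre] commutator_in_radical_centre
      centralizer_radical_centre_iff by metis
  moreover have "comm_sub G ?A ?Q \<subseteq> {\<one>}"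
    using comm_sub_trivial[OF subgroup.subset[OF subgroup_radical_centre] Q(4)]
      centralizer_in_commute by metis
  ultimately have "comm_sub G (comm_sub G (comm_sub G S ?Q) ?Q) ?Q \<subseteq> {\<one>}"
    by (meson comm_sub_mono order_refl order_trans)
  then show "iter_comm G S ?Q 3 \<subseteq> {\<one>}" by (simp add: numeral_3_eq_3)
  show "3 < p" by (rule p_gt_3)
qed

end

end

theorem thompson_subset_oliver_defining: "thompson_subgroup G p S \<subseteq> oliver"
proof -
  obtain U where U: "isotropic_invariant U"
    and trivial_quotient: "\<And>g x. \<lbrakk>g \<in> S; x \<in> perp U\<rbrakk> \<Longrightarrow> act g x - x \<in> U"
    using exists_trivial_on_perp_quotient by blast
  have "thompson_subgroup G p S \<subseteq> C_S (radical_centre U)"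
    using thompson_subgroup_le_centralizer[OF elab_radical_centre[OF U]]
      S_normalizes_radical_centre[OF U]
      fixes_U_if_acts_quadratically[OF U] centralizer_radical_centre_iff[OF U] by blast
  then show ?thesis using centralizer_radical_centre_subset_oliver[OF U trivial_quotient] by blast
qed

end

theorem theorem1p2:
  fixes n p q :: nat and S :: "'a::{field,finite} mat set"
  assumes "n \<ge> 1" and "Factorial_Ring.prime p" and "p \<ge> 5" and "prime_power q"
    and "card (UNIV :: 'a set) = q ^ 2"
    and "sylow_subgroup (unitary_group q n :: 'a mat monoid) p S"
  shows "thompson_subgroup (unitary_group q n :: 'a mat monoid) p S
           \<subseteq> oliver_subgroup (unitary_group q n :: 'a mat monoid) p S"
proof -
  interpret unitary_sylow q n "unitary_group q n :: 'a mat monoid" p S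
    by unfold_locales (use assms in simp_all)
  show ?thesis
  proof (cases "of_nat p = (0 :: 'a)")
    case True
    then interpret defining_unitary_sylow q n "unitary_group q n :: 'a mat monoid" p S
      by unfold_locales (use assms in simp_all)
    show ?thesis by (rule thompson_subset_oliver_defining)
  next
    case False
    then interpret coprime_unitary_sylow q n "unitary_group q n :: 'a mat monoid" p S
      by unfold_locales (use assms in simp_all)
    show ?thesis by (rule thompson_subset_oliver_coprime)
  qed
qed

end
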